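(* For any $\epsilon>0$, there exist $\delta>0$ and $p_0\in\mathbb{N}$ such that for all primes $p>p_0$ and for all 1-bounded functions $f_0, f_1, f_2, f_3:\mathbb{F}_p\to\mathbb{C}$ such that at least one of $f_0, f_1, f_2$ satisfies $\|f_i\|_{u^3}\leqslant \delta$ or $f_3$ satisfies $\|f_3\|_{U^2}\leqslant \delta$, we have $$\left|\mathbb{E}_{x,y\in\mathbb{F}_p}f_0(x)f_1(x+y)f_2(x+2y)f_3(x+y^2)\right|\leqslant \epsilon.$$
   Context: A function $f:\mathbb{F}_p\to\mathbb{C}$ is 1-bounded if $|f|\leqslant 1$ pointwise. $\mathbb{E}$ denotes averaging, $e_p(x)=e^{2\pi i x/p}$. $\|f\|_{U^2}=\left(\mathbb{E}_{x,h_1,h_2\in\mathbb{F}_p}f(x)\overline{f(x+h_1)}\,\overline{f(x+h_2)}f(x+h_1+h_2)\right)^{1/4}$. The polynomial bias norm of degree 3 is $\|f\|_{u^3}=\max_{\alpha,\beta\in\mathbb{F}_p}\left|\mathbb{E}_{x\in\mathbb{F}_p}f(x)e_p(\alpha x^2+\beta x)\right|$. *)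

theory Defs
  imports "HOL-Analysis.Analysis" "HOL-Number_Theory.Residues"
begin

text \<open>
  Since \<open>p\<close> is quantified inside the statement, the field with \<open>p\<close> elements is the structure
  \<^const>\<open>residue_ring\<close>, with carrier \<open>{0..int p - 1}\<close>. A function on it is rendered as a
  function on \<^typ>\<open>int\<close> that is only ever evaluated on the carrier; its other values play
  no role.
\<close>

abbreviation F :: "nat \<Rightarrow> int ring" where
  "F p \<equiv> residue_ring (int p)"

definition one_bounded :: "nat \<Rightarrow> (int \<Rightarrow> complex) \<Rightarrow> bool" where
  "one_bounded p f \<longleftrightarrow> (\<forall>x\<in>carrier (F p). cmod (f x) \<le> 1)"

definition avg :: "'a set \<Rightarrow> ('a \<Rightarrow> complex) \<Rightarrow> complex" where
  "avg A g = (\<Sum>a\<in>A. g a) / of_nat (card A)"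

definition e_p :: "nat \<Rightarrow> int \<Rightarrow> complex" where
  "e_p p x = exp (2 * of_real pi * \<i> * of_int x / of_nat p)"

definition U2_avg :: "nat \<Rightarrow> (int \<Rightarrow> complex) \<Rightarrow> complex" where
  "U2_avg p f = avg (carrier (F p) \<times> carrier (F p) \<times> carrier (F p))
     (\<lambda>(x, h1, h2). f x * cnj (f (x \<oplus>\<^bsub>F p\<^esub> h1)) * cnj (f (x \<oplus>\<^bsub>F p\<^esub> h2))
                     * f (x \<oplus>\<^bsub>F p\<^esub> h1 \<oplus>\<^bsub>F p\<^esub> h2))"

text \<open>
  The average \<^term>\<open>U2_avg p f\<close> is always a nonnegative real number (lemma \<open>U2_avg_nonneg\<close>
  below), so passing to the real part before taking the fourth root loses nothing.
\<close>

definition U2_norm :: "nat \<Rightarrow> (int \<Rightarrow> complex) \<Rightarrow> real" where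
  "U2_norm p f = root 4 (Re (U2_avg p f))"

definition u3_norm :: "nat \<Rightarrow> (int \<Rightarrow> complex) \<Rightarrow> real" where
  "u3_norm p f = Max ((\<lambda>(\<alpha>, \<beta>). cmod (avg (carrier (F p))
       (\<lambda>x. f x * e_p p (\<alpha> \<otimes>\<^bsub>F p\<^esub> (x [^]\<^bsub>F p\<^esub> (2::nat)) \<oplus>\<^bsub>F p\<^esub> \<beta> \<otimes>\<^bsub>F p\<^esub> x))))
     ` (carrier (F p) \<times> carrier (F p)))"

lemma U2_avg_nonneg:
  assumes "prime p"
  shows "Im (U2_avg p f) = 0" "Re (U2_avg p f) \<ge> 0"
proof -
  let ?C = "carrier (F p)"
  have p: "int p > 1"
    using prime_gt_1_nat[OF assms] by simp
  interpret residues "int p" "F p"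
    using p by unfold_locales auto
  have fin: "finite ?C"
    by (simp add: finite)
  have bij: "bij_betw (\<lambda>h. x \<oplus>\<^bsub>F p\<^esub> h) ?C ?C" if "x \<in> ?C" for x
    by (rule bij_betwI[where g = "\<lambda>y. \<ominus>\<^bsub>F p\<^esub> x \<oplus>\<^bsub>F p\<^esub> y"])
       (use that in \<open>auto simp: a_assoc[symmetric] r_neg l_neg\<close>)
  define S where "S h = (\<Sum>x\<in>?C. f x * cnj (f (x \<oplus>\<^bsub>F p\<^esub> h)))" for h
  let ?g = "\<lambda>x h1 h2. f x * cnj (f (x \<oplus>\<^bsub>F p\<^esub> h1)) * cnj (f (x \<oplus>\<^bsub>F p\<^esub> h2))
      * f (x \<oplus>\<^bsub>F p\<^esub> h1 \<oplus>\<^bsub>F p\<^esub> h2)"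
  have "(\<Sum>x\<in>?C. \<Sum>h1\<in>?C. \<Sum>h2\<in>?C. ?g x h1 h2)
      = (\<Sum>x\<in>?C. \<Sum>h1\<in>?C. \<Sum>h2\<in>?C.
          (\<lambda>z. f x * cnj (f (x \<oplus>\<^bsub>F p\<^esub> h1)) * cnj (f z) * f (z \<oplus>\<^bsub>F p\<^esub> h1)) (x \<oplus>\<^bsub>F p\<^esub> h2))"
    by (intro sum.cong refl) (simp add: a_assoc a_comm a_lcomm)
  also have "\<dots> = (\<Sum>x\<in>?C. \<Sum>h1\<in>?C. \<Sum>z\<in>?C.
          f x * cnj (f (x \<oplus>\<^bsub>F p\<^esub> h1)) * cnj (f z) * f (z \<oplus>\<^bsub>F p\<^esub> h1))"
    by (rule sum.cong[OF refl], rule sum.cong[OF refl])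
       (simp add: sum.reindex_bij_betw[OF bij,
          where g = "\<lambda>z. f x * cnj (f (x \<oplus>\<^bsub>F p\<^esub> h)) * cnj (f z) * f (z \<oplus>\<^bsub>F p\<^esub> h)" for x h])
  also have "\<dots> = (\<Sum>h1\<in>?C. \<Sum>x\<in>?C. \<Sum>z\<in>?C.
          f x * cnj (f (x \<oplus>\<^bsub>F p\<^esub> h1)) * cnj (f z) * f (z \<oplus>\<^bsub>F p\<^esub> h1))"
    by (rule sum.swap)
  also have "\<dots> = (\<Sum>h1\<in>?C. S h1 * cnj (S h1))"
    by (simp add: S_def sum_product mult.assoc)
  also have "\<dots> = of_real (\<Sum>h1\<in>?C. (cmod (S h1))\<^sup>2)"
    by (simp add: complex_norm_square del: of_real_power)
  finally have "U2_avg p f =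
      of_real ((\<Sum>h1\<in>?C. (cmod (S h1))\<^sup>2) / real (card (?C \<times> ?C \<times> ?C)))"
    by (simp add: U2_avg_def avg_def sum.cartesian_product[symmetric])
  moreover have "0 \<le> (\<Sum>h1\<in>?C. (cmod (S h1))\<^sup>2) / real (card (?C \<times> ?C \<times> ?C))"
    by (intro divide_nonneg_nonneg sum_nonneg) auto
  ultimately show "Im (U2_avg p f) = 0" "Re (U2_avg p f) \<ge> 0"
    by simp_all
qed

end

theory Submission
  imports Defs
begin

text \<open>
  Let \<open>D\<close> be the dual function with \<open>E f0(x) f1(x+y) f2(x+2y) f3(x+y\<^sup>2) = E D
  f3\<close>. If this average is large then so is the one with \<open>f3\<close> replaced by the conjugate of
  \<open>D\<close>, and three applications of Cauchy--Schwarz followed by a linear-forms bound show that the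
  \<open>U\<^sup>7\<close> norm of \<open>D\<close> is large.

  The order of the norm is lowered one by one. If multiplicative derivatives of \<open>D\<close> with
  increments \<open>k\<close> correlate with \<open>e(\<phi>(k) z)\<close>, one writes \<open>D(z + k)\<close>
  times the conjugate of \<open>D(z)\<close> as an average over \<open>(x, y)\<close> and \<open>(x',
  y')\<close> with \<open>z = x + y\<^sup>2\<close> and \<open>z + k = x' + y'\<^sup>2\<close>, and applies
  Cauchy--Schwarz along the curves on which \<open>x\<close>, \<open>x'\<close> and \<open>k\<close> are
  fixed. This makes the phase linear in \<open>\<phi>(k)\<close> with a free scaling parameter. Removing two
  further functions and averaging over that parameter leaves a linear relation with varying coefficients
  between four values of \<open>\<phi>\<close>, valid for a positive proportion of parameters. Counting shows
  that this forces \<open>\<phi>\<close> to be constant on a positive proportion of pairs, which is what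
  degree lowering needs.

  Hence \<open>D\<close> has a large Fourier coefficient, and the identity \<open>2 y\<^sup>2 = x\<^sup>2 - 2
  (x + y)\<^sup>2 + (x + 2 y)\<^sup>2\<close> turns it into a weighted count of 3-term progressions, so each
  of \<open>f0\<close>, \<open>f1\<close>, \<open>f2\<close> correlates with a quadratic phase. For
  \<open>f3\<close>, the same argument is applied to the difference of \<open>D\<close> and its average over a
  large set of shifts on which the characters of its large spectrum are nearly trivial: that difference has no
  large Fourier coefficient, so \<open>f3\<close> correlates with the averaged function, and this is bounded
  by its \<open>U\<^sup>2\<close> norm.
\<close>

section \<open>Averages over residues\<close>

text \<open>The frequencies \<phi>(k) come from a mere choice, so no additive structure can be
  assumed for them. The strength of the relation lies in its coefficients b, b + m, b + l, b + m + l
  with alternating signs, which vary with the points where \<phi> is evaluated. Constant functions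
  always satisfy it, since the signed coefficients add up to 0. For other values of \<phi> there is
  little room: the four points already impose one linear relation on (b, m, l), so a second
  independent one fixes the ratios b : m : l and with them all five parameters, and only O(p^4) of
  the p^5 tuples can arise. Two requirements shape the formulation. Degree lowering has to apply to
  D minus its average over shifts, so it is proved for all combinations of translates of D of total
  weight at most 1. And all losses have to be uniform in p: the number of lowering steps is fixed at
  five, from U^7 to U^2, and each of them costs a fixed power and a term O(1/p) that a large p0
  absorbs.\<close>

lemma dvd_comb2: "P dvd e1 \<Longrightarrow> P dvd e2 \<Longrightarrow> x = c1 * e1 + c2 * e2 \<Longrightarrow> P dvd (x::int)"
  by simp

lemma dvd_comb3: "P dvd e1 \<Longrightarrow> P dvd e2 \<Longrightarrow> P dvd e3 \<Longrightarrow> x = c1 * e1 + c2 * e2 + c3 * e3 \<Longrightarrow> P dvd (x::int)"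
  by simp

lemma dvd_comb4: "P dvd e1 \<Longrightarrow> P dvd e2 \<Longrightarrow> P dvd e3 \<Longrightarrow> P dvd e4
    \<Longrightarrow> x = c1 * e1 + c2 * e2 + c3 * e3 + c4 * e4 \<Longrightarrow> P dvd (x::int)"
  by simp

text \<open>The bound p > 3 makes 2, 3 and 4 invertible; these are the numerical factors that later
  have to be cancelled.\<close>

locale prime_field =
  fixes p :: nat
  assumes prime_p: "prime p" and p_gt3: "p > 3"
begin

lemma p_pos [simp]: "0 < p" and p_ne0 [simp]: "p \<noteq> 0" and p_ge1 [simp]: "Suc 0 \<le> p"
  using p_gt3 by auto

lemma p_ne1 [simp]: "p \<noteq> Suc 0"
  using p_gt3 by simp

lemma prime_int [simp]: "prime (int p)"
  using prime_p by simp

definition av :: "(int \<Rightarrow> 'a::real_normed_field) \<Rightarrow> 'a" (binder "AV " 10) where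
  "av g = (\<Sum>x\<in>{0..<int p}. g x) / of_nat p"

text \<open>Residue classes get no type of their own: functions on them are integer functions that
  are constant on classes (\<open>per\<close>), maps between them are integer maps that respect
  congruence (\<open>pc\<close>). Shifts and dilations are then plain integer arithmetic.\<close>

definition per :: "(int \<Rightarrow> 'a) \<Rightarrow> bool" where
  "per f \<longleftrightarrow> (\<forall>x y. [x = y] (mod int p) \<longrightarrow> f x = f y)"

definition pc :: "(int \<Rightarrow> int) \<Rightarrow> bool" where
  "pc f \<longleftrightarrow> (\<forall>x y. [x = y] (mod int p) \<longrightarrow> [f x = f y] (mod int p))"

named_theorems per_intros

lemma perD: "per f \<Longrightarrow> [x = y] (mod int p) \<Longrightarrow> f x = f y"
  by (simp add: per_def)

lemma per_mod: "per f \<Longrightarrow> f (x mod int p) = f x"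
  by (rule perD) (auto simp: cong_def)

lemma per_of_mod [per_intros]: "per (\<lambda>x. f (x mod int p))"
  by (auto simp: per_def cong_def)

lemma pc_id [per_intros]: "pc (\<lambda>x. x)" and pc_const [per_intros]: "pc (\<lambda>x. c)"
  by (auto simp: pc_def)

lemma pc_ops [per_intros]:
  assumes "pc f" "pc g"
  shows "pc (\<lambda>x. f x + g x)" "pc (\<lambda>x. f x - g x)" "pc (\<lambda>x. f x * g x)"
  using assms by (simp_all add: pc_def cong_add cong_diff cong_mult)

lemma pc_pow [per_intros]: "pc f \<Longrightarrow> pc (\<lambda>x. f x ^ n)"
  by (auto simp: pc_def intro: cong_pow)

lemma per_comp: "per f \<Longrightarrow> pc g \<Longrightarrow> per (\<lambda>x. f (g x))"
  by (auto simp: per_def pc_def)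

lemma per_const [per_intros]: "per (\<lambda>x. c)"
  by (auto simp: per_def)

lemma per_map: "per f \<Longrightarrow> per (\<lambda>x. Q (f x))"
  by (auto simp: per_def)

lemma per_map2: "per f \<Longrightarrow> per g \<Longrightarrow> per (\<lambda>x. Q (f x) (g x))"
  by (simp add: per_def)

lemmas [per_intros] = per_map2 [where Q = "(*)"] per_map2 [where Q = "(+)"] per_map2 [where Q = "(-)"]
  per_map [where Q = cnj] per_map [where Q = "norm"] per_map [where Q = "of_real"]
  per_map [where Q = "\<lambda>x. x ^ n" for n] per_map [where Q = "of_bool"] per_map [where Q = "uminus"]
  per_map [where Q = Re]

lemma per_all [per_intros]: "(\<And>y. per (\<lambda>x. Q x y)) \<Longrightarrow> per (\<lambda>x y. Q x y)"
  by (auto simp: per_def)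

lemma per_av [per_intros]: "(\<And>y. per (\<lambda>x. Q x y)) \<Longrightarrow> per (\<lambda>x. AV y. Q x y)"
  unfolding per_def by (intro allI impI arg_cong [where f = av] ext) blast

lemma per_dvd [per_intros]: "pc g \<Longrightarrow> per (\<lambda>x. int p dvd g x)"
  by (auto simp: per_def pc_def cong_dvd_iff intro!: ext iffI dest: cong_dvd_iff)

lemma of_nat_p_ne0 [simp]: "of_nat p \<noteq> (0::'a::real_normed_field)"
  by simp

lemma av_const [simp]: "(AV x. c) = c"
  by (simp add: av_def)

lemma av_zero [simp]: "(AV x. 0) = 0" by simp

lemma av_add: "(AV x. f x + g x) = av f + av g"
  by (simp add: av_def sum.distrib add_divide_distrib)

lemma av_diff: "(AV x. f x - g x) = av f - av g"
  by (simp add: av_def sum_subtractf diff_divide_distrib)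

lemma av_cmult: "(AV x. c * f x) = c * av f"
  by (simp add: av_def sum_distrib_left)

lemma av_multc: "(AV x. f x * c) = av f * c"
  by (simp add: av_def sum_distrib_right)

lemma av_cnj: "cnj (av f) = (AV x. cnj (f x))"
  by (simp add: av_def)

lemma av_Re: "Re (av f) = (AV x. Re (f x))"
  by (simp add: av_def)

lemma av_of_real: "of_real (av f) = (AV x. of_real (f x) :: 'a::real_normed_field)"
  by (simp add: av_def)

lemma av_swap: "(AV x. AV y. Q x y) = (AV y. AV x. Q x y)"
  by (simp add: av_def sum_divide_distrib [symmetric]) (subst sum.swap, simp)

lemma av_swap_in: "(AV x. AV y. AV z. Q x y z) = (AV x. AV z. AV y. Q x y z)"
  by (rule arg_cong [where f = av], rule ext, rule av_swap)

lemma av_rotate: "(AV x. AV y. AV z. Q x y z) = (AV y. AV z. AV x. Q x y z)"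
  by (rule trans [OF av_swap av_swap_in])

lemma av_sum: "(AV x. \<Sum>i\<in>I. Q x i) = (\<Sum>i\<in>I. AV x. Q x i)"
  by (simp add: av_def sum_divide_distrib [symmetric]) (subst sum.swap, simp)

lemma av_sum_left: "(\<Sum>x\<in>{0..<int p}. g x) = of_nat p * av g"
  by (simp add: av_def)

lemma av_cong: "(\<And>x. x \<in> {0..<int p} \<Longrightarrow> f x = g x) \<Longrightarrow> av f = av g"
  unfolding av_def by (intro arg_cong2 [where f = "(/)"] sum.cong refl)

lemma norm_av_le: "norm (av f) \<le> (AV x. norm (f x))"
  by (simp add: av_def norm_divide divide_right_mono norm_sum)

lemma av_mono:
  fixes f g :: "int \<Rightarrow> real"
  assumes "\<And>x. x \<in> {0..<int p} \<Longrightarrow> f x \<le> g x" shows "av f \<le> av g"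
  unfolding av_def by (intro divide_right_mono sum_mono assms) auto

lemma av_nonneg:
  fixes f :: "int \<Rightarrow> real"
  assumes "\<And>x. 0 \<le> f x" shows "0 \<le> av f"
  unfolding av_def by (intro divide_nonneg_nonneg sum_nonneg assms) auto

lemma av_le_const:
  fixes f :: "int \<Rightarrow> real"
  assumes "\<And>x. x \<in> {0..<int p} \<Longrightarrow> f x \<le> c" shows "av f \<le> c"
  using av_mono [of f "\<lambda>_. c"] assms by simp

lemma norm_av_le_const:
  assumes "\<And>x. norm (f x) \<le> c" shows "norm (av f) \<le> c"
  using norm_av_le [of f] av_le_const [of "\<lambda>x. norm (f x)" c] assms by fastforce

lemma av_reindex:
  assumes "per g" "pc h" and inj: "\<And>x y. [h x = h y] (mod int p) \<Longrightarrow> [x = y] (mod int p)"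
  shows "(AV x. g (h x)) = av g"
proof -
  have inj': "inj_on (\<lambda>x. h x mod int p) {0..<int p}"
  proof (rule inj_onI)
    fix x y assume xy: "x \<in> {0..<int p}" "y \<in> {0..<int p}" "h x mod int p = h y mod int p"
    then have "[h x = h y] (mod int p)" by (simp add: cong_def)
    then have "[x = y] (mod int p)" by (rule inj)
    with xy show "x = y" by (simp add: cong_def)
  qed
  have img: "(\<lambda>x. h x mod int p) ` {0..<int p} = {0..<int p}"
    by (rule endo_inj_surj [OF _ _ inj']) auto
  have "(\<Sum>x\<in>{0..<int p}. g (h x)) = (\<Sum>x\<in>{0..<int p}. g (h x mod int p))"
    by (simp add: per_mod [OF \<open>per g\<close>])
  also have "\<dots> = (\<Sum>x\<in>(\<lambda>x. h x mod int p) ` {0..<int p}. g x)"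
    by (simp add: sum.reindex [OF inj'])
  finally show ?thesis by (simp add: img av_def)
qed

lemma av_shift:
  assumes "per g" shows "(AV x. g (x + a)) = av g"
  by (rule av_reindex [OF assms]) (intro per_intros, simp add: cong_add_rcancel)

lemma cong_mult_lcancel_p: "\<not> int p dvd a \<Longrightarrow> [a * x = a * y] (mod int p) \<longleftrightarrow> [x = y] (mod int p)"
  by (rule cong_mult_lcancel) (metis coprime_commute prime_imp_coprime prime_int)

lemma av_dilate:
  assumes "per g" "\<not> int p dvd a" shows "(AV x. g (a * x)) = av g"
  by (rule av_reindex [OF assms(1)])
     (intro per_intros, use assms(2) in \<open>simp add: cong_mult_lcancel_p\<close>)

lemma av_affine:
  assumes "per g" "\<not> int p dvd a" shows "(AV x. g (a * x + b)) = av g"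
proof -
  have "pc (\<lambda>x. x + b)" by (intro per_intros)
  from av_dilate [OF per_comp [OF assms(1) this] assms(2)] av_shift [OF assms(1), of b]
  show ?thesis by simp
qed

lemma av_jensen2:
  fixes f :: "int \<Rightarrow> real"
  shows "(av f)\<^sup>2 \<le> (AV x. (f x)\<^sup>2)"
proof -
  have "0 \<le> (AV x. (f x - av f)\<^sup>2)" by (intro av_nonneg) auto
  also have "\<dots> = (AV x. (f x)\<^sup>2 + ((av f)\<^sup>2 - (2 * av f) * f x))"
    by (simp add: power2_diff algebra_simps)
  also have "\<dots> = (AV x. (f x)\<^sup>2) - (av f)\<^sup>2"
    by (simp add: av_add av_diff av_cmult power2_eq_square)
  finally show ?thesis by simp
qed

lemma av_jensen:
  fixes f :: "int \<Rightarrow> real"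
  assumes "\<And>x. 0 \<le> f x"
  shows "(av f) ^ (2 ^ n) \<le> (AV x. f x ^ (2 ^ n))"
proof (induction n)
  case 0 show ?case by simp
next
  case (Suc n)
  have "(av f) ^ (2 ^ Suc n) = ((av f) ^ (2 ^ n))\<^sup>2" by (simp add: power_mult [symmetric] mult.commute)
  also have "\<dots> \<le> (AV x. f x ^ (2 ^ n))\<^sup>2"
    by (intro power_mono Suc) (auto intro: av_nonneg assms zero_le_power)
  also have "\<dots> \<le> (AV x. (f x ^ (2 ^ n))\<^sup>2)" by (rule av_jensen2)
  finally show ?case by (simp add: power_mult [symmetric] mult.commute)
qed

lemma cmod_av_power_le:
  "cmod (av f) ^ (2 ^ n) \<le> (AV x. cmod (f x) ^ (2 ^ n))"
  by (rule order_trans [OF power_mono [OF norm_av_le] av_jensen]) auto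

lemma av_square: "complex_of_real ((cmod (av f))\<^sup>2) = (AV x. AV y. f x * cnj (f y))"
proof -
  have "complex_of_real ((cmod (av f))\<^sup>2) = av f * cnj (av f)" by (rule complex_norm_square)
  also have "\<dots> = (AV x. f x * cnj (av f))" by (rule av_multc [symmetric])
  also have "\<dots> = (AV x. AV y. f x * cnj (f y))" by (simp add: av_cnj av_cmult)
  finally show ?thesis .
qed

lemma av_square_Re: "(cmod (av f))\<^sup>2 = Re (AV x. AV y. f x * cnj (f y))"
  by (simp add: av_square [symmetric] del: of_real_power)

text \<open>The van der Corput form of a squared average: the second point is written as a translate
  of the first.\<close>

lemma av_square_shift:
  assumes "per f"
  shows "complex_of_real ((cmod (av f))\<^sup>2) = (AV h. AV x. f (x + h) * cnj (f x))"
proof -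
  have "complex_of_real ((cmod (av f))\<^sup>2) = (AV y. AV x. f x * cnj (f y))"
    by (subst av_square, rule av_swap)
  also have "\<dots> = (AV y. AV x. f (x + y) * cnj (f y))"
    by (simp add: av_multc av_shift [OF assms])
  also have "\<dots> = (AV h. AV x. f (x + h) * cnj (f x))"
    by (subst av_swap) (simp add: add.commute)
  finally show ?thesis .
qed

lemma cs_av:
  assumes "\<And>x. cmod (b x) \<le> 1"
  shows "(cmod (AV x. b x * av (Q x)))\<^sup>2 \<le> (AV x. (cmod (av (Q x)))\<^sup>2)"
proof -
  have "cmod (AV x. b x * av (Q x)) \<le> (AV x. cmod (av (Q x)))"
    by (rule order_trans [OF norm_av_le av_mono])
       (use assms in \<open>auto simp: norm_mult intro: mult_left_le_one_le\<close>)
  then have "(cmod (AV x. b x * av (Q x)))\<^sup>2 \<le> (AV x. cmod (av (Q x)))\<^sup>2"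
    by (intro power_mono) auto
  also have "\<dots> \<le> (AV x. (cmod (av (Q x)))\<^sup>2)" by (rule av_jensen2)
  finally show ?thesis .
qed

lemma av_indicator:
  assumes "per G"
  shows "(AV y. of_bool (int p dvd y - a) * G y) = G a / of_nat p"
proof -
  have "(AV y. of_bool (int p dvd y - a) * G y) = (AV y. of_bool (int p dvd y) * G (y + a))"
    by (subst av_shift [where a = a, symmetric]) (auto intro!: per_intros per_comp [OF assms])
  also have "\<dots> = (\<Sum>y\<in>{0..<int p}. if y = 0 then G (y + a) else 0) / of_nat p"
    unfolding av_def
    by (intro arg_cong2 [where f = "(/)"] sum.cong refl) (auto simp: zdvd_not_zless)
  finally show ?thesis by simp
qed

section \<open>Additive characters and Parseval\<close>

definition ep :: "int \<Rightarrow> complex" where "ep = e_p p"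

lemma ep_add: "ep (x + y) = ep x * ep y"
  by (simp add: ep_def e_p_def exp_add [symmetric] add_divide_distrib algebra_simps)

lemma ep_0 [simp]: "ep 0 = 1" by (simp add: ep_def e_p_def)

lemma norm_ep [simp]: "cmod (ep x) = 1"
proof -
  have "ep x = exp (\<i> * of_real (2 * pi * x / p))" by (simp add: ep_def e_p_def mult_ac)
  then show ?thesis by (simp only: norm_exp_i_times)
qed

lemma ep_minus: "ep (- x) = cnj (ep x)"
proof -
  have "ep x \<noteq> 0" using norm_ep [of x] by (metis norm_zero zero_neq_one)
  moreover have "ep (- x) * ep x = 1" by (simp add: ep_add [symmetric])
  moreover have "cnj (ep x) * ep x = 1"
    using complex_norm_square [of "ep x"] by (simp add: mult.commute)
  ultimately show ?thesis by (metis mult_cancel_right)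
qed

lemma ep_diff: "ep (x - y) = ep x * cnj (ep y)"
  using ep_add [of x "-y"] by (simp add: ep_minus)

lemma ep_mult_p: "ep (int p * k) = 1"
proof -
  have "ep (int p * k) = exp (2 * of_real pi * \<i> * of_int k)" by (simp add: ep_def e_p_def mult.assoc)
  also have "\<dots> = exp ((2 * of_int k * of_real pi) * \<i>)" by (rule arg_cong [where f = exp]) simp
  also have "\<dots> = 1" using exp_integer_2pi [of "of_int k"] by simp
  finally show ?thesis .
qed

lemma per_ep: "per ep"
proof (unfold per_def, intro allI impI)
  fix x y assume "[x = y] (mod int p)"
  then obtain k where "x = y + int p * k" by (metis cong_iff_lin cong_sym)
  then show "ep x = ep y" by (simp add: ep_add ep_mult_p)
qed

lemmas [per_intros] = per_comp [OF per_ep]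

lemma ep_eq_1D:
  assumes "ep x = 1" shows "int p dvd x"
proof -
  have "exp (2 * of_real pi * \<i> * of_int x / of_nat p) = (1::complex)"
    using assms by (simp add: ep_def e_p_def)
  then obtain n :: int where n: "Im (2 * of_real pi * \<i> * of_int x / of_nat p) = of_int (2 * n) * pi"
    by (auto simp: exp_eq_1)
  have "Im (2 * of_real pi * \<i> * of_int x / of_nat p) = 2 * pi * x / p"
    by (simp add: Im_divide_of_nat)
  with n have "real_of_int x = real_of_int (n * int p)" by (simp add: field_simps)
  then have "x = n * int p" by (simp only: of_int_eq_iff)
  then show ?thesis by simp
qed

lemma av_ep: "(AV x. ep (a * x)) = of_bool (int p dvd a)"
proof (cases "int p dvd a")
  case True
  then have "ep (a * x) = 1" for x by (auto simp: mult.assoc ep_mult_p)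
  then show ?thesis using True by simp
next
  case False
  \<comment> \<open>Shifting the variable multiplies the average by \<open>ep a\<close>, so it
    vanishes unless \<open>ep a = 1\<close>.\<close>
  have "(AV x. ep (a * x)) = (AV x. ep (a * (x + 1)))"
    by (subst av_shift) (auto intro!: per_intros)
  also have "\<dots> = (AV x. ep (a * x)) * ep a" by (simp add: algebra_simps ep_add av_cmult av_multc)
  finally have "(AV x. ep (a * x)) = 0 \<or> ep a = 1" by (metis mult_cancel_left2)
  with False ep_eq_1D show ?thesis by auto
qed

lemma av_ep': "(AV x. ep (x * a)) = of_bool (int p dvd a)"
  using av_ep [of a] by (simp add: mult.commute)

text \<open>Normalisation: averages over points, sums over frequencies. Averaging the expanded
  square over \<open>a\<close> leaves the diagonal \<open>x = y\<close>.\<close>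

lemma parseval:
  assumes "per g"
  shows "(\<Sum>a\<in>{0..<int p}. (cmod (AV x. g x * ep (a * x)))\<^sup>2) = (AV x. (cmod (g x))\<^sup>2)"
proof -
  have "complex_of_real (AV a. (cmod (AV x. g x * ep (a * x)))\<^sup>2)
      = (AV a. AV x. AV y. g x * ep (a * x) * cnj (g y * ep (a * y)))"
    by (simp add: av_of_real av_square del: of_real_power)
  also have "\<dots> = (AV x. AV y. AV a. g x * ep (a * x) * cnj (g y * ep (a * y)))"
    by (subst av_swap) (subst (2) av_swap, rule refl)
  also have "\<dots> = (AV x. AV y. g x * cnj (g y) * (AV a. ep ((x - y) * a)))"
    unfolding av_cmult [symmetric] left_diff_distrib ep_diff by (simp add: mult_ac)
  also have "\<dots> = (AV x. AV y. of_bool (int p dvd y - x) * (g x * cnj (g y)))"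
    by (simp add: av_ep av_ep' dvd_diff_commute [of "int p"] mult.commute)
  also have "\<dots> = (AV x. g x * cnj (g x) / of_nat p)"
    by (subst av_indicator) (auto intro!: per_intros assms)
  also have "\<dots> = complex_of_real ((AV x. (cmod (g x))\<^sup>2) / p)"
    by (simp add: av_of_real complex_norm_square [symmetric] av_def sum_divide_distrib del: of_real_power)
  finally have "(AV a. (cmod (AV x. g x * ep (a * x)))\<^sup>2) = (AV x. (cmod (g x))\<^sup>2) / p"
    by (simp only: of_real_eq_iff)
  then show ?thesis by (simp add: av_sum_left field_simps)
qed

section \<open>Gowers norms and systems of linear forms\<close>

definition fn :: "(int \<Rightarrow> complex) \<Rightarrow> bool" where
  "fn f \<longleftrightarrow> per f \<and> (\<forall>x. cmod (f x) \<le> 1)"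

lemma fn_per: "fn f \<Longrightarrow> per f" and fn_le1: "fn f \<Longrightarrow> cmod (f x) \<le> 1"
  by (auto simp: fn_def)

lemma cmod_mult_le1: "cmod a \<le> 1 \<Longrightarrow> cmod b \<le> 1 \<Longrightarrow> cmod (a * b) \<le> 1"
  by (simp add: norm_mult mult_le_one)

lemma fn_mult: "fn f \<Longrightarrow> fn g \<Longrightarrow> fn (\<lambda>x. f x * g x)"
  by (auto simp: fn_def intro: cmod_mult_le1 per_intros)

lemma fn_cnj: "fn f \<Longrightarrow> fn (\<lambda>x. cnj (f x))"
  by (auto simp: fn_def intro: per_intros)

lemma fn_comp: "fn f \<Longrightarrow> pc h \<Longrightarrow> fn (\<lambda>x. f (h x))"
  by (auto simp: fn_def intro: per_comp)

lemma fn_ep: "pc h \<Longrightarrow> fn (\<lambda>x. ep (h x))"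
  by (auto simp: fn_def intro: per_intros)

text \<open>The multiplicative derivative of higher-order Fourier analysis: applied to a polynomial
  phase, it lowers the degree by one.\<close>

definition dd :: "int \<Rightarrow> (int \<Rightarrow> complex) \<Rightarrow> int \<Rightarrow> complex" where
  "dd h f = (\<lambda>x. f (x + h) * cnj (f x))"

primrec dl :: "int list \<Rightarrow> (int \<Rightarrow> complex) \<Rightarrow> int \<Rightarrow> complex" where
  "dl [] f = f"
| "dl (h # hs) f = dl hs (dd h f)"

text \<open>\<open>NN n f\<close> is the \<open>2^(n+1)\<close>-th power of the \<open>U\<^sup>n\<^sup>+\<^sup>1\<close> norm of \<open>f\<close>.\<close>

primrec NN :: "nat \<Rightarrow> (int \<Rightarrow> complex) \<Rightarrow> real" where
  "NN 0 f = (cmod (av f))\<^sup>2"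
| "NN (Suc n) f = (AV h. NN n (dd h f))"

lemma fn_dd: "fn f \<Longrightarrow> fn (dd h f)"
  using fn_mult [OF fn_comp [of f "\<lambda>x. x + h"] fn_cnj [of f]] unfolding dd_def by (simp add: per_intros)

lemma fn_dl: "fn f \<Longrightarrow> fn (dl k f)"
  by (induction k arbitrary: f) (auto intro: fn_dd)

lemma dd_mult: "dd h (\<lambda>x. f x * g x) = (\<lambda>x. dd h f x * dd h g x)"
  by (auto simp: dd_def)

lemma dd_cnj: "dd h (\<lambda>x. cnj (f x)) = (\<lambda>x. cnj (dd h f x))"
  by (auto simp: dd_def)

lemma dd_shift: "dd h (\<lambda>x. f (x + a)) = (\<lambda>x. dd h f (x + a))"
  by (auto simp: dd_def add_ac)

lemma dl_mult: "dl k (\<lambda>x. f x * g x) = (\<lambda>x. dl k f x * dl k g x)"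
  by (induction k arbitrary: f g) (simp_all add: dd_mult)

lemma dl_cnj: "dl k (\<lambda>x. cnj (f x)) = (\<lambda>x. cnj (dl k f x))"
  by (induction k arbitrary: f) (simp_all add: dd_cnj)

lemma dl_shift: "dl k (\<lambda>x. f (x + a)) = (\<lambda>x. dl k f (x + a))"
  by (induction k arbitrary: f) (simp_all add: dd_shift)

lemma dl_dd: "dl k (dd h f) x = dl k f (x + h) * cnj (dl k f x)"
  unfolding dd_def by (simp add: dl_mult dl_cnj dl_shift)

lemma per_dd: "per f \<Longrightarrow> per (\<lambda>h. dd h f)"
  unfolding dd_def by (intro per_intros) (simp add: per_comp per_intros)

lemma NN_nonneg: "0 \<le> NN n f"
  by (induction n arbitrary: f) (auto intro: av_nonneg)

lemma NN_cnj: "NN n (\<lambda>x. cnj (f x)) = NN n f"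
  by (induction n arbitrary: f) (simp_all add: dd_cnj av_cnj [symmetric])

lemma NN_shift: "per f \<Longrightarrow> NN n (\<lambda>x. f (x + a)) = NN n f"
proof (induction n arbitrary: f)
  case 0
  then show ?case by (simp add: av_shift)
next
  case (Suc n)
  have "per (dd h f)" for h unfolding dd_def by (intro per_intros per_comp [OF Suc.prems])
  then show ?case by (simp add: dd_shift Suc.IH)
qed

text \<open>The generalised von Neumann argument. Each Cauchy--Schwarz in \<open>z\<close> removes
  one form and replaces \<open>g\<close> by a derivative. Slopes need only be nonzero, so that the
  directions \<open>- a * h\<close> run over all residues; equal slopes are harmless, since the
  derivative in direction 0 is still bounded by 1.\<close>

lemma linear_forms:
  assumes "fn g" "\<And>a f. (a, f) \<in> set L \<Longrightarrow> \<not> int p dvd a \<and> fn f" "length L = Suc n"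
  shows "cmod (AV z. AV u. g z * prod_list (map (\<lambda>(a, f). f (z + a * u)) L)) ^ (2 ^ Suc n) \<le> NN n g"
  using assms
proof (induction n arbitrary: g L)
  case 0
  then obtain a f where L: "L = [(a, f)]" by (metis length_Suc_conv length_0_conv surj_pair)
  have f: "fn f" "\<not> int p dvd a" using 0(2) L by auto
  have "(AV u. f (z + a * u)) = av f" for z
    using av_affine [OF fn_per [OF f(1)] f(2), of z] by (simp add: add.commute)
  then have "cmod (AV z. AV u. g z * f (z + a * u)) = cmod (av g) * cmod (av f)"
    by (simp add: av_cmult av_multc norm_mult)
  also have "\<dots> \<le> cmod (av g) * 1"
    using f by (intro mult_left_mono norm_av_le_const fn_le1) auto
  finally show ?case by (simp add: L power_mono)
next
  case (Suc n)
  then obtain a f L' where L: "L = (a, f) # L'" by (metis length_Suc_conv surj_pair)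
  have f: "fn f" "\<not> int p dvd a" using Suc.prems(2) L by auto
  have L': "\<not> int p dvd b" "fn k" if "(b, k) \<in> set L'" for b k using Suc.prems(2) L that by auto
  have lenL': "length L' = Suc n" using Suc.prems L by simp
  define R where "R z u = prod_list (map (\<lambda>(b, k). k (z + b * u)) L')" for z u
  have perR: "pc h1 \<Longrightarrow> pc h2 \<Longrightarrow> per (\<lambda>x. R (h1 x) (h2 x))" for h1 h2
    using L'(2) unfolding R_def
  proof (induction L')
    case Nil then show ?case by (simp add: per_intros)
  next
    case (Cons y ys)
    obtain b k where y: "y = (b, k)" by fastforce
    have "fn k" using Cons y by auto
    then have "per (\<lambda>x. k (h1 x + b * h2 x))"
      using Cons(2,3) by (auto intro!: per_comp [OF fn_per] per_intros)
    moreover have "per (\<lambda>x. prod_list (map (\<lambda>(b, k). k (h1 x + b * h2 x)) ys))"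
      using Cons by auto
    ultimately show ?case by (auto simp: y intro: per_intros)
  qed
  note pg = per_comp [OF fn_per [OF Suc.prems(1)]] and pf = per_comp [OF fn_per [OF f(1)]]
  \<comment> \<open>After the translation of \<open>z\<close> by \<open>- a * u\<close> the function
    \<open>f\<close> is evaluated at \<open>z\<close> alone and can be discarded as a bounded
    weight.\<close>
  define G where "G z u = g (z - a * u) * R (z - a * u) u" for z u
  have perG1: "per (\<lambda>u. G z u)" and perG2: "per (\<lambda>z. G (z + c) d)" for z c d
    unfolding G_def by (intro per_intros pg perR)+
  \<comment> \<open>With the argument of \<open>f\<close> held fixed, increasing \<open>u\<close> by
    \<open>h\<close> moves the form of slope \<open>b\<close> by \<open>(b - a) * h\<close> and
    \<open>g\<close> by \<open>- a * h\<close>. The slopes of the remaining forms survive.\<close>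
  define L'' where "L'' h = map (\<lambda>(b, k). (b, dd ((b - a) * h) k)) L'" for h
  define Y where "Y h = (AV z. AV u. dd (- a * h) g z * prod_list (map (\<lambda>(b, k). k (z + b * u)) (L'' h)))" for h
  have RR: "R (z - a * h) (u + h) * cnj (R z u) = prod_list (map (\<lambda>(b, k). k (z + b * u)) (L'' h))" for z u h
    unfolding R_def L''_def by (induction L') (auto simp: dd_def algebra_simps)
  have e1: "(AV z. g z * f (z + a * u) * R z u) = (AV z. f z * G z u)" for u
  proof -
    have "per (\<lambda>z. g z * f (z + a * u) * R z u)" by (intro per_intros pg pf perR)
    from av_shift [OF this, of "- a * u"] show ?thesis by (simp add: G_def mult_ac)
  qed
  have e3: "G (z + a * u) (u + h) * cnj (G (z + a * u) u)
      = dd (- a * h) g z * prod_list (map (\<lambda>(b, k). k (z + b * u)) (L'' h))" for z u h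
  proof -
    have eq: "z + a * u - a * (u + h) = z - a * h" by (simp add: algebra_simps)
    show ?thesis unfolding G_def RR [symmetric] dd_def eq by (simp add: mult_ac)
  qed
  have "(AV z. AV u. g z * prod_list (map (\<lambda>(a, f). f (z + a * u)) L))
      = (AV u. AV z. g z * f (z + a * u) * R z u)"
    by (subst av_swap) (simp add: L R_def mult_ac)
  also have "\<dots> = (AV u. AV z. f z * G z u)" by (simp only: e1)
  also have "\<dots> = (AV z. f z * av (G z))"
    by (subst av_swap) (simp add: av_cmult)
  finally have X: "(AV z. AV u. g z * prod_list (map (\<lambda>(a, f). f (z + a * u)) L)) = (AV z. f z * av (G z))" .
  have le: "(cmod (AV z. f z * av (G z)))\<^sup>2 \<le> (AV z. (cmod (av (G z)))\<^sup>2)"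
    by (intro cs_av fn_le1 f)
  have "complex_of_real (AV z. (cmod (av (G z)))\<^sup>2) = (AV z. AV h. AV u. G z (u + h) * cnj (G z u))"
    by (simp add: av_of_real av_square_shift perG1 del: of_real_power)
  also have "\<dots> = (AV h. AV u. AV z. G z (u + h) * cnj (G z u))"
    by (rule av_rotate)
  also have "\<dots> = (AV h. AV u. AV z. G (z + a * u) (u + h) * cnj (G (z + a * u) u))"
  proof -
    have "per (\<lambda>z. G z (u + h) * cnj (G z u))" for u h
      using perG2 [of 0 "u + h"] perG2 [of 0 u] by (auto intro!: per_intros)
    from av_shift [OF this] show ?thesis by simp
  qed
  also have "\<dots> = av Y"
    unfolding Y_def e3 by (rule av_swap_in)
  finally have eq: "complex_of_real (AV z. (cmod (av (G z)))\<^sup>2) = av Y" .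
  have "(AV z. (cmod (av (G z)))\<^sup>2) = Re (av Y)" by (simp flip: eq)
  then have "(cmod (AV z. f z * av (G z)))\<^sup>2 \<le> cmod (av Y)"
    using le complex_Re_le_cmod [of "av Y"] by simp
  moreover have Yle: "cmod (Y h) ^ (2 ^ Suc n) \<le> NN n (dd (- a * h) g)" for h
    unfolding Y_def
  proof (rule Suc.IH)
    show "\<not> int p dvd b \<and> fn k" if "(b, k) \<in> set (L'' h)" for b k
      using that L' by (auto simp: L''_def intro: fn_dd)
  qed (simp_all add: L''_def lenL' fn_dd Suc.prems)
  ultimately have "((cmod (AV z. f z * av (G z)))\<^sup>2) ^ (2 ^ Suc n) \<le> cmod (av Y) ^ (2 ^ Suc n)"
    by (intro power_mono) auto
  also have "\<dots> \<le> (AV h. cmod (Y h) ^ (2 ^ Suc n))" by (rule cmod_av_power_le)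
  also have "\<dots> \<le> (AV h. NN n (dd (- a * h) g))"
    by (rule av_mono) (rule Yle)
  also have "\<dots> = NN (Suc n) g"
    using av_dilate [OF per_map [OF per_dd [OF fn_per [OF Suc.prems(1)]]], of "- a" "NN n"] f by simp
  finally show ?case by (simp only: X power_mult [symmetric] power_Suc)
qed

section \<open>Iterated Cauchy--Schwarz\<close>

text \<open>Averages over n-tuples, coded as lists so that inductions can vary the number of
  increments.\<close>

primrec EL :: "nat \<Rightarrow> (int list \<Rightarrow> 'a::real_normed_field) \<Rightarrow> 'a" where
  "EL 0 f = f []"
| "EL (Suc n) f = (AV h. EL n (\<lambda>k. f (h # k)))"

lemma EL_const [simp]: "EL n (\<lambda>k. c) = c"
  by (induction n) simp_all

lemma EL_cmult: "EL n (\<lambda>k. c * f k) = c * EL n f"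
  by (induction n arbitrary: f) (simp_all add: av_cmult)

lemma EL_add: "EL n (\<lambda>k. f k + g k) = EL n f + EL n g"
  by (induction n arbitrary: f g) (simp_all add: av_add)

lemma EL_sum: "EL n (\<lambda>k. \<Sum>i\<in>I. f i k) = (\<Sum>i\<in>I. EL n (f i))"
  by (induction n arbitrary: f) (simp_all add: av_sum)

lemma EL_Re: "Re (EL n f) = EL n (\<lambda>k. Re (f k))"
  by (induction n arbitrary: f) (simp_all add: av_Re)

lemma EL_of_real: "of_real (EL n f) = (EL n (\<lambda>k. of_real (f k)) :: 'a::real_normed_field)"
  by (induction n arbitrary: f) (simp_all add: av_of_real)

lemma EL_cong: "(\<And>k. length k = n \<Longrightarrow> f k = g k) \<Longrightarrow> EL n f = EL n g"
proof (induction n arbitrary: f g)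
  case (Suc n)
  have "EL n (\<lambda>k. f (h # k)) = EL n (\<lambda>k. g (h # k))" for h
    by (rule Suc.IH) (simp add: Suc.prems)
  then show ?case by simp
qed simp

lemma EL_av: "(AV x. EL n (f x)) = EL n (\<lambda>k. AV x. f x k)"
proof (induction n arbitrary: f)
  case (Suc n)
  show ?case by (simp add: Suc.IH [symmetric]) (rule av_swap)
qed simp

lemma EL_EL: "EL m (\<lambda>j. EL n (f j)) = EL n (\<lambda>k. EL m (\<lambda>j. f j k))"
  by (induction m arbitrary: f) (simp_all add: EL_av)

lemma EL_mono:
  fixes f g :: "int list \<Rightarrow> real"
  assumes "\<And>k. length k = n \<Longrightarrow> f k \<le> g k" shows "EL n f \<le> EL n g"
  using assms
proof (induction n arbitrary: f g)
  case (Suc n)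
  then show ?case by (auto intro!: av_mono)
qed simp

lemma EL_nonneg:
  fixes f :: "int list \<Rightarrow> real"
  assumes "\<And>k. 0 \<le> f k" shows "0 \<le> EL n f"
  using EL_mono [of n "\<lambda>_. 0" f] assms by simp

lemma norm_EL_le: "norm (EL n f) \<le> EL n (\<lambda>k. norm (f k))"
proof (induction n arbitrary: f)
  case (Suc n)
  have "norm (EL (Suc n) f) \<le> (AV h. norm (EL n (\<lambda>k. f (h # k))))" by (simp add: norm_av_le)
  also have "\<dots> \<le> EL (Suc n) (\<lambda>k. norm (f k))" by (auto intro!: av_mono Suc.IH)
  finally show ?case .
qed simp

lemma EL_jensen:
  fixes f :: "int list \<Rightarrow> real"
  assumes "\<And>k. 0 \<le> f k"
  shows "(EL n f) ^ (2 ^ r) \<le> EL n (\<lambda>k. f k ^ (2 ^ r))"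
  using assms
proof (induction n arbitrary: f)
  case (Suc n)
  have "(EL (Suc n) f) ^ (2 ^ r) \<le> (AV h. (EL n (\<lambda>k. f (h # k))) ^ (2 ^ r))"
    using Suc.prems by (auto intro!: av_jensen EL_nonneg)
  also have "\<dots> \<le> EL (Suc n) (\<lambda>k. f k ^ (2 ^ r))"
    using Suc.prems by (auto intro!: av_mono Suc.IH)
  finally show ?case .
qed simp

lemma cmod_EL_power_le: "cmod (EL n f) ^ (2 ^ r) \<le> EL n (\<lambda>k. cmod (f k) ^ (2 ^ r))"
  by (rule order_trans [OF power_mono [OF norm_EL_le] EL_jensen]) auto

lemma av_exists_ge:
  fixes f :: "int \<Rightarrow> real"
  shows "\<exists>x. av f \<le> f x"
proof (rule ccontr)
  assume *: "\<not> (\<exists>x. av f \<le> f x)"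
  have "(\<Sum>x\<in>{0..<int p}. f x) < (\<Sum>x\<in>{0..<int p}. av f)"
    using * by (intro sum_strict_mono) (auto simp: not_le)
  then show False by (simp add: av_def)
qed

lemma EL_exists_ge:
  fixes f :: "int list \<Rightarrow> real"
  shows "\<exists>k. length k = n \<and> EL n f \<le> f k"
proof (induction n arbitrary: f)
  case (Suc n)
  obtain h where h: "EL (Suc n) f \<le> EL n (\<lambda>k. f (h # k))"
    using av_exists_ge [of "\<lambda>h. EL n (\<lambda>k. f (h # k))"] by auto
  obtain k where "length k = n" "EL n (\<lambda>k. f (h # k)) \<le> f (h # k)" using Suc by blast
  with h show ?case by (intro exI [of _ "h # k"]) auto
qed simp

lemma NN_add_EL: "NN (n + m) f = EL n (\<lambda>k. NN m (dl k f))"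
  by (induction n arbitrary: f) simp_all

text \<open>The 2^n-th power of the Gowers box norm of a function of n separate variables.\<close>

primrec BA :: "nat \<Rightarrow> (int list \<Rightarrow> complex) \<Rightarrow> complex" where
  "BA 0 f = f []"
| "BA (Suc n) f = (AV h. AV h'. BA n (\<lambda>k. f (h # k) * cnj (f (h' # k))))"

text \<open>\<open>LW n w\<close> says that \<open>w\<close>, on lists of length \<open>n\<close>, is a product of \<open>n\<close> functions bounded by
  1 of which the \<open>i\<close>-th one does not depend on the \<open>i\<close>-th entry.\<close>

primrec LW :: "nat \<Rightarrow> (int list \<Rightarrow> complex) \<Rightarrow> bool" where
  "LW 0 w \<longleftrightarrow> w [] = 1"
| "LW (Suc n) w \<longleftrightarrow> (\<exists>b v. (\<forall>h k. w (h # k) = b k * v h k) \<and> (\<forall>k. cmod (b k) \<le> 1) \<and> (\<forall>h. LW n (v h)))"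

lemma LW_mult: "LW n v \<Longrightarrow> LW n w \<Longrightarrow> LW n (\<lambda>k. v k * w k)"
proof (induction n arbitrary: v w)
  case (Suc n)
  from Suc.prems obtain b v' c w' where
    "\<forall>h k. v (h # k) = b k * v' h k" "\<forall>k. cmod (b k) \<le> 1" "\<forall>h. LW n (v' h)"
    "\<forall>h k. w (h # k) = c k * w' h k" "\<forall>k. cmod (c k) \<le> 1" "\<forall>h. LW n (w' h)" by auto
  then show ?case
    by (auto simp: mult_ac intro!: exI [of _ "\<lambda>k. b k * c k"] exI [of _ "\<lambda>h k. v' h k * w' h k"]
        Suc.IH cmod_mult_le1)
qed simp

lemma LW_cnj: "LW n w \<Longrightarrow> LW n (\<lambda>k. cnj (w k))"
proof (induction n arbitrary: w)
  case (Suc n)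
  from Suc.prems obtain b v where
    "\<forall>h k. w (h # k) = b k * v h k" "\<forall>k. cmod (b k) \<le> 1" "\<forall>h. LW n (v h)" by auto
  then show ?case
    by (auto intro!: exI [of _ "\<lambda>k. cnj (b k)"] exI [of _ "\<lambda>h k. cnj (v h k)"] Suc.IH)
qed simp

lemma cs_EL:
  assumes "\<And>k. cmod (b k) \<le> 1"
  shows "(cmod (EL n (\<lambda>k. b k * f k)))\<^sup>2 \<le> EL n (\<lambda>k. (cmod (f k))\<^sup>2)"
proof -
  have "(cmod (EL n (\<lambda>k. b k * f k)))\<^sup>2 \<le> EL n (\<lambda>k. (cmod (b k * f k))\<^sup>2)"
    using cmod_EL_power_le [of n "\<lambda>k. b k * f k" 1] by simp
  also have "\<dots> \<le> EL n (\<lambda>k. (cmod (f k))\<^sup>2)"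
    using assms by (intro EL_mono power_mono) (auto simp: norm_mult intro: mult_left_le_one_le)
  finally show ?thesis .
qed

text \<open>The factor free of the first entry leaves the average over that entry and is removed by
  Cauchy--Schwarz. The other factors, multiplied for two values of the entry, keep the shape
  \<open>LW\<close>, so the step can be repeated. For no variables at all the bound by a real part
  would fail, hence \<open>Suc n\<close>.\<close>

lemma box_cs:
  "LW (Suc n) w \<Longrightarrow> cmod (EL (Suc n) (\<lambda>k. f k * w k)) ^ (2 ^ Suc n) \<le> Re (BA (Suc n) f)"
proof (induction n arbitrary: f w)
  case 0
  then obtain b v where w: "\<And>h k. w (h # k) = b k * v h k" "\<And>k. cmod (b k) \<le> 1" "\<And>h. v h [] = 1"
    by auto
  have "cmod (AV h. f [h] * w [h]) = cmod (AV h. f [h]) * cmod (b [])"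
    by (simp add: w av_multc norm_mult)
  also have "\<dots> \<le> cmod (AV h. f [h])"
    by (simp add: w mult_right_le_one_le)
  finally have "(cmod (AV h. f [h] * w [h]))\<^sup>2 \<le> (cmod (AV h. f [h]))\<^sup>2" by (intro power_mono) auto
  then show ?case by (simp add: av_square_Re)
next
  case (Suc n)
  then obtain b v where w: "\<And>h k. w (h # k) = b k * v h k" "\<And>k. cmod (b k) \<le> 1"
      "\<And>h. LW (Suc n) (v h)" by auto
  define X where "X h h' k = f (h # k) * cnj (f (h' # k)) * (v h k * cnj (v h' k))" for h h' k
  have "EL (Suc (Suc n)) (\<lambda>k. f k * w k) = (AV h. EL (Suc n) (\<lambda>k. b k * (f (h # k) * v h k)))"
    by (simp add: w mult_ac)
  also have "\<dots> = EL (Suc n) (\<lambda>k. b k * (AV h. f (h # k) * v h k))"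
    by (simp only: EL_av av_cmult)
  finally have "(cmod (EL (Suc (Suc n)) (\<lambda>k. f k * w k)))\<^sup>2
      \<le> EL (Suc n) (\<lambda>k. (cmod (AV h. f (h # k) * v h k))\<^sup>2)"
    using cs_EL [OF w(2), where n = "Suc n" and f = "\<lambda>k. AV h. f (h # k) * v h k"] by simp
  also have "\<dots> = Re (EL (Suc n) (\<lambda>k. AV h. AV h'. X h h' k))"
    by (simp only: EL_Re av_square_Re X_def) (simp add: mult_ac)
  also have "\<dots> = Re (AV h. AV h'. EL (Suc n) (X h h'))"
    by (simp only: EL_av)
  also have "\<dots> \<le> (AV h. AV h'. cmod (EL (Suc n) (X h h')))"
    unfolding av_Re by (intro av_mono complex_Re_le_cmod)
  finally have "((cmod (EL (Suc (Suc n)) (\<lambda>k. f k * w k)))\<^sup>2) ^ (2 ^ Suc n)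
      \<le> (AV h. AV h'. cmod (EL (Suc n) (X h h'))) ^ (2 ^ Suc n)"
    by (rule power_mono) simp
  also have "\<dots> \<le> (AV h. (AV h'. cmod (EL (Suc n) (X h h'))) ^ (2 ^ Suc n))"
    by (intro av_jensen av_nonneg) simp
  also have "\<dots> \<le> (AV h. AV h'. cmod (EL (Suc n) (X h h')) ^ (2 ^ Suc n))"
    by (intro av_mono av_jensen) simp
  also have "\<dots> \<le> (AV h. AV h'. Re (BA (Suc n) (\<lambda>k. f (h # k) * cnj (f (h' # k)))))"
    unfolding X_def by (intro av_mono Suc.IH LW_mult LW_cnj w)
  also have "\<dots> = Re (BA (Suc (Suc n)) f)"
    by (simp only: BA.simps(2) [of "Suc n"] av_Re)
  finally show ?case by (simp only: power_mult [symmetric] power_Suc)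
qed

lemma box_cs2:
  assumes "\<And>k. cmod (b0 k) \<le> 1" "\<And>k. cmod (b1 k) \<le> 1"
  shows "cmod (AV k. AV l. f k l * b0 l * b1 k) ^ 4
    \<le> Re (AV k. AV k'. AV l. AV l'. f k l * cnj (f k' l) * cnj (f k l' * cnj (f k' l')))"
proof -
  have "LW (Suc (Suc 0)) (\<lambda>k. b0 (k ! 1) * b1 (k ! 0))"
    unfolding LW.simps(2) [of "Suc 0"]
  proof (intro exI conjI allI)
    show "b0 ((h # k) ! 1) * b1 ((h # k) ! 0) = b0 (k ! 0) * b1 h" for h and k :: "int list" by simp
    show "LW (Suc 0) (\<lambda>k. b1 h)" for h
      unfolding LW.simps
      by (rule exI [of _ "\<lambda>k. b1 h"], rule exI [of _ "\<lambda>h k. 1"]) (simp add: assms)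
  qed (simp add: assms)
  moreover have "2 ^ Suc (Suc 0) = (4::nat)" by simp
  ultimately show ?thesis
    using box_cs [of "Suc 0" "\<lambda>k. b0 (k ! 1) * b1 (k ! 0)" "\<lambda>k. f (k ! 0) (k ! 1)"]
    by (simp only: EL.simps BA.simps) (simp add: mult_ac)
qed

lemma box_cs3:
  assumes "\<And>k l. cmod (b0 k l) \<le> 1" "\<And>k l. cmod (b1 k l) \<le> 1" "\<And>k l. cmod (b2 k l) \<le> 1"
  shows "cmod (AV k. AV l. AV m. f k l m * b0 l m * b1 k m * b2 k l) ^ 8
    \<le> Re (AV k. AV k'. AV l. AV l'. AV m. AV m'.
        f k l m * cnj (f k' l m) * cnj (f k l' m * cnj (f k' l' m))
        * cnj (f k l m' * cnj (f k' l m') * cnj (f k l' m' * cnj (f k' l' m'))))"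
proof -
  have "LW (Suc (Suc (Suc 0))) (\<lambda>k. b0 (k ! 1) (k ! 2) * (b1 (k ! 0) (k ! 2) * b2 (k ! 0) (k ! 1)))"
    unfolding LW.simps(2) [of "Suc (Suc 0)"]
  proof (intro exI conjI allI)
    show "b0 ((h # k) ! 1) ((h # k) ! 2) * (b1 ((h # k) ! 0) ((h # k) ! 2) * b2 ((h # k) ! 0) ((h # k) ! 1))
      = b0 (k ! 0) (k ! 1) * (b1 h (k ! 1) * b2 h (k ! 0))" for h and k :: "int list" by simp
    show "LW (Suc (Suc 0)) (\<lambda>k. b1 h (k ! 1) * b2 h (k ! 0))" for h
      unfolding LW.simps(2) [of "Suc 0"]
    proof (intro exI conjI allI)
      show "b1 h ((h' # k) ! 1) * b2 h ((h' # k) ! 0) = b1 h (k ! 0) * b2 h h'" for h' and k :: "int list"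
        by simp
      show "LW (Suc 0) (\<lambda>k. b2 h h')" for h'
        unfolding LW.simps
        by (rule exI [of _ "\<lambda>k. b2 h h'"], rule exI [of _ "\<lambda>h k. 1"]) (simp add: assms)
    qed (simp add: assms)
  qed (simp add: assms)
  moreover have "2 ^ Suc (Suc (Suc 0)) = (8::nat)" by simp
  ultimately show ?thesis
    using box_cs [of "Suc (Suc 0)" "\<lambda>k. b0 (k ! 1) (k ! 2) * (b1 (k ! 0) (k ! 2) * b2 (k ! 0) (k ! 1))"
        "\<lambda>k. f (k ! 0) (k ! 1) (k ! 2)"]
    by (simp only: EL.simps BA.simps) (simp add: mult_ac)
qed

text \<open>The iterated derivative is a product over the vertices of a cube. Every vertex except
  \<open>z + sum_list k\<close> omits some increment, so the product of all the others has the shape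
  \<open>LW\<close>.\<close>

lemma dl_split:
  assumes "fn g"
  shows "\<exists>w. LW n w \<and> (\<forall>k. length k = n \<longrightarrow> dl k g z = g (z + sum_list k) * w k)"
proof (induction n arbitrary: z)
  case 0
  show ?case by (intro exI [of _ "\<lambda>k. 1"]) auto
next
  case (Suc n)
  then obtain w where w: "\<And>z. LW n (w z)"
      "\<And>z k. length k = n \<Longrightarrow> dl k g z = g (z + sum_list k) * w z k" by metis
  define w' where "w' ks = cnj (dl (tl ks) g z) * w (z + hd ks) (tl ks)" for ks
  have "LW (Suc n) w'"
    unfolding LW.simps
    by (rule exI [of _ "\<lambda>k. cnj (dl k g z)"], rule exI [of _ "\<lambda>h. w (z + h)"])
       (simp add: w'_def w fn_le1 [OF fn_dl [OF assms]])
  moreover have "dl ks g z = g (z + sum_list ks) * w' ks" if "length ks = Suc n" for ks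
    using that by (cases ks) (auto simp: w'_def dl_dd w algebra_simps)
  ultimately show ?case by blast
qed

text \<open>After a translation of \<open>z\<close>, each pair \<open>h\<close>, \<open>h'\<close>
  enters only through its difference, which becomes the direction of a derivative.\<close>

lemma BA_sum_list:
  assumes "per g"
  shows "(AV z. BA n (\<lambda>k. g (z + sum_list k))) = EL n (\<lambda>k. av (dl k g))"
  using assms
proof (induction n arbitrary: g)
  case 0
  then show ?case by simp
next
  case (Suc n)
  define B where "B d z = BA n (\<lambda>k. dd d g (z + sum_list k))" for d z
  have pdd: "per (dd d g)" for d unfolding dd_def by (intro per_intros per_comp [OF Suc.prems])
  have pB1: "per (\<lambda>z. B d z)" for d
    unfolding B_def by (intro per_map [where Q = "BA n"] per_all per_comp [OF pdd] per_intros)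
  have "per (\<lambda>d. dd d g z)" for z
    by (rule per_map [OF per_dd [OF Suc.prems], of "\<lambda>f. f z"])
  then have pB2: "per (\<lambda>d. B d z)" for z
    unfolding B_def by (intro per_map [where Q = "BA n"] per_all)
  have "(AV z. BA (Suc n) (\<lambda>k. g (z + sum_list k))) = (AV z. AV h. AV h'. B (h - h') (z + h'))"
    by (simp add: B_def dd_def algebra_simps)
  also have "\<dots> = (AV h. AV h'. AV z. B (h - h') (z + h'))" by (rule av_rotate)
  also have "\<dots> = (AV h. AV h'. AV z. B (h - h') z)" by (simp add: av_shift [OF pB1])
  also have "\<dots> = (AV h'. AV h. AV z. B (h + - h') z)" by (subst av_swap) simp
  also have "\<dots> = (AV h'. AV h. AV z. B h z)"
  proof -
    have "per (\<lambda>h. AV z. B h z)" by (intro per_av pB2)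
    from av_shift [OF this] show ?thesis by (simp only: av_const)
  qed
  also have "\<dots> = (AV h. EL n (\<lambda>k. av (dl k (dd h g))))"
    by (simp add: B_def Suc.IH [OF pdd])
  finally show ?case by simp
qed

lemma NN_eq_EL_av:
  assumes "per g" shows "of_real (NN n g) = EL (Suc n) (\<lambda>k. av (dl k g))"
  using assms
proof (induction n arbitrary: g)
  case 0
  then show ?case by (simp add: av_square_shift dd_def del: of_real_power)
next
  case (Suc n)
  have "per (dd d g)" for d unfolding dd_def by (intro per_intros per_comp [OF Suc.prems])
  then show ?case using Suc.IH by (simp add: av_of_real)
qed

text \<open>Squaring the Fourier coefficient introduces a new increment \<open>h\<close>, and the
  phase becomes \<open>ep (\<psi> k * h)\<close>, free of \<open>z\<close>. If for each
  \<open>h\<close> it splits into factors each missing an entry of \<open>k\<close>, box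
  Cauchy--Schwarz removes it together with the lower vertices, and a Gowers norm of \<open>g\<close>
  remains.\<close>

lemma low_rank:
  assumes g: "fn g" and w: "\<And>h. LW (Suc m) (\<lambda>k. ep (\<psi> k * h))"
  shows "EL (Suc m) (\<lambda>k. (cmod (AV z. dl k g z * ep (\<psi> k * z)))\<^sup>2) ^ (2 ^ Suc m) \<le> NN (Suc m) g"
proof -
  define X where "X h z = EL (Suc m) (\<lambda>k. dl k (dd h g) z * ep (\<psi> k * h))" for h z
  have X: "cmod (X h z) ^ (2 ^ Suc m) \<le> Re (BA (Suc m) (\<lambda>k. dd h g (z + sum_list k)))" for h z
  proof -
    obtain v where v: "LW (Suc m) v"
      "\<And>k. length k = Suc m \<Longrightarrow> dl k (dd h g) z = dd h g (z + sum_list k) * v k"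
      using dl_split [OF fn_dd [OF g]] by metis
    have "X h z = EL (Suc m) (\<lambda>k. dd h g (z + sum_list k) * (v k * ep (\<psi> k * h)))"
      unfolding X_def by (rule EL_cong) (simp add: v)
    then show ?thesis using box_cs [OF LW_mult [OF v(1) w]] by metis
  qed
  have per1: "per (\<lambda>z. dl k g z * ep (\<psi> k * z))" for k
    by (intro per_intros fn_per [OF fn_dl [OF g]])
  have pt: "dl k g (z + h) * ep (\<psi> k * (z + h)) * cnj (dl k g z * ep (\<psi> k * z))
      = dl k (dd h g) z * ep (\<psi> k * h)" for k z h
  proof -
    have "ep (\<psi> k * (z + h)) * cnj (ep (\<psi> k * z)) = ep (\<psi> k * h)"
      unfolding ep_diff [symmetric] by (simp add: algebra_simps)
    then show ?thesis by (simp add: dl_dd mult_ac)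
  qed
  have "complex_of_real (EL (Suc m) (\<lambda>k. (cmod (AV z. dl k g z * ep (\<psi> k * z)))\<^sup>2))
    = EL (Suc m) (\<lambda>k. AV h. AV z. dl k (dd h g) z * ep (\<psi> k * h))"
    by (simp only: EL_of_real av_square_shift [OF per1] pt)
  also have "\<dots> = (AV h. AV z. X h z)"
    by (simp only: X_def EL_av)
  finally have eq: "complex_of_real (EL (Suc m) (\<lambda>k. (cmod (AV z. dl k g z * ep (\<psi> k * z)))\<^sup>2))
    = (AV h. AV z. X h z)" .
  have "EL (Suc m) (\<lambda>k. (cmod (AV z. dl k g z * ep (\<psi> k * z)))\<^sup>2) = cmod (AV h. AV z. X h z)"
    unfolding eq [symmetric] norm_of_real by (intro abs_of_nonneg [symmetric] EL_nonneg) simp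
  then have "EL (Suc m) (\<lambda>k. (cmod (AV z. dl k g z * ep (\<psi> k * z)))\<^sup>2) ^ (2 ^ Suc m)
      \<le> (AV h. cmod (AV z. X h z) ^ (2 ^ Suc m))"
    using cmod_av_power_le by metis
  also have "\<dots> \<le> (AV h. AV z. cmod (X h z) ^ (2 ^ Suc m))"
    by (intro av_mono cmod_av_power_le)
  also have "\<dots> \<le> (AV h. AV z. Re (BA (Suc m) (\<lambda>k. dd h g (z + sum_list k))))"
    by (intro av_mono X)
  also have "\<dots> = (AV h. Re (EL (Suc m) (\<lambda>k. av (dl k (dd h g)))))"
    by (simp only: av_Re [symmetric] BA_sum_list [OF fn_per [OF fn_dd [OF g]]])
  also have "\<dots> = NN (Suc m) g"
    by (simp only: NN_eq_EL_av [OF fn_per [OF fn_dd [OF g]], symmetric] NN.simps Re_complex_of_real)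
  finally show ?thesis .
qed

text \<open>\<open>bx k l f\<close> is the integrand of \<open>BA\<close>: the product of
  \<open>f\<close> over the vertices whose i-th entry is that of \<open>k\<close> or of
  \<open>l\<close>. \<open>alt\<close> is its additive counterpart for phases. Recursion runs on
  \<open>k\<close> alone; \<open>l\<close> is meant to have the same length.\<close>

primrec bx :: "int list \<Rightarrow> int list \<Rightarrow> (int list \<Rightarrow> complex) \<Rightarrow> complex" where
  "bx [] l f = f []"
| "bx (h # k) l f = bx k (tl l) (\<lambda>x. f (h # x) * cnj (f (hd l # x)))"

primrec alt :: "int list \<Rightarrow> int list \<Rightarrow> (int list \<Rightarrow> int) \<Rightarrow> int" where
  "alt [] l \<phi> = \<phi> []"
| "alt (h # k) l \<phi> = alt k (tl l) (\<lambda>x. \<phi> (h # x) - \<phi> (hd l # x))"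

lemma BA_bx: "BA n f = EL n (\<lambda>k. EL n (\<lambda>l. bx k l f))"
  by (induction n arbitrary: f) (simp_all add: EL_av)

lemma bx_mult: "bx k l (\<lambda>x. f x * g x) = bx k l f * bx k l g"
proof (induction k arbitrary: l f g)
  case (Cons h k)
  have "bx (h # k) l (\<lambda>x. f x * g x)
    = bx k (tl l) (\<lambda>x. (f (h # x) * cnj (f (hd l # x))) * (g (h # x) * cnj (g (hd l # x))))"
    by (simp add: mult_ac)
  then show ?case by (simp only: Cons.IH bx.simps)
qed simp

lemma bx_cnj: "bx k l (\<lambda>x. cnj (f x)) = cnj (bx k l f)"
proof (induction k arbitrary: l f)
  case (Cons h k)
  show ?case using Cons.IH [of "tl l" "\<lambda>x. f (h # x) * cnj (f (hd l # x))"] by simp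
qed simp

lemma bx_norm_le: "(\<And>x. cmod (f x) \<le> 1) \<Longrightarrow> cmod (bx k l f) \<le> cmod (f k)"
proof (induction k arbitrary: l f)
  case (Cons h k)
  have "cmod (bx (h # k) l f) \<le> cmod (f (h # k) * cnj (f (hd l # k)))"
    using Cons.IH [of "\<lambda>x. f (h # x) * cnj (f (hd l # x))" "tl l"] Cons.prems
    by (simp add: cmod_mult_le1)
  also have "\<dots> \<le> cmod (f (h # k))"
    using Cons.prems by (simp add: norm_mult mult_right_le_one_le)
  finally show ?case .
qed simp

lemma alt_diff: "alt k l (\<lambda>x. \<phi> x - \<psi> x) = alt k l \<phi> - alt k l \<psi>"
proof (induction k arbitrary: l \<phi> \<psi>)
  case (Cons h k)
  have "alt (h # k) l (\<lambda>x. \<phi> x - \<psi> x)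
    = alt k (tl l) (\<lambda>x. (\<phi> (h # x) - \<phi> (hd l # x)) - (\<psi> (h # x) - \<psi> (hd l # x)))"
    by (simp add: algebra_simps)
  then show ?case by (simp only: Cons.IH alt.simps)
qed simp

lemma bx_ep: "bx k l (\<lambda>x. ep (\<phi> x * z)) = ep (alt k l \<phi> * z)"
  by (induction k arbitrary: l \<phi>) (simp_all add: ep_diff [symmetric] left_diff_distrib [symmetric])

lemma bx_sum_list:
  "length k = length l \<Longrightarrow> bx k l (\<lambda>x. g (z + sum_list x)) = dl (map2 (-) k l) g (z + sum_list l)"
proof (induction k arbitrary: l g z)
  case (Cons h k)
  then obtain h' l' where l: "l = h' # l'" "length k = length l'" by (metis length_Suc_conv length_Cons)
  have "bx (h # k) l (\<lambda>x. g (z + sum_list x)) = bx k l' (\<lambda>x. dd (h - h') g (z + h' + sum_list x))"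
    by (simp add: l dd_def algebra_simps)
  also have "\<dots> = dl (map2 (-) k l') (dd (h - h') g) (z + h' + sum_list l')"
    by (rule Cons.IH [OF l(2)])
  finally show ?case by (simp add: l algebra_simps)
qed simp

text \<open>The alternating sum contains \<open>\<phi> k\<close> with sign +, which cancels. Each
  other term takes some entry from the fixed list \<open>l\<close> and so is free of that entry of
  \<open>k\<close>.\<close>

lemma LW_alt: "length l = n \<Longrightarrow> LW n (\<lambda>k. ep ((\<phi> k - alt k l \<phi>) * h))"
proof (induction n arbitrary: \<phi> l)
  case (Suc n)
  then obtain h' l' where l: "l = h' # l'" "length l' = n" by (metis length_Suc_conv)
  show ?case
    unfolding LW.simps
  proof (intro exI conjI allI)
    show "ep ((\<phi> (h0 # k) - alt (h0 # k) l \<phi>) * h)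
      = ep (alt k l' (\<lambda>x. \<phi> (h' # x)) * h) * ep ((\<phi> (h0 # k) - alt k l' (\<lambda>x. \<phi> (h0 # x))) * h)" for h0 k
      by (simp add: l alt_diff ep_add [symmetric] algebra_simps)
    show "LW n (\<lambda>k. ep ((\<phi> (h0 # k) - alt k l' (\<lambda>x. \<phi> (h0 # x))) * h))" for h0
      by (rule Suc.IH [OF l(2)])
  qed simp
qed simp

section \<open>Control by a high-order Gowers norm\<close>

lemma av_up2: "(AV k. AV l. AV x. R k l x) = (AV x. AV k. AV l. R k l x)"
  by (rule trans [OF av_swap_in av_swap])

lemma av_up3: "(AV k. AV l. AV m. AV x. R k l m x) = (AV x. AV k. AV l. AV m. R k l m x)"
  by (rule trans [OF arg_cong [where f = av, OF ext, OF av_up2] av_swap])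

lemma av_up4: "(AV k. AV l. AV m. AV n. AV x. R k l m n x) = (AV x. AV k. AV l. AV m. AV n. R k l m n x)"
  by (rule trans [OF arg_cong [where f = av, OF ext, OF av_up3] av_swap])

lemma av_up5: "(AV k. AV l. AV m. AV n. AV r. AV x. R k l m n r x)
    = (AV x. AV k. AV l. AV m. AV n. AV r. R k l m n r x)"
  by (rule trans [OF arg_cong [where f = av, OF ext, OF av_up4] av_swap])

lemma av_up6: "(AV k. AV l. AV m. AV n. AV r. AV q. AV x. R k l m n r q x)
    = (AV x. AV k. AV l. AV m. AV n. AV r. AV q. R k l m n r q x)"
  by (rule trans [OF arg_cong [where f = av, OF ext, OF av_up5] av_swap])

lemma av_mono2:
  fixes f g :: "int \<Rightarrow> int \<Rightarrow> real"
  assumes "\<And>x y. f x y \<le> g x y" shows "(AV x. AV y. f x y) \<le> (AV x. AV y. g x y)"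
  by (intro av_mono assms)

lemma cmod_av2_power_le:
  "cmod (AV x. AV y. f x y) ^ (2 ^ n) \<le> (AV x. AV y. cmod (f x y) ^ (2 ^ n))"
  by (rule order_trans [OF cmod_av_power_le av_mono]) (rule cmod_av_power_le)

lemma av_of_bool_dvd:
  "\<not> int p dvd a \<Longrightarrow> (AV y. of_bool (int p dvd a * y + b)) = 1 / real p"
proof -
  assume "\<not> int p dvd a"
  have "per (\<lambda>y. of_bool (int p dvd y) :: real)" by (intro per_intros)
  from av_affine [OF this \<open>\<not> int p dvd a\<close>]
  have "(AV y. of_bool (int p dvd a * y + b)) = (AV y. of_bool (int p dvd y - 0) * (1::real))" by simp
  also have "\<dots> = 1 / real p" by (subst av_indicator) (auto intro: per_intros)
  finally show ?thesis .
qed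

lemma not_dvd_small [simp]: "\<not> int p dvd 1" "\<not> int p dvd 2" "\<not> int p dvd 3" "\<not> int p dvd 4"
proof -
  show 1: "\<not> int p dvd 1" "\<not> int p dvd 2" "\<not> int p dvd 3" using p_gt3 by (auto dest: zdvd_imp_le)
  show "\<not> int p dvd 4" using prime_dvd_mult_iff [OF prime_int, of 2 2] 1 by simp
qed

lemma av_of_bool_dvd1:
  "(AV y. of_bool (int p dvd y + b)) = 1 / real p" "(AV y. of_bool (int p dvd y - b)) = 1 / real p"
  "(AV y. of_bool (int p dvd b + y)) = 1 / real p"
  using av_of_bool_dvd [of 1 b] av_of_bool_dvd [of 1 "- b"] p_gt3 by (simp_all add: add.commute)

definition Lam where
  "Lam f0 f1 f2 f3 = (AV x. AV y. f0 x * f1 (x + y) * f2 (x + 2 * y) * f3 (x + y\<^sup>2))"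

definition Du :: "(int \<Rightarrow> complex) \<Rightarrow> (int \<Rightarrow> complex) \<Rightarrow> (int \<Rightarrow> complex) \<Rightarrow> int \<Rightarrow> complex" where
  "Du f0 f1 f2 z = (AV y. f0 (z - y\<^sup>2) * f1 (z - y\<^sup>2 + y) * f2 (z - y\<^sup>2 + 2 * y))"

lemma Lam_Du:
  assumes "per f0" "per f1" "per f2" "per f3"
  shows "Lam f0 f1 f2 f3 = (AV z. Du f0 f1 f2 z * f3 z)"
proof -
  define H where "H y z = f0 (z - y\<^sup>2) * f1 (z - y\<^sup>2 + y) * f2 (z - y\<^sup>2 + 2 * y) * f3 z" for y z
  have H: "per (H y)" for y
    unfolding H_def by (intro per_intros assms [THEN per_comp])
  have "Lam f0 f1 f2 f3 = (AV y. AV x. H y (x + y\<^sup>2))"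
    unfolding Lam_def by (subst av_swap) (simp add: H_def algebra_simps)
  also have "\<dots> = (AV y. AV x. H y x)" by (simp add: av_shift [OF H])
  also have "\<dots> = (AV z. Du f0 f1 f2 z * f3 z)"
    by (subst av_swap) (simp add: H_def Du_def av_multc)
  finally show ?thesis .
qed

lemma fn_Du:
  assumes "fn f0" "fn f1" "fn f2" shows "fn (Du f0 f1 f2)"
  unfolding fn_def
proof
  show "per (Du f0 f1 f2)"
    unfolding Du_def by (intro per_intros assms [THEN fn_per, THEN per_comp])
  show "\<forall>x. cmod (Du f0 f1 f2 x) \<le> 1"
    unfolding Du_def by (intro allI norm_av_le_const cmod_mult_le1 assms [THEN fn_le1])
qed

text \<open>One vertex serves as base point; the other seven are linear forms in \<open>y\<close>.
  Seven forms mean U^7, hence \<open>NN 6\<close> and the exponent 2^7 = 128.\<close>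

lemma cube_bound:
  assumes f: "fn f"
    and nz: "\<not> int p dvd h" "\<not> int p dvd i" "\<not> int p dvd h + i" "\<not> int p dvd j"
      "\<not> int p dvd h + j" "\<not> int p dvd i + j" "\<not> int p dvd h + i + j"
  shows "cmod (AV x. AV y. f x * cnj (f (x + 2 * h * y + c1)) * cnj (f (x + 2 * i * y + c2)) *
      f (x + 2 * (h + i) * y + c3) * cnj (f (x + 2 * j * y + c4)) * f (x + 2 * (h + j) * y + c5) *
      f (x + 2 * (i + j) * y + c6) * cnj (f (x + 2 * (h + i + j) * y + c7))) ^ 128 \<le> NN 6 f"
proof -
  define L where "L = [(2 * h, \<lambda>w. cnj (f (w + c1))), (2 * i, \<lambda>w. cnj (f (w + c2))),
    (2 * (h + i), \<lambda>w. f (w + c3)), (2 * j, \<lambda>w. cnj (f (w + c4))), (2 * (h + j), \<lambda>w. f (w + c5)),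
    (2 * (i + j), \<lambda>w. f (w + c6)), (2 * (h + i + j), \<lambda>w. cnj (f (w + c7)))]"
  have sh: "fn (\<lambda>w. f (w + c))" for c by (rule fn_comp [OF f]) (intro per_intros)
  have dv: "int p dvd 2 * a \<longleftrightarrow> int p dvd a" for a
    using prime_dvd_mult_iff [OF prime_int, of 2 a] by simp
  have "cmod (AV z. AV u. f z * prod_list (map (\<lambda>(a, f). f (z + a * u)) L)) ^ (2 ^ Suc 6) \<le> NN 6 f"
  proof (rule linear_forms [OF f])
    show "length L = Suc 6" by (simp add: L_def)
    show "\<not> int p dvd a \<and> fn k" if "(a, k) \<in> set L" for a k
      using that unfolding L_def by (auto simp: dv nz sh simp del: mult_2 distrib_left_numeral intro: fn_cnj sh)
  qed
  then show ?thesis by (simp add: L_def mult.assoc)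
qed

lemma le_root128: "0 \<le> x \<Longrightarrow> x ^ 128 \<le> y \<Longrightarrow> x \<le> root 128 y"
  using real_root_le_mono [of 128 "x ^ 128" y] real_root_power_cancel [of 128 x] by simp

text \<open>Three shifts are introduced so that each of \<open>f0\<close>, \<open>f1\<close>,
  \<open>f2\<close> misses one of them, and \<open>box_cs3\<close> removes these functions together.
  The remaining eight values of \<open>f3\<close> have the same quadratic part in \<open>y\<close>,
  so up to a translation only linear forms remain.\<close>

lemma pet:
  assumes f: "fn f0" "fn f1" "fn f2" "fn f3"
  shows "cmod (Lam f0 f1 f2 f3) ^ 8 \<le> root 128 (NN 6 f3) + 7 / p"
proof -
  note pf = f [THEN fn_per, THEN per_comp]
  define q where "q x y = f0 x * f1 (x + y) * f2 (x + 2 * y) * f3 (x + y\<^sup>2)" for x y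
  \<comment> \<open>Obtained from \<open>x - l - 2 * m\<close> and \<open>y + k + l + m\<close> in
    place of \<open>x\<close> and \<open>y\<close>: \<open>f0\<close> loses \<open>k\<close>,
    \<open>f1\<close> loses \<open>l\<close>, \<open>f2\<close> loses \<open>m\<close>.\<close>
  define b0 where "b0 x l m = f0 (x - l - 2 * m)" for x l m
  define b1 where "b1 x y k m = f1 (x + y + k - m)" for x y k m
  define b2 where "b2 x y k l = f2 (x + 2 * y + 2 * k + l)" for x y k l
  define g where "g x y k l m = f3 (x - l - 2 * m + (y + k + l + m)\<^sup>2)" for x y k l m
  have pq: "per (\<lambda>x. q x y)" "per (\<lambda>y. q x y)" for x y
    unfolding q_def by (intro per_intros pf)+
  have 1: "Lam f0 f1 f2 f3 = (AV x. AV y. g x y k l m * b0 x l m * b1 x y k m * b2 x y k l)" for k l m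
  proof -
    have "(AV x. AV y. q x y) = (AV x. AV y. q (x + (- l - 2 * m)) y)"
      by (rule av_shift [symmetric]) (intro per_intros pq)
    also have "\<dots> = (AV x. AV y. q (x + (- l - 2 * m)) (y + (k + l + m)))"
      by (simp only: av_shift [OF pq(2)])
    also have "\<dots> = (AV x. AV y. g x y k l m * b0 x l m * b1 x y k m * b2 x y k l)"
      unfolding q_def b0_def b1_def b2_def g_def by (simp add: algebra_simps)
    finally show ?thesis unfolding Lam_def q_def .
  qed
  have "Lam f0 f1 f2 f3 = (AV k. AV l. AV m. Lam f0 f1 f2 f3)" by simp
  also have "\<dots> = (AV k. AV l. AV m. AV x. AV y. g x y k l m * b0 x l m * b1 x y k m * b2 x y k l)"
    by ((rule arg_cong [where f = av], rule ext)+) (rule 1)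
  also have "\<dots> = (AV x. AV y. AV k. AV l. AV m. g x y k l m * b0 x l m * b1 x y k m * b2 x y k l)"
    by (subst av_up3) (rule arg_cong [where f = av], rule ext, rule av_up3)
  finally have "cmod (Lam f0 f1 f2 f3) ^ (2 ^ 3)
    \<le> (AV x. AV y. cmod (AV k. AV l. AV m. g x y k l m * b0 x l m * b1 x y k m * b2 x y k l) ^ (2 ^ 3))"
    by (simp only: cmod_av2_power_le)
  then have 2: "cmod (Lam f0 f1 f2 f3) ^ 8
    \<le> (AV x. AV y. cmod (AV k. AV l. AV m. g x y k l m * b0 x l m * b1 x y k m * b2 x y k l) ^ 8)"
    by simp
  define X where "X k k' l l' m m' x y = g x y k l m * cnj (g x y k' l m) * cnj (g x y k l' m * cnj (g x y k' l' m))
        * cnj (g x y k l m' * cnj (g x y k' l m') * cnj (g x y k l' m' * cnj (g x y k' l' m')))"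
    for k k' l l' m m' x y
  note 2
  also have "(AV x. AV y. cmod (AV k. AV l. AV m. g x y k l m * b0 x l m * b1 x y k m * b2 x y k l) ^ 8)
      \<le> (AV x. AV y. Re (AV k. AV k'. AV l. AV l'. AV m. AV m'. X k k' l l' m m' x y))"
    unfolding X_def b0_def b1_def b2_def by (intro av_mono2 box_cs3 f [THEN fn_le1])
  also have "\<dots> = Re (AV x. AV y. AV k. AV k'. AV l. AV l'. AV m. AV m'. X k k' l l' m m' x y)"
    by (simp only: av_Re)
  also have "\<dots> = Re (AV k. AV k'. AV l. AV l'. AV m. AV m'. AV x. AV y. X k k' l l' m m' x y)"
    by (rule arg_cong [where f = Re],
        rule trans [OF arg_cong [where f = av, OF ext, OF av_up6 [symmetric]] av_up6 [symmetric]])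
  also have "\<dots> = (AV k. AV k'. AV l. AV l'. AV m. AV m'. Re (AV x. AV y. X k k' l l' m m' x y))"
    by (simp only: av_Re)
  also have "\<dots> \<le> (AV k. AV k'. AV l. AV l'. AV m. AV m'. root 128 (NN 6 f3)
     + (of_bool (int p dvd k' - k) + (of_bool (int p dvd l' - l) + (of_bool (int p dvd (k' - k) + (l' - l))
     + (of_bool (int p dvd m' - m) + (of_bool (int p dvd (k' - k) + (m' - m))
     + (of_bool (int p dvd (l' - l) + (m' - m)) + of_bool (int p dvd (k' - k) + (l' - l) + (m' - m)))))))))"
  proof (intro av_mono)
    fix k k' l l' m m'
    have pX: "per (\<lambda>x. X k k' l l' m m' x y)" "per (\<lambda>y. X k k' l l' m m' x y)" for x y
      unfolding X_def g_def by (intro per_intros pf)+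
    define h i j s where "h = k' - k" and "i = l' - l" and "j = m' - m" and "s = k + l + m"
    \<comment> \<open>Recentring: \<open>y - s\<close> cancels the shifts at the base vertex, and
      the translation of \<open>x\<close> turns that vertex into \<open>f3 x\<close>. The squares of
      \<open>y\<close> then cancel at the other vertices too.\<close>
    define T where "T y = (AV x. X k k' l l' m m' (x + (l + 2 * m - y\<^sup>2)) (y - s))" for y
    have pT: "per T"
      unfolding T_def X_def g_def by (intro per_intros pf)
    have "(AV x. AV y. X k k' l l' m m' x y) = (AV y. AV x. X k k' l l' m m' x y)" by (rule av_swap)
    also have "\<dots> = (AV y. T (y + s))" by (simp add: T_def av_shift [OF pX(1)])
    also have "\<dots> = (AV y. T y)" by (rule av_shift [OF pT])
    also have "\<dots> = (AV x. AV y. X k k' l l' m m' (x + (l + 2 * m - y\<^sup>2)) (y - s))"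
      unfolding T_def by (rule av_swap)
    also have "\<dots> = (AV x. AV y. f3 x * cnj (f3 (x + 2 * h * y + h\<^sup>2)) * cnj (f3 (x + 2 * i * y + (i\<^sup>2 - i))) *
      f3 (x + 2 * (h + i) * y + ((h + i)\<^sup>2 - i)) * cnj (f3 (x + 2 * j * y + (j\<^sup>2 - 2 * j))) *
      f3 (x + 2 * (h + j) * y + ((h + j)\<^sup>2 - 2 * j)) *
      f3 (x + 2 * (i + j) * y + ((i + j)\<^sup>2 - i - 2 * j)) *
      cnj (f3 (x + 2 * (h + i + j) * y + ((h + i + j)\<^sup>2 - i - 2 * j))))" (is "_ = ?C")
    proof -
      have "X k k' l l' m m' (x + (l + 2 * m - y\<^sup>2)) (y - s) =
        f3 x * cnj (f3 (x + 2 * h * y + h\<^sup>2)) * cnj (f3 (x + 2 * i * y + (i\<^sup>2 - i))) *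
        f3 (x + 2 * (h + i) * y + ((h + i)\<^sup>2 - i)) * cnj (f3 (x + 2 * j * y + (j\<^sup>2 - 2 * j))) *
        f3 (x + 2 * (h + j) * y + ((h + j)\<^sup>2 - 2 * j)) *
        f3 (x + 2 * (i + j) * y + ((i + j)\<^sup>2 - i - 2 * j)) *
        cnj (f3 (x + 2 * (h + i + j) * y + ((h + i + j)\<^sup>2 - i - 2 * j)))" for x y
      proof -
        have G: "g (x + (l + 2 * m - y\<^sup>2)) (y - s) K L M = f3 z"
          if "x + (l + 2 * m - y\<^sup>2) - L - 2 * M + (y - s + K + L + M)\<^sup>2 = z" for K L M z
          using that by (simp add: g_def)
        have e: "g (x + (l + 2 * m - y\<^sup>2)) (y - s) k l m = f3 x"
          "g (x + (l + 2 * m - y\<^sup>2)) (y - s) k' l m = f3 (x + 2 * h * y + h\<^sup>2)"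
          "g (x + (l + 2 * m - y\<^sup>2)) (y - s) k l' m = f3 (x + 2 * i * y + (i\<^sup>2 - i))"
          "g (x + (l + 2 * m - y\<^sup>2)) (y - s) k' l' m = f3 (x + 2 * (h + i) * y + ((h + i)\<^sup>2 - i))"
          "g (x + (l + 2 * m - y\<^sup>2)) (y - s) k l m' = f3 (x + 2 * j * y + (j\<^sup>2 - 2 * j))"
          "g (x + (l + 2 * m - y\<^sup>2)) (y - s) k' l m' = f3 (x + 2 * (h + j) * y + ((h + j)\<^sup>2 - 2 * j))"
          "g (x + (l + 2 * m - y\<^sup>2)) (y - s) k l' m' = f3 (x + 2 * (i + j) * y + ((i + j)\<^sup>2 - i - 2 * j))"
          "g (x + (l + 2 * m - y\<^sup>2)) (y - s) k' l' m' = f3 (x + 2 * (h + i + j) * y + ((h + i + j)\<^sup>2 - i - 2 * j))"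
          by (rule G, simp add: h_def i_def j_def s_def power2_eq_square algebra_simps)+
        show ?thesis unfolding X_def e by (simp add: mult_ac)
      qed
      then show ?thesis by simp
    qed
    finally have eq: "(AV x. AV y. X k k' l l' m m' x y) = ?C" .
    \<comment> \<open>If one of the seven slopes vanishes, the trivial bound 1 is used; each case
      has density 1 / p, which is the origin of 7 / p.\<close>
    have "cmod ?C \<le> root 128 (NN 6 f3)
     + (of_bool (int p dvd h) + (of_bool (int p dvd i) + (of_bool (int p dvd h + i)
     + (of_bool (int p dvd j) + (of_bool (int p dvd h + j)
     + (of_bool (int p dvd i + j) + of_bool (int p dvd h + i + j)))))))"
    proof (cases "int p dvd h \<or> int p dvd i \<or> int p dvd h + i \<or> int p dvd j \<or> int p dvd h + j
        \<or> int p dvd i + j \<or> int p dvd h + i + j")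
      case True
      have "cmod ?C \<le> 1"
        by (intro norm_av_le_const cmod_mult_le1) (simp_all add: fn_le1 [OF f(4)])
      also have "\<dots> \<le> of_bool (int p dvd h) + (of_bool (int p dvd i) + (of_bool (int p dvd h + i)
        + (of_bool (int p dvd j) + (of_bool (int p dvd h + j)
        + (of_bool (int p dvd i + j) + of_bool (int p dvd h + i + j))))))"
        using True by auto
      finally show ?thesis using real_root_ge_zero [OF NN_nonneg, of 128 6 f3] by linarith
    next
      case False
      then have nd: "\<not> int p dvd h" "\<not> int p dvd i" "\<not> int p dvd h + i" "\<not> int p dvd j"
        "\<not> int p dvd h + j" "\<not> int p dvd i + j" "\<not> int p dvd h + i + j" by blast+
      have "cmod ?C ^ 128 \<le> NN 6 f3" by (rule cube_bound [OF f(4) nd])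
      then have "cmod ?C \<le> root 128 (NN 6 f3)"
        by (rule le_root128 [OF norm_ge_zero])
      then show ?thesis by simp
    qed
    then show "Re (AV x. AV y. X k k' l l' m m' x y) \<le> root 128 (NN 6 f3)
     + (of_bool (int p dvd k' - k) + (of_bool (int p dvd l' - l) + (of_bool (int p dvd (k' - k) + (l' - l))
     + (of_bool (int p dvd m' - m) + (of_bool (int p dvd (k' - k) + (m' - m))
     + (of_bool (int p dvd (l' - l) + (m' - m)) + of_bool (int p dvd (k' - k) + (l' - l) + (m' - m))))))))"
      unfolding eq h_def i_def j_def by (rule order_trans [OF complex_Re_le_cmod])
  qed
  also have "\<dots> = root 128 (NN 6 f3) + 7 / p"
  proof -
    have "(AV k'. of_bool (int p dvd k' - k + c)) = 1 / real p" for k c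
      using av_of_bool_dvd1(1) [of "c - k"] by (simp add: algebra_simps)
    moreover have "(AV k'. of_bool (int p dvd c + (k' - k))) = 1 / real p" for k c
      using av_of_bool_dvd1(1) [of "c - k"] by (simp add: algebra_simps)
    ultimately show ?thesis by (simp only: av_add av_const av_of_bool_dvd1)
  qed
  finally show ?thesis .
qed

section \<open>Fourier coefficients and quadratic phases\<close>

text \<open>The inverse theorem for U^2: the fourth power of the norm is the sum of the fourth
  powers of the Fourier coefficients, at most the largest squared coefficient times the Parseval
  sum.\<close>

lemma NN1_le_fourier:
  assumes g: "fn g"
  shows "\<exists>a. NN 1 g \<le> (cmod (AV x. g x * ep (a * x)))\<^sup>2"
proof -
  define G where "G a = (AV x. g x * ep (a * x))" for a
  define r where "r h = av (dd h g)" for h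
  note pg = per_comp [OF fn_per [OF g]]
  have pr: "per r"
    unfolding r_def by (rule per_map [OF per_dd [OF fn_per [OF g]]])
  have pg': "per (\<lambda>x. g x * ep (a * x))" for a
    by (intro per_intros fn_per g)
  have hat: "(AV h. r h * ep (a * h)) = complex_of_real ((cmod (G a))\<^sup>2)" for a
  proof -
    have "g (x + h) * ep (a * (x + h)) * cnj (g x * ep (a * x)) = dd h g x * ep (a * h)" for x h
    proof -
      have "ep (a * (x + h)) * cnj (ep (a * x)) = ep (a * h)"
        unfolding ep_diff [symmetric] by (simp add: algebra_simps)
      then show ?thesis by (simp add: dd_def mult_ac)
    qed
    then show ?thesis
      unfolding G_def av_square_shift [OF pg'] r_def by (simp add: av_multc)
  qed
  have sum: "(\<Sum>a\<in>{0..<int p}. (cmod (G a))\<^sup>2) \<le> 1"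
    unfolding G_def parseval [OF fn_per [OF g]]
    by (intro av_le_const power_le_one) (auto simp: fn_le1 [OF g])
  have eq: "NN 1 g = (\<Sum>a\<in>{0..<int p}. ((cmod (G a))\<^sup>2)\<^sup>2)"
  proof -
    have "NN 1 g = (AV h. (cmod (r h))\<^sup>2)" by (simp add: r_def)
    also have "\<dots> = (\<Sum>a\<in>{0..<int p}. (cmod (AV h. r h * ep (a * h)))\<^sup>2)"
      by (simp add: parseval [OF pr])
    finally show ?thesis unfolding hat norm_of_real by simp
  qed
  define M where "M = Max ((\<lambda>a. (cmod (G a))\<^sup>2) ` {0..<int p})"
  have ne: "(\<lambda>a. (cmod (G a))\<^sup>2) ` {0..<int p} \<noteq> {}" by simp
  have "M \<in> (\<lambda>a. (cmod (G a))\<^sup>2) ` {0..<int p}" unfolding M_def by (rule Max_in [OF _ ne]) simp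
  then obtain a where a: "M = (cmod (G a))\<^sup>2" by auto
  have "NN 1 g \<le> (\<Sum>a\<in>{0..<int p}. M * (cmod (G a))\<^sup>2)"
    unfolding eq power2_eq_square [of "(cmod (G _))\<^sup>2"] M_def
    by (intro sum_mono mult_right_mono Max_ge) auto
  also have "\<dots> \<le> M * 1"
    unfolding sum_distrib_left [symmetric] using sum a by (intro mult_left_mono) auto
  finally show ?thesis using a by (auto simp: G_def)
qed

text \<open>Two forms besides \<open>g\<close> give the U^2 norm of \<open>g\<close>, and this
  yields a Fourier coefficient. One square on the left is lost because \<open>NN 1\<close> is
  bounded by a squared coefficient.\<close>

lemma ap3:
  assumes "fn g" "fn g1" "fn g2" "\<not> int p dvd a" "\<not> int p dvd b"
  shows "\<exists>\<xi>. (cmod (AV x. AV y. g x * g1 (x + a * y) * g2 (x + b * y)))\<^sup>2 \<le> cmod (AV x. g x * ep (\<xi> * x))"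
proof -
  have "cmod (AV z. AV u. g z * prod_list (map (\<lambda>(a, f). f (z + a * u)) [(a, g1), (b, g2)])) ^ (2 ^ Suc 1) \<le> NN 1 g"
    by (rule linear_forms) (use assms in auto)
  then have "((cmod (AV x. AV y. g x * g1 (x + a * y) * g2 (x + b * y)))\<^sup>2)\<^sup>2 \<le> NN 1 g"
    by (simp add: mult.assoc del: NN.simps)
  with NN1_le_fourier [OF assms(1)] show ?thesis
    by (meson norm_ge_zero order_trans power2_le_imp_le)
qed

text \<open>A linear phase on \<open>x + y\<^sup>2\<close> splits into quadratic phases on the 3-term progression because
  \<open>2 y\<^sup>2 = x\<^sup>2 - 2 (x + y)\<^sup>2 + (x + 2 y)\<^sup>2\<close>.\<close>

lemma Du_fourier:
  assumes f: "fn f0" "fn f1" "fn f2" and i: "g = f0 \<or> g = f1 \<or> g = f2"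
  shows "\<exists>\<alpha> \<beta>. (cmod (AV z. Du f0 f1 f2 z * ep (a * z)))\<^sup>2 \<le> cmod (AV x. g x * ep (\<alpha> * x\<^sup>2 + \<beta> * x))"
proof -
  \<comment> \<open>\<open>(int p + 1) div 2\<close> inverts 2 modulo p, so \<open>2 * c\<close> is
    congruent to \<open>a\<close>.\<close>
  define c where "c = a * ((int p + 1) div 2)"
  have "odd p" using prime_p p_gt3 prime_odd_nat by auto
  then have c: "2 * c = a * (int p + 1)" by (auto simp: c_def elim: oddE)
  define d where "d = - 2 * c"
  define g0 where "g0 x = f0 x * ep (c * x\<^sup>2 + a * x)" for x
  define g1 where "g1 x = f1 x * ep (d * x\<^sup>2)" for x
  define g2 where "g2 x = f2 x * ep (c * x\<^sup>2)" for x
  have g: "fn g0" "fn g1" "fn g2"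
    unfolding g0_def g1_def g2_def by (intro fn_mult f fn_ep per_intros)+
  note pg = g [THEN fn_per, THEN per_comp]
  have fea: "fn (\<lambda>z. ep (a * z))" by (intro fn_ep per_intros)
  have id: "ep (c * x\<^sup>2 + a * x) * ep (d * (x + y)\<^sup>2) * ep (c * (x + 2 * y)\<^sup>2) = ep (a * (x + y\<^sup>2))" for x y
  proof -
    have "ep (c * x\<^sup>2 + a * x) * ep (d * (x + y)\<^sup>2) * ep (c * (x + 2 * y)\<^sup>2)
      = ep (c * x\<^sup>2 + a * x + d * (x + y)\<^sup>2 + c * (x + 2 * y)\<^sup>2)" by (simp only: ep_add)
    also have "c * x\<^sup>2 + a * x + d * (x + y)\<^sup>2 + c * (x + 2 * y)\<^sup>2 = a * x + 2 * c * y\<^sup>2"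
      by (simp add: d_def power2_eq_square algebra_simps)
    also have "\<dots> = a * (x + y\<^sup>2) + int p * (a * y\<^sup>2)"
      unfolding c by (simp add: algebra_simps)
    finally show ?thesis by (simp add: ep_add ep_mult_p)
  qed
  have "(AV z. Du f0 f1 f2 z * ep (a * z)) = (AV x. AV y. g0 x * g1 (x + y) * g2 (x + 2 * y))"
  proof -
    have "f0 x * f1 (x + y) * f2 (x + 2 * y) * ep (a * (x + y\<^sup>2)) = g0 x * g1 (x + y) * g2 (x + 2 * y)" for x y
      unfolding g0_def g1_def g2_def id [symmetric] by (simp add: mult_ac)
    then show ?thesis
      by (subst Lam_Du [symmetric]) (auto simp: Lam_def intro: f fn_per fea)
  qed
  moreover have "\<exists>\<xi>. (cmod (AV x. AV y. g0 x * g1 (x + y) * g2 (x + 2 * y)))\<^sup>2 \<le> cmod (AV x. g0 x * ep (\<xi> * x))"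
    using ap3 [OF g, of 1 2] p_gt3 by simp
  moreover have "\<exists>\<xi>. (cmod (AV x. AV y. g0 x * g1 (x + y) * g2 (x + 2 * y)))\<^sup>2 \<le> cmod (AV x. g1 x * ep (\<xi> * x))"
  proof -
    have "(AV x. AV y. g0 x * g1 (x + y) * g2 (x + 2 * y)) = (AV y. AV x. g0 x * g1 (x + y) * g2 (x + 2 * y))"
      by (rule av_swap)
    \<comment> \<open>The progression is recentred at its middle term, so that \<open>g1\<close>
      becomes the base function of \<open>ap3\<close>; the case of \<open>g2\<close> uses the last
      term.\<close>
    also have "\<dots> = (AV y. AV x. g0 (x + - y) * g1 (x + - y + y) * g2 (x + - y + 2 * y))"
      by (subst av_shift) (auto intro!: per_intros pg)
    also have "\<dots> = (AV x. AV y. g1 x * g0 (x + - 1 * y) * g2 (x + 1 * y))"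
      by (rule trans [OF av_swap]) (simp add: algebra_simps)
    finally show ?thesis using ap3 [OF g(2,1,3), of "- 1" 1] by simp
  qed
  moreover have "\<exists>\<xi>. (cmod (AV x. AV y. g0 x * g1 (x + y) * g2 (x + 2 * y)))\<^sup>2 \<le> cmod (AV x. g2 x * ep (\<xi> * x))"
  proof -
    have "(AV x. AV y. g0 x * g1 (x + y) * g2 (x + 2 * y)) = (AV y. AV x. g0 x * g1 (x + y) * g2 (x + 2 * y))"
      by (rule av_swap)
    also have "\<dots> = (AV y. AV x. g0 (x + - 2 * y) * g1 (x + - 2 * y + y) * g2 (x + - 2 * y + 2 * y))"
      by (subst av_shift) (auto intro!: per_intros pg)
    also have "\<dots> = (AV x. AV y. g2 x * g0 (x + - 2 * y) * g1 (x + - 1 * y))"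
      by (rule trans [OF av_swap]) (simp add: algebra_simps)
    finally show ?thesis using ap3 [OF g(3,1,2), of "- 2" "- 1"] by simp
  qed
  moreover have "g0 x * ep (\<xi> * x) = f0 x * ep (c * x\<^sup>2 + (a + \<xi>) * x)"
    "g1 x * ep (\<xi> * x) = f1 x * ep (d * x\<^sup>2 + \<xi> * x)"
    "g2 x * ep (\<xi> * x) = f2 x * ep (c * x\<^sup>2 + \<xi> * x)" for x \<xi>
    by (simp_all add: g0_def g1_def g2_def ep_add [symmetric] algebra_simps)
  ultimately show ?thesis using i by auto
qed

section \<open>The relation between derivative phases\<close>

text \<open>Cauchy--Schwarz on the fibres of \<open>y'\<^sup>2 - y\<^sup>2\<close>; pairs of points of a fibre are
  parametrised by \<open>(Y - r g, r Y - g)\<close> and \<open>(Y + r g, r Y + g)\<close>.\<close>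

lemma cs_hyperbola:
  assumes p1: "\<And>y'. per (\<lambda>y. X y y')" and p2: "\<And>y. per (\<lambda>y'. X y y')" and le: "\<And>y y'. cmod (X y y') \<le> 1"
  shows "(cmod (AV y. AV y'. X y y'))\<^sup>2
    \<le> Re (AV Y. AV r. AV g. X (Y - r * g) (r * Y - g) * cnj (X (Y + r * g) (r * Y + g))) + 3 / p"
proof -
  note pX1 = per_comp [OF p1] and pX2 = per_comp [OF p2]
  have pX: "per (\<lambda>x. X (h x) (k x))" if "pc h" "pc k" for h k
    unfolding per_def
  proof (intro allI impI)
    fix x y assume "[x = y] (mod int p)"
    then have "[h x = h y] (mod int p)" "[k x = k y] (mod int p)" using that by (auto simp: pc_def)
    then show "X (h x) (k x) = X (h y) (k y)" using perD [OF p1] perD [OF p2] by metis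
  qed
  define W where "W y y' y1 y1' = X y y' * cnj (X y1 y1')" for y y' y1 y1'
  define I :: "int \<Rightarrow> int \<Rightarrow> int \<Rightarrow> int \<Rightarrow> complex" where
    "I y y' y1 y1' = of_bool (int p dvd (y'\<^sup>2 - y\<^sup>2) - (y1'\<^sup>2 - y1\<^sup>2))" for y y' y1 y1'
  \<comment> \<open>\<open>S 0\<close> is the average to be bounded. Summing the squares over all
    frequencies \<open>a\<close> keeps exactly the pairs of points on a common fibre: this is
    Cauchy--Schwarz over the p fibres in Fourier form.\<close>
  define S where "S a = (AV y. AV y'. X y y' * ep (a * (y'\<^sup>2 - y\<^sup>2)))" for a
  have IW: "(AV a. complex_of_real ((cmod (S a))\<^sup>2)) = (AV y. AV y'. AV y1. AV y1'. I y y' y1 y1' * W y y' y1 y1')"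
  proof -
    have "complex_of_real ((cmod (S a))\<^sup>2)
      = (AV y. AV y'. AV y1. AV y1'. W y y' y1 y1' * ep (a * ((y'\<^sup>2 - y\<^sup>2) - (y1'\<^sup>2 - y1\<^sup>2))))" for a
    proof -
      have "complex_of_real ((cmod (S a))\<^sup>2) = S a * cnj (S a)" by (rule complex_norm_square)
      also have "\<dots> = (AV y. AV y'. X y y' * ep (a * (y'\<^sup>2 - y\<^sup>2)) * cnj (S a))"
        by (simp add: S_def av_multc)
      also have "\<dots> = (AV y. AV y'. AV y1. AV y1'. X y y' * ep (a * (y'\<^sup>2 - y\<^sup>2)) * cnj (X y1 y1' * ep (a * (y1'\<^sup>2 - y1\<^sup>2))))"
        by (simp only: S_def av_cnj av_cmult)
      also have "\<dots> = (AV y. AV y'. AV y1. AV y1'. W y y' y1 y1' * ep (a * ((y'\<^sup>2 - y\<^sup>2) - (y1'\<^sup>2 - y1\<^sup>2))))"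
        unfolding right_diff_distrib [of a "_ - _" "_ - _"] ep_diff [of "a * (_ - _)" "a * (_ - _)"] W_def by (simp add: mult_ac)
      finally show ?thesis .
    qed
    then have "(AV a. complex_of_real ((cmod (S a))\<^sup>2))
      = (AV a. AV y. AV y'. AV y1. AV y1'. W y y' y1 y1' * ep (a * ((y'\<^sup>2 - y\<^sup>2) - (y1'\<^sup>2 - y1\<^sup>2))))"
      by (simp only:)
    also have "\<dots> = (AV y. AV y'. AV y1. AV y1'. AV a. W y y' y1 y1' * ep (a * ((y'\<^sup>2 - y\<^sup>2) - (y1'\<^sup>2 - y1\<^sup>2))))"
      by (rule av_up4 [symmetric])
    also have "\<dots> = (AV y. AV y'. AV y1. AV y1'. W y y' y1 y1' * I y y' y1 y1')"
      by (simp only: av_cmult av_ep' I_def)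
    also have "\<dots> = (AV y. AV y'. AV y1. AV y1'. I y y' y1 y1' * W y y' y1 y1')"
      by (simp only: mult.commute)
    finally show ?thesis .
  qed
  have "(cmod (S 0))\<^sup>2 \<le> (\<Sum>a\<in>{0..<int p}. (cmod (S a))\<^sup>2)"
    by (rule member_le_sum) auto
  also have "\<dots> = p * (AV a. (cmod (S a))\<^sup>2)" by (simp add: av_sum_left)
  also have "(AV a. (cmod (S a))\<^sup>2) = Re (AV a. complex_of_real ((cmod (S a))\<^sup>2))" by (simp add: av_Re)
  also note IW
  finally have 1: "(cmod (AV y. AV y'. X y y'))\<^sup>2
      \<le> p * Re (AV y. AV y'. AV y1. AV y1'. I y y' y1 y1' * W y y' y1 y1')" by (simp add: S_def)
  define V where "V g = (AV y. AV y'. AV y1. I y y' y1 (2 * g + y') * W y y' y1 (2 * g + y'))" for g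
  define U where "U g = (AV r. AV Y. X (Y - r * g) (r * Y - g) * cnj (X (Y + r * g) (r * Y + g)))" for g
  have pI: "per (\<lambda>x. I (h1 x) (h2 x) (h3 x) (h4 x) * W (h1 x) (h2 x) (h3 x) (h4 x))"
    if "pc h1" "pc h2" "pc h3" "pc h4" for h1 h2 h3 h4
    unfolding I_def W_def by (intro per_intros pX that)
  have 2: "(AV y. AV y'. AV y1. AV y1'. I y y' y1 y1' * W y y' y1 y1') = av V"
  proof -
    have "per (\<lambda>y1'. I y y' y1 y1' * W y y' y1 y1')" for y y' y1 by (intro pI per_intros)
    then have "(AV y1'. I y y' y1 y1' * W y y' y1 y1')
        = (AV g. I y y' y1 (2 * g + y') * W y y' y1 (2 * g + y'))" for y y' y1
      by (rule av_affine [symmetric]) simp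
    then have "(AV y. AV y'. AV y1. AV y1'. I y y' y1 y1' * W y y' y1 y1')
        = (AV y. AV y'. AV y1. AV g. I y y' y1 (2 * g + y') * W y y' y1 (2 * g + y'))" by (simp only:)
    also have "\<dots> = av V" unfolding V_def by (rule av_up3)
    finally show ?thesis .
  qed
  have V: "V g = U g / p" if g: "\<not> int p dvd g" for g
  proof -
    have g2: "\<not> int p dvd 2 * g" using g prime_dvd_mult_iff [OF prime_int, of 2 g] by simp
    \<comment> \<open>Under \<open>y1 = y + 2 * g * r\<close> and \<open>y1' = y' + 2 * g\<close>
      the factor \<open>- 4 * g\<close> comes out of the fibre condition, which becomes linear in
      \<open>y'\<close> with solution \<open>a y r\<close>. Passing to the midpoint
      \<open>Y = y + r * g\<close> makes the pair symmetric.\<close>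
    define a where "a y r = r * y + r\<^sup>2 * g - g" for y r
    define R where "R y r y' = W y y' (2 * g * r + y) (2 * g + y')" for y r y'
    have pR: "per (\<lambda>x. R (h x) (k x) (l x))" if "pc h" "pc k" "pc l" for h k l
      unfolding R_def W_def by (intro per_intros pX that)
    have I: "I y y' (2 * g * r + y) (2 * g + y') = of_bool (int p dvd y' - a y r)" for y y' r
    proof -
      have "(y'\<^sup>2 - y\<^sup>2) - ((2 * g + y')\<^sup>2 - (2 * g * r + y)\<^sup>2) = (- 4 * g) * (y' - a y r)"
        by (simp add: a_def power2_eq_square algebra_simps)
      moreover have "int p dvd (- 4 * g) * x \<longleftrightarrow> int p dvd x" for x
        using g by (simp add: prime_dvd_mult_iff [OF prime_int])
      ultimately show ?thesis by (simp only: I_def)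
    qed
    have "per (\<lambda>y1. I y y' y1 (2 * g + y') * W y y' y1 (2 * g + y'))" for y y' by (intro pI per_intros)
    from av_affine [OF this g2]
    have "V g = (AV y. AV y'. AV r. of_bool (int p dvd y' - a y r) * R y r y')"
      unfolding V_def R_def I [symmetric] by (simp only:)
    also have "\<dots> = (AV y. AV r. AV y'. of_bool (int p dvd y' - a y r) * R y r y')" by (rule av_swap_in)
    also have "\<dots> = (AV y. AV r. R y r (a y r) / of_nat p)"
    proof -
      have "per (\<lambda>y'. R y r y')" for y r by (intro pR per_intros)
      from av_indicator [OF this] show ?thesis by (simp only:)
    qed
    also have "\<dots> = (AV r. AV y. R y r (a y r) / of_nat p)" by (rule av_swap)
    also have "\<dots> = (AV r. AV Y. R (Y + - r * g) r (a (Y + - r * g) r) / of_nat p)"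
    proof -
      have "per (\<lambda>y. R y r (a y r) / of_nat p)" for r
        unfolding a_def divide_inverse by (intro per_intros pR)
      from av_shift [OF this] show ?thesis by (simp only:)
    qed
    also have "\<dots> = (AV r. AV Y. X (Y - r * g) (r * Y - g) * cnj (X (Y + r * g) (r * Y + g)) / of_nat p)"
    proof -
      have "a (Y + - r * g) r = r * Y - g" for Y r by (simp add: a_def power2_eq_square algebra_simps)
      moreover have "2 * g * r + (Y + - r * g) = Y + r * g" "2 * g + (r * Y - g) = r * Y + g"
        "Y + - r * g = Y - r * g" for Y r by simp_all
      ultimately show ?thesis by (simp only: R_def W_def)
    qed
    also have "\<dots> = U g / p" by (simp add: U_def divide_inverse av_multc)
    finally show ?thesis .
  qed
  \<comment> \<open>For \<open>g = 0\<close> the slope \<open>r\<close> parametrises nothing. The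
    fibre condition then means \<open>y1 = y\<close> or \<open>y1 = - y\<close>, which costs 2 / p;
    inserting the missing term \<open>U 0 / p\<close> costs another 1 / p.\<close>
  have V0: "cmod (V 0) \<le> 2 / p"
  proof -
    have "cmod (V 0) \<le> (AV y. AV y'. AV y1. of_bool (int p dvd y1 - y) + of_bool (int p dvd y1 + y))"
      unfolding V_def
    proof (rule order_trans [OF norm_av_le], intro av_mono, rule order_trans [OF norm_av_le],
        intro av_mono, rule order_trans [OF norm_av_le], intro av_mono)
      fix y y' y1
      have W: "cmod (W y y' y1 y') \<le> 1" unfolding W_def by (intro cmod_mult_le1) (simp_all add: le)
      have "(y'\<^sup>2 - y\<^sup>2) - (y'\<^sup>2 - y1\<^sup>2) = (y1 - y) * (y1 + y)" by (simp add: power2_eq_square algebra_simps)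
      then have I: "I y y' y1 y' = of_bool (int p dvd y1 - y \<or> int p dvd y1 + y)"
        by (simp only: I_def prime_dvd_mult_iff [OF prime_int])
      show "cmod (I y y' y1 (2 * 0 + y') * W y y' y1 (2 * 0 + y'))
          \<le> of_bool (int p dvd y1 - y) + of_bool (int p dvd y1 + y)"
        using W by (simp add: I norm_mult)
    qed
    also have "\<dots> = 2 / p" by (simp add: av_add av_of_bool_dvd1)
    finally show ?thesis .
  qed
  have U0: "cmod (U 0) \<le> 1"
    unfolding U_def by (intro norm_av_le_const cmod_mult_le1) (simp_all add: le)
  have "p * av V = (\<Sum>g\<in>{0..<int p}. V g)" by (simp add: av_sum_left)
  also have "{0..<int p} = insert 0 {1..<int p}" by auto
  also have "(\<Sum>g\<in>insert 0 {1..<int p}. V g) = V 0 + (\<Sum>g\<in>{1..<int p}. V g)" by simp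
  also have "(\<Sum>g\<in>{1..<int p}. V g) = (\<Sum>g\<in>{1..<int p}. U g / p)"
    by (intro sum.cong refl V) (auto dest: zdvd_imp_le)
  also have "\<dots> = (\<Sum>g\<in>insert 0 {1..<int p}. U g / p) - U 0 / p" by simp
  also have "insert 0 {1..<int p} = {0..<int p}" by auto
  also have "(\<Sum>g\<in>{0..<int p}. U g / p) = av U" by (simp add: av_def sum_divide_distrib)
  finally have 3: "p * av V = av U + (V 0 - U 0 / p)" by simp
  have "(cmod (AV y. AV y'. X y y'))\<^sup>2 \<le> Re (p * av V)" using 1 unfolding 2 by simp
  also have "\<dots> \<le> Re (av U) + cmod (V 0 - U 0 / p)"
    unfolding 3 using complex_Re_le_cmod [of "V 0 - U 0 / p"] by simp
  also have "cmod (V 0 - U 0 / p) \<le> 2 / p + 1 / p"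
    by (rule order_trans [OF norm_triangle_ineq4 add_mono [OF V0]]) (simp add: norm_divide U0 divide_right_mono)
  also have "av U = (AV Y. AV r. AV g. X (Y - r * g) (r * Y - g) * cnj (X (Y + r * g) (r * Y + g)))"
    unfolding U_def by (rule trans [OF av_up2 av_swap_in])
  finally show ?thesis by (simp add: add_divide_distrib [symmetric])
qed

text \<open>Doubling the shifts \<open>m\<close> and \<open>l\<close> creates more variables than
  the integrand sees; translation invariance absorbs the redundant \<open>x\<close>,
  \<open>m\<close>, \<open>l\<close>.\<close>

lemma av_unshift:
  assumes p1: "\<And>b m l. per (\<lambda>a. G a b m l)" and p2: "\<And>a m l. per (\<lambda>b. G a b m l)"
    and p3: "\<And>a b l. per (\<lambda>m. G a b m l)" and p4: "\<And>a b m. per (\<lambda>l. G a b m l)"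
  shows "(AV x. AV a. AV b. AV m. AV m'. AV l. AV l'. G (a + c x m l) (b + (m + l)) (m' + - m) (l' + - l))
    = (AV a. AV b. AV m. AV l. G a b m l)"
proof -
  define H where "H m l = (AV a. AV b. G a b m l)" for m l
  have H: "per (\<lambda>m. H m l)" "per (\<lambda>l. H m l)" for m l
    unfolding H_def by (intro per_av p3 p4)+
  have inner: "(AV a. AV b. G (a + c x m l) (b + (m + l)) m' l') = H m' l'" for x m l m' l'
    using av_shift [OF per_av, of "\<lambda>a b. G a b m' l'" "c x m l", OF p1] av_shift [OF p2]
    unfolding H_def by (simp only:)
  have "(AV a. AV b. AV m. AV m'. AV l. AV l'. G (a + c x m l) (b + (m + l)) (m' + - m) (l' + - l))
    = (AV m. AV m'. AV l. AV l'. AV a. AV b. G (a + c x m l) (b + (m + l)) (m' + - m) (l' + - l))" for x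
    by (rule trans [OF arg_cong [where f = av, OF ext, OF av_up4 [symmetric]] av_up4 [symmetric]])
  then have "(AV a. AV b. AV m. AV m'. AV l. AV l'. G (a + c x m l) (b + (m + l)) (m' + - m) (l' + - l))
    = (AV m. AV m'. AV l. AV l'. H (m' + - m) (l' + - l))" for x
    by (simp only: inner)
  moreover have "(AV m. AV m'. AV l. AV l'. H (m' + - m) (l' + - l)) = (AV m. AV l. H m l)"
  proof -
    have "(AV m'. AV l'. H (m' + - m) l') = (AV m'. AV l'. H m' l')" for m
      by (rule av_shift) (intro per_av H)
    then show ?thesis by (simp only: av_shift [OF H(2)] av_const)
  qed
  moreover have "(AV m. AV l. H m l) = (AV a. AV b. AV m. AV l. G a b m l)"
    unfolding H_def by (rule trans [OF av_up3 av_up3])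
  ultimately show ?thesis by (simp only: av_const)
qed

lemma per_pc: "per f \<Longrightarrow> pc g \<Longrightarrow> pc (\<lambda>x. f (g x))"
  unfolding per_def pc_def by (metis cong_refl)

lemma av_swap22: "(AV k. AV l. AV x. AV y. R k l x y) = (AV x. AV y. AV k. AV l. R k l x y)"
  by (rule trans [OF av_up3 av_up3])

lemma av_swap32: "(AV k. AV l. AV m. AV x. AV y. R k l m x y) = (AV x. AV y. AV k. AV l. AV m. R k l m x y)"
  by (rule trans [OF av_up4 av_up4])

lemma cmod_av3_power_le:
  "cmod (AV x. AV y. AV z. f x y z) ^ (2 ^ n) \<le> (AV x. AV y. AV z. cmod (f x y z) ^ (2 ^ n))"
  by (rule order_trans [OF cmod_av_power_le av_mono]) (rule cmod_av2_power_le)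

text \<open>15 = 4 + 6 + 4 + 1, from the binomial terms that contain \<open>e\<close>.\<close>

lemma power4_add_le:
  fixes a e :: real
  assumes "0 \<le> a" "a \<le> 1" "0 \<le> e" "e \<le> 1"
  shows "(a + e) ^ 4 \<le> a ^ 4 + 15 * e"
proof -
  have e: "e\<^sup>2 \<le> e" "e ^ 3 \<le> e" "e ^ 4 \<le> e"
    using assms power_decreasing [of 1 2 e] power_decreasing [of 1 3 e] power_decreasing [of 1 4 e] by auto
  have "a ^ 3 * e \<le> 1 * e" "a\<^sup>2 * e\<^sup>2 \<le> 1 * e" "a * e ^ 3 \<le> 1 * e"
    by (rule mult_mono; use assms e in \<open>auto intro: power_le_one\<close>)+
  note this e(3)
  moreover have "(a + e) ^ 4 = a ^ 4 + 4 * (a ^ 3 * e) + 6 * (a\<^sup>2 * e\<^sup>2) + 4 * (a * e ^ 3) + e ^ 4"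
    by (simp add: power2_eq_square power3_eq_cube power4_eq_xxxx algebra_simps)
  ultimately show ?thesis by linarith
qed

text \<open>Paired points of a fibre share the value of \<open>k\<close>, so their phases differ by
  \<open>\<phi>(k) (y\<^sup>2 - y1\<^sup>2) = - 4 r g b \<phi>(k)\<close>; the average over \<open>g\<close> then detects a linear relation.\<close>

lemma core_relation:
  assumes g: "fn g0" "fn g1" "fn g2" and h: "fn h0" "fn h1" "fn h2"
    and \<theta>: "per \<theta>" "\<And>k. cmod (\<theta> k) \<le> 1" and \<phi>: "per \<phi>"
  shows "cmod (AV k. AV z. AV y. AV y'. \<theta> k * ep (\<phi> k * z) *
      (h0 (z - y\<^sup>2) * h1 (z - y\<^sup>2 + y) * h2 (z - y\<^sup>2 + 2 * y)) *
      (g0 (z + k - y'\<^sup>2) * g1 (z + k - y'\<^sup>2 + y') * g2 (z + k - y'\<^sup>2 + 2 * y'))) ^ 8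
    \<le> 45 / p + (AV r. AV a. AV b. AV m. AV l. cmod (\<theta> (a + (r\<^sup>2 - 1) * b\<^sup>2)) *
      of_bool (int p dvd r * (b * \<phi> (a + (r\<^sup>2 - 1) * b\<^sup>2)
        - (b + m) * \<phi> (a - (r - 1) * m + (r\<^sup>2 - 1) * (b + m)\<^sup>2)
        - (b + l) * \<phi> (a - (r - 1) * (2 * l) + (r\<^sup>2 - 1) * (b + l)\<^sup>2)
        + (b + m + l) * \<phi> (a - (r - 1) * (m + 2 * l) + (r\<^sup>2 - 1) * (b + m + l)\<^sup>2))))"
    (is "cmod ?T ^ 8 \<le> _ + ?Z")
proof -
  note pgh = g [THEN fn_per, THEN per_comp] h [THEN fn_per, THEN per_comp]
    per_comp [OF \<theta>(1)] per_pc [OF \<phi>] per_comp [OF \<phi>]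
  define R where "R k z y y' = \<theta> k * ep (\<phi> k * z) *
      (h0 (z - y\<^sup>2) * h1 (z - y\<^sup>2 + y) * h2 (z - y\<^sup>2 + 2 * y)) *
      (g0 (z + k - y'\<^sup>2) * g1 (z + k - y'\<^sup>2 + y') * g2 (z + k - y'\<^sup>2 + 2 * y'))" for k z y y'
  define X where "X x x' y y' = h1 (x + y) * g1 (x' + y') * (h2 (x + 2 * y) * g2 (x' + 2 * y')) *
    (\<theta> (x' + y'\<^sup>2 - x - y\<^sup>2) * ep (\<phi> (x' + y'\<^sup>2 - x - y\<^sup>2) * (x + y\<^sup>2)))" for x x' y y'
  have pR: "per (\<lambda>k. R k z y y')" "per (\<lambda>z. AV k. R k z y y')" for k z y y'
    unfolding R_def by (intro per_intros pgh)+
  have "?T = (AV k. AV z. AV y. AV y'. R k z y y')" unfolding R_def ..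
  also have "\<dots> = (AV y. AV y'. AV k. AV z. R k z y y')" by (rule av_swap22)
  also have "\<dots> = (AV y. AV y'. AV z. AV k. R k z y y')"
    by (rule arg_cong [where f = av], rule ext, rule arg_cong [where f = av], rule ext, rule av_swap)
  \<comment> \<open>New variables \<open>x = z - y^2\<close> and \<open>x' = z + k - y'^2\<close>.
    Then \<open>h0\<close> and \<open>g0\<close> depend on \<open>x\<close> and \<open>x'\<close>
    only, and \<open>k = x' + y'^2 - x - y^2\<close> is a function on the curves of
    \<open>cs_hyperbola\<close>.\<close>
  also have "\<dots> = (AV y. AV y'. AV x. AV x'. R (x' + (y'\<^sup>2 - x - y\<^sup>2)) (x + y\<^sup>2) y y')"
    by (simp only: av_shift [OF pR(1)] av_shift [OF pR(2)])
  also have "\<dots> = (AV x. AV x'. AV y. AV y'. R (x' + (y'\<^sup>2 - x - y\<^sup>2)) (x + y\<^sup>2) y y')" by (rule av_swap22)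
  also have "\<dots> = (AV x. AV x'. AV y. AV y'. (h0 x * g0 x') * X x x' y y')"
  proof -
    have "R (x' + (y'\<^sup>2 - x - y\<^sup>2)) (x + y\<^sup>2) y y' = (h0 x * g0 x') * X x x' y y'" for x x' y y'
    proof -
      have "x' + (y'\<^sup>2 - x - y\<^sup>2) = x' + y'\<^sup>2 - x - y\<^sup>2" "x + y\<^sup>2 - y\<^sup>2 = x"
        "x + y\<^sup>2 + (x' + y'\<^sup>2 - x - y\<^sup>2) - y'\<^sup>2 = x'" by simp_all
      then show ?thesis unfolding R_def X_def by (simp only:) (simp only: mult_ac)
    qed
    then show ?thesis by (simp only:)
  qed
  finally have T: "?T = (AV x. AV x'. (h0 x * g0 x') * (AV y. AV y'. X x x' y y'))" by (simp only: av_cmult)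
  \<comment> \<open>For fixed \<open>r\<close> and \<open>g\<close> the surviving functions depend
    on \<open>(x + Y, x' + r * Y)\<close> and on \<open>(x + 2 * Y, x' + 2 * r * Y)\<close>, so each
    can be made independent of one shift.\<close>
  define \<beta>1 where "\<beta>1 r g u v = h1 (u - r * g) * g1 (v - g) * cnj (h1 (u + r * g) * g1 (v + g))" for r g u v
  define \<beta>2 where "\<beta>2 r g u v = h2 (u - 2 * r * g) * g2 (v - 2 * g) * cnj (h2 (u + 2 * r * g) * g2 (v + 2 * g))" for r g u v
  define \<omega> where "\<omega> r g x x' Y = of_real ((cmod (\<theta> (x' - x + (r\<^sup>2 - 1) * (Y\<^sup>2 - g\<^sup>2))))\<^sup>2) *
    ep (\<phi> (x' - x + (r\<^sup>2 - 1) * (Y\<^sup>2 - g\<^sup>2)) * (- 4 * r * g * Y))" for r g x x' Y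
  define Z where "Z r g = (AV x. AV x'. AV Y. \<omega> r g x x' Y * \<beta>1 r g (x + Y) (x' + r * Y) * \<beta>2 r g (x + 2 * Y) (x' + 2 * r * Y))" for r g
  have X1: "cmod (X x x' y y') \<le> 1" for x x' y y'
    unfolding X_def by (intro cmod_mult_le1 g [THEN fn_le1] h [THEN fn_le1] \<theta>) simp
  have pair: "X x x' (Y - r * g) (r * Y - g) * cnj (X x x' (Y + r * g) (r * Y + g))
      = \<omega> r g x x' Y * \<beta>1 r g (x + Y) (x' + r * Y) * \<beta>2 r g (x + 2 * Y) (x' + 2 * r * Y)" for x x' Y r g
  proof -
    let ?k = "x' - x + (r\<^sup>2 - 1) * (Y\<^sup>2 - g\<^sup>2)"
    have k: "x' + (r * Y - g)\<^sup>2 - x - (Y - r * g)\<^sup>2 = ?k" "x' + (r * Y + g)\<^sup>2 - x - (Y + r * g)\<^sup>2 = ?k"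
      by (simp_all add: power2_eq_square algebra_simps)
    have e: "ep (\<phi> ?k * (x + (Y - r * g)\<^sup>2)) * cnj (ep (\<phi> ?k * (x + (Y + r * g)\<^sup>2))) = ep (\<phi> ?k * (- 4 * r * g * Y))"
      unfolding ep_diff [symmetric] by (rule arg_cong [where f = ep]) (simp add: power2_eq_square algebra_simps)
    have t: "of_real ((cmod (\<theta> ?k))\<^sup>2) = \<theta> ?k * cnj (\<theta> ?k)" by (rule complex_norm_square)
    have a: "x + (Y - r * g) = x + Y - r * g" "x + (Y + r * g) = x + Y + r * g"
      "x' + (r * Y - g) = x' + r * Y - g" "x' + (r * Y + g) = x' + r * Y + g"
      "x + 2 * (Y - r * g) = x + 2 * Y - 2 * r * g" "x + 2 * (Y + r * g) = x + 2 * Y + 2 * r * g"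
      "x' + 2 * (r * Y - g) = x' + 2 * r * Y - 2 * g" "x' + 2 * (r * Y + g) = x' + 2 * r * Y + 2 * g"
      by (simp_all add: algebra_simps)
    show ?thesis
      unfolding X_def \<omega>_def \<beta>1_def \<beta>2_def k e [symmetric] t a by (simp only: complex_cnj_mult complex_cnj_cnj mult_ac)
  qed
  have "(cmod ?T)\<^sup>2 \<le> (AV x. AV x'. (cmod ((h0 x * g0 x') * (AV y. AV y'. X x x' y y')))\<^sup>2)"
    unfolding T using cmod_av2_power_le [where n = 1] by simp
  also have "\<dots> \<le> (AV x. AV x'. (cmod (AV y. AV y'. X x x' y y'))\<^sup>2)"
  proof (intro av_mono2 power_mono)
    show "cmod (h0 x * g0 x' * (AV y y'. X x x' y y')) \<le> cmod (AV y y'. X x x' y y')" for x x'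
      using cmod_mult_le1 [OF fn_le1 [OF h(1)] fn_le1 [OF g(1)]]
      unfolding norm_mult [of "h0 x * g0 x'"] by (intro mult_left_le_one_le) auto
  qed simp
  also have "\<dots> \<le> (AV x. AV x'. Re (AV Y. AV r. AV g. \<omega> r g x x' Y * \<beta>1 r g (x + Y) (x' + r * Y) * \<beta>2 r g (x + 2 * Y) (x' + 2 * r * Y)) + 3 / p)"
    unfolding pair [symmetric]
    by (intro av_mono2 cs_hyperbola X1) (unfold X_def, (intro per_intros pgh)+)
  also have "\<dots> = Re (AV x. AV x'. AV Y. AV r. AV g. \<omega> r g x x' Y * \<beta>1 r g (x + Y) (x' + r * Y) * \<beta>2 r g (x + 2 * Y) (x' + 2 * r * Y)) + 3 / p"
    by (simp only: av_Re av_add av_const)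
  also have "(AV x. AV x'. AV Y. AV r. AV g. \<omega> r g x x' Y * \<beta>1 r g (x + Y) (x' + r * Y) * \<beta>2 r g (x + 2 * Y) (x' + 2 * r * Y))
      = (AV r. AV g. Z r g)"
    unfolding Z_def by (rule av_swap32)
  also have "Re (AV r. AV g. Z r g) \<le> (AV r. AV g. cmod (Z r g))"
    unfolding av_Re by (intro av_mono2 complex_Re_le_cmod)
  finally have T2: "(cmod ?T)\<^sup>2 \<le> (AV r. AV g. cmod (Z r g)) + 3 / p" by simp
  define k0 where "k0 r a b = a + (r\<^sup>2 - 1) * b\<^sup>2" for r a b :: int
  define k1 where "k1 r a b m = a - (r - 1) * m + (r\<^sup>2 - 1) * (b + m)\<^sup>2" for r a b m :: int
  define k2 where "k2 r a b l = a - (r - 1) * (2 * l) + (r\<^sup>2 - 1) * (b + l)\<^sup>2" for r a b l :: int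
  define k3 where "k3 r a b m l = a - (r - 1) * (m + 2 * l) + (r\<^sup>2 - 1) * (b + m + l)\<^sup>2" for r a b m l :: int
  define q where "q k = (cmod (\<theta> k))\<^sup>2" for k
  define t where "t r a b m l = q (k0 r a b) * q (k1 r a b m) * q (k2 r a b l) * q (k3 r a b m l)" for r a b m l
  define S where "S r a b m l = b * \<phi> (k0 r a b) - (b + m) * \<phi> (k1 r a b m)
    - (b + l) * \<phi> (k2 r a b l) + (b + m + l) * \<phi> (k3 r a b m l)" for r a b m l
  define G where "G r g a b m l = of_real (t r a b m l) * ep (g * (- 4 * r * S r a b m l))" for r g a b m l
  have pq: "pc h \<Longrightarrow> per (\<lambda>x. q (h x))" for h
    unfolding q_def by (intro per_intros pgh)
  have Z4: "cmod (Z r g) ^ 4 \<le> Re (AV a. AV b. AV m. AV l. G r g a b m l)" for r g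
  proof -
    \<comment> \<open>Moving \<open>x\<close> by \<open>- (m + 2 * l)\<close>, \<open>x'\<close> by
      \<open>r\<close> times that and \<open>Y\<close> by \<open>m + l\<close> makes \<beta>1
      independent of \<open>m\<close> and \<beta>2 independent of \<open>l\<close>;
      \<open>box_cs2\<close> then removes both.\<close>
    define f where "f x x' Y m l = \<omega> r g (x - (m + 2 * l)) (x' - r * (m + 2 * l)) (Y + (m + l))" for x x' Y m l
    define c where "c x m l = - x - (r - 1) * (m + 2 * l) - (r\<^sup>2 - 1) * g\<^sup>2" for x m l
    define Q where "Q x x' Y = \<omega> r g x x' Y * \<beta>1 r g (x + Y) (x' + r * Y) * \<beta>2 r g (x + 2 * Y) (x' + 2 * r * Y)" for x x' Y
    have pQ: "per (\<lambda>x. Q x x' Y)" "per (\<lambda>x'. Q x x' Y)" "per (\<lambda>Y. Q x x' Y)" for x x' Y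
      unfolding Q_def \<omega>_def \<beta>1_def \<beta>2_def by (intro per_intros pgh)+
    have Z1: "Z r g = (AV x. AV x'. AV Y. f x x' Y m l * \<beta>1 r g (x + Y - l) (x' + r * (Y - l))
        * \<beta>2 r g (x + 2 * Y + m) (x' + r * (2 * Y + m)))" for m l
    proof -
      have "Z r g = (AV x. AV x'. AV Y. Q x x' Y)" unfolding Z_def Q_def ..
      also have "\<dots> = (AV x. AV x'. AV Y. Q (x + - (m + 2 * l)) x' Y)"
        by (rule av_shift [symmetric]) (intro per_av pQ)
      also have "\<dots> = (AV x. AV x'. AV Y. Q (x + - (m + 2 * l)) (x' + - r * (m + 2 * l)) Y)"
        by (rule arg_cong [where f = av], rule ext, rule av_shift [symmetric]) (intro per_av pQ)
      also have "\<dots> = (AV x. AV x'. AV Y. Q (x + - (m + 2 * l)) (x' + - r * (m + 2 * l)) (Y + (m + l)))"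
        by (simp only: av_shift [OF pQ(3)])
      finally have Zr: "Z r g = (AV x. AV x'. AV Y. Q (x + - (m + 2 * l)) (x' + - r * (m + 2 * l)) (Y + (m + l)))" .
      have "x + - (m + 2 * l) = x - (m + 2 * l)" "x' + - r * (m + 2 * l) = x' - r * (m + 2 * l)"
        "x - (m + 2 * l) + (Y + (m + l)) = x + Y - l"
        "x' - r * (m + 2 * l) + r * (Y + (m + l)) = x' + r * (Y - l)"
        "x - (m + 2 * l) + 2 * (Y + (m + l)) = x + 2 * Y + m"
        "x' - r * (m + 2 * l) + 2 * r * (Y + (m + l)) = x' + r * (2 * Y + m)" for x x' Y
        by (simp_all add: algebra_simps)
      with Zr show ?thesis by (simp only: Q_def f_def)
    qed
    have "Z r g = (AV m. AV l. Z r g)" by simp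
    also have "\<dots> = (AV m. AV l. AV x. AV x'. AV Y. f x x' Y m l * \<beta>1 r g (x + Y - l) (x' + r * (Y - l))
        * \<beta>2 r g (x + 2 * Y + m) (x' + r * (2 * Y + m)))"
      by (rule arg_cong [where f = av], rule ext, rule arg_cong [where f = av], rule ext, rule Z1)
    also have "\<dots> = (AV x. AV x'. AV Y. AV m. AV l. f x x' Y m l * \<beta>1 r g (x + Y - l) (x' + r * (Y - l))
        * \<beta>2 r g (x + 2 * Y + m) (x' + r * (2 * Y + m)))"
      by (rule trans [OF av_up4 trans [OF av_up4 av_up4]])
    finally have "cmod (Z r g) ^ (2 ^ 2) \<le> (AV x. AV x'. AV Y. cmod (AV m. AV l. f x x' Y m l
        * \<beta>1 r g (x + Y - l) (x' + r * (Y - l)) * \<beta>2 r g (x + 2 * Y + m) (x' + r * (2 * Y + m))) ^ (2 ^ 2))"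
      by (simp only: cmod_av3_power_le)
    then have "cmod (Z r g) ^ 4 \<le> (AV x. AV x'. AV Y. cmod (AV m. AV l. f x x' Y m l
        * \<beta>1 r g (x + Y - l) (x' + r * (Y - l)) * \<beta>2 r g (x + 2 * Y + m) (x' + r * (2 * Y + m))) ^ 4)"
      by simp
    also have "\<dots> \<le> (AV x. AV x'. AV Y. Re (AV m. AV m'. AV l. AV l'. f x x' Y m l * cnj (f x x' Y m' l)
        * cnj (f x x' Y m l' * cnj (f x x' Y m' l'))))"
    proof (intro av_mono)
      fix x x' Y
      show "cmod (AV m. AV l. f x x' Y m l
        * \<beta>1 r g (x + Y - l) (x' + r * (Y - l)) * \<beta>2 r g (x + 2 * Y + m) (x' + r * (2 * Y + m))) ^ 4
        \<le> Re (AV m. AV m'. AV l. AV l'. f x x' Y m l * cnj (f x x' Y m' l)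
        * cnj (f x x' Y m l' * cnj (f x x' Y m' l')))"
        by (rule box_cs2; unfold \<beta>1_def \<beta>2_def, intro cmod_mult_le1)
           (simp_all add: g [THEN fn_le1] h [THEN fn_le1] cmod_mult_le1)
    qed
    also have "\<dots> = Re (AV x. AV x'. AV Y. AV m. AV m'. AV l. AV l'. f x x' Y m l * cnj (f x x' Y m' l)
        * cnj (f x x' Y m l' * cnj (f x x' Y m' l')))"
      by (simp only: av_Re)
    also have "\<dots> = Re (AV x. AV a. AV b. AV m. AV m'. AV l. AV l'.
        G r g (a + c x m l) (b + (m + l)) (m' + - m) (l' + - l))"
    proof -
      have "f x x' Y m l * cnj (f x x' Y m' l) * cnj (f x x' Y m l' * cnj (f x x' Y m' l'))
          = G r g (x' + c x m l) (Y + (m + l)) (m' + - m) (l' + - l)" for x x' Y m m' l l'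
      proof -
        define a b M L where "a = x' + c x m l" and "b = Y + (m + l)" and "M = m' + - m" and "L = l' + - l"
        have f: "f x x' Y i j = of_real (q k) * ep (\<phi> k * (- 4 * r * g * B))"
          if "x' - r * (i + 2 * j) - (x - (i + 2 * j)) + (r\<^sup>2 - 1) * ((Y + (i + j))\<^sup>2 - g\<^sup>2) = k"
            "Y + (i + j) = B" for i j k B
          unfolding f_def \<omega>_def that(1) unfolding that(2) q_def ..
        have e: "f x x' Y m l = of_real (q (k0 r a b)) * ep (\<phi> (k0 r a b) * (- 4 * r * g * b))"
          "f x x' Y m' l = of_real (q (k1 r a b M)) * ep (\<phi> (k1 r a b M) * (- 4 * r * g * (b + M)))"
          "f x x' Y m l' = of_real (q (k2 r a b L)) * ep (\<phi> (k2 r a b L) * (- 4 * r * g * (b + L)))"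
          "f x x' Y m' l' = of_real (q (k3 r a b M L)) * ep (\<phi> (k3 r a b M L) * (- 4 * r * g * (b + M + L)))"
          by (rule f; simp add: k0_def k1_def k2_def k3_def a_def b_def c_def M_def L_def power2_eq_square algebra_simps)+
        have "ep (g * (- 4 * r * S r a b M L)) = ep (\<phi> (k0 r a b) * (- 4 * r * g * b)
           - \<phi> (k1 r a b M) * (- 4 * r * g * (b + M)) - (\<phi> (k2 r a b L) * (- 4 * r * g * (b + L))
           - \<phi> (k3 r a b M L) * (- 4 * r * g * (b + M + L))))"
          by (rule arg_cong [where f = ep]) (simp add: S_def algebra_simps)
        then show ?thesis
          unfolding G_def e a_def [symmetric] b_def [symmetric] M_def [symmetric] L_def [symmetric] t_def ep_diff
          by (simp add: mult_ac)
      qed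
      then show ?thesis by (simp only:)
    qed
    also have "(AV x. AV a. AV b. AV m. AV m'. AV l. AV l'.
        G r g (a + c x m l) (b + (m + l)) (m' + - m) (l' + - l)) = (AV a. AV b. AV m. AV l. G r g a b m l)"
      by (rule av_unshift) (unfold G_def t_def S_def k0_def k1_def k2_def k3_def, (intro per_intros pq pgh)+)
    finally show ?thesis .
  qed
  define A where "A = (AV r. AV g. cmod (Z r g))"
  have "cmod (Z r g) \<le> 1" for r g
    unfolding Z_def pair [symmetric] by (intro norm_av_le_const cmod_mult_le1) (simp_all add: X1)
  then have A: "0 \<le> A" "A \<le> 1"
    unfolding A_def by (intro av_nonneg norm_ge_zero, intro av_le_const)
  have "A ^ (2 ^ 2) \<le> (AV r. (AV g. cmod (Z r g)) ^ (2 ^ 2))"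
    unfolding A_def by (intro av_jensen av_nonneg norm_ge_zero)
  also have "\<dots> \<le> (AV r. AV g. cmod (Z r g) ^ (2 ^ 2))"
    by (intro av_mono av_jensen norm_ge_zero)
  finally have "A ^ 4 \<le> (AV r. AV g. cmod (Z r g) ^ 4)" by simp
  also have "\<dots> \<le> (AV r. AV g. Re (AV a. AV b. AV m. AV l. G r g a b m l))"
    by (intro av_mono2 Z4)
  also have "\<dots> = (AV r. Re (AV a. AV b. AV m. AV l. AV g. G r g a b m l))"
    by (simp only: av_Re [symmetric] av_up4 [symmetric, of "\<lambda>a b m l g. G _ g a b m l"])
  also have "\<dots> = (AV r. AV a. AV b. AV m. AV l. t r a b m l * of_bool (int p dvd r * S r a b m l))"
  proof -
    have "int p dvd - 4 * r * s \<longleftrightarrow> int p dvd r * s" for r s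
      by (simp add: prime_dvd_mult_iff [OF prime_int])
    then have "Re (AV g. G r g a b m l) = t r a b m l * of_bool (int p dvd r * S r a b m l)" for r a b m l
      unfolding G_def av_cmult av_ep' by simp
    then show ?thesis by (simp only: av_Re)
  qed
  \<comment> \<open>Of the four weights only the one at \<open>k0\<close> is kept, the others being
    at most 1. In degree lowering it is the size of a Fourier coefficient.\<close>
  also have "\<dots> \<le> (AV r. AV a. AV b. AV m. AV l. cmod (\<theta> (k0 r a b)) * of_bool (int p dvd r * S r a b m l))"
  proof (intro av_mono mult_right_mono)
    fix r a b m l
    have q: "0 \<le> q k" "q k \<le> 1" "q k \<le> cmod (\<theta> k)" for k
      using \<theta>(2) [of k] by (auto simp: q_def power2_eq_square mult_left_le_one_le intro: mult_le_one)
    have "t r a b m l \<le> q (k0 r a b)"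
      unfolding t_def mult.assoc by (intro mult_right_le_one_le mult_le_one mult_nonneg_nonneg q)
    from this q(3) show "t r a b m l \<le> cmod (\<theta> (k0 r a b))" by (rule order_trans)
  qed simp
  also have "\<dots> = ?Z" unfolding k0_def k1_def k2_def k3_def S_def ..
  finally have A4: "A ^ 4 \<le> ?Z" .
  have "cmod ?T ^ 8 = ((cmod ?T)\<^sup>2) ^ 4" by (simp flip: power_mult)
  also have "\<dots> \<le> (A + 3 / p) ^ 4" using T2 unfolding A_def by (intro power_mono) auto
  \<comment> \<open>45 = 15 * 3, with 3 / p lost in \<open>cs_hyperbola\<close>.\<close>
  also have "\<dots> \<le> A ^ 4 + 15 * (3 / p)" using p_gt3 by (intro power4_add_le A) auto
  finally show ?thesis using A4 by simp
qed

section \<open>Counting solutions of the relation\<close>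

lemma dvd_mult_cancel:
  "int p dvd a * b \<Longrightarrow> \<not> int p dvd a \<Longrightarrow> int p dvd b"
  using prime_dvd_mult_iff [OF prime_int] by blast

text \<open>Both vectors are orthogonal to \<open>n\<close> and \<open>q\<close>, hence lie on the
  line of their nonzero cross product. Its middle coordinate \<open>u2\<close> cannot vanish because
  \<open>m\<close> does not.\<close>

lemma proportional:
  assumes v: "int p dvd b * n1 + m * n2 + l * n3" "int p dvd b * q1 + m * q2 + l * q3" "\<not> int p dvd m"
    and v': "int p dvd b' * n1 + m' * n2 + l' * n3" "int p dvd b' * q1 + m' * q2 + l' * q3"
    and nz: "\<not> (int p dvd n2 * q3 - n3 * q2 \<and> int p dvd n3 * q1 - n1 * q3 \<and> int p dvd n1 * q2 - n2 * q1)"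
  shows "int p dvd b * m' - b' * m" "int p dvd l * m' - l' * m"
proof -
  define u1 u2 u3 where "u1 = n2 * q3 - n3 * q2" and "u2 = n3 * q1 - n1 * q3" and "u3 = n1 * q2 - n2 * q1"
  have 1: "int p dvd b * u2 - m * u1"
    by (rule dvd_comb2 [OF v(1,2), of _ "- q3" n3]) (simp add: u1_def u2_def algebra_simps)
  have 2: "int p dvd l * u2 - m * u3"
    by (rule dvd_comb2 [OF v(1,2), of _ "q1" "- n1"]) (simp add: u3_def u2_def algebra_simps)
  have 11: "int p dvd b' * u2 - m' * u1"
    by (rule dvd_comb2 [OF v'(1,2), of _ "- q3" n3]) (simp add: u1_def u2_def algebra_simps)
  have 22: "int p dvd l' * u2 - m' * u3"
    by (rule dvd_comb2 [OF v'(1,2), of _ "q1" "- n1"]) (simp add: u3_def u2_def algebra_simps)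
  have u2: "\<not> int p dvd u2"
  proof
    assume d: "int p dvd u2"
    have "int p dvd m * u1" by (rule dvd_comb2 [OF d 1, of _ b "- 1"]) simp
    moreover have "int p dvd m * u3" by (rule dvd_comb2 [OF d 2, of _ l "- 1"]) simp
    ultimately have "int p dvd u1" "int p dvd u3" using dvd_mult_cancel v(3) by blast+
    with d nz show False by (simp add: u1_def u2_def u3_def)
  qed
  have "int p dvd u2 * (b * m' - b' * m)"
    by (rule dvd_comb2 [OF 1 11, of _ m' "- m"]) (simp add: algebra_simps)
  then show "int p dvd b * m' - b' * m" using u2 dvd_mult_cancel by blast
  have "int p dvd u2 * (l * m' - l' * m)"
    by (rule dvd_comb2 [OF 2 22, of _ m' "- m"]) (simp add: algebra_simps)
  then show "int p dvd l * m' - l' * m" using u2 dvd_mult_cancel by blast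
qed

text \<open>The four arguments of \<phi> in \<open>core_relation\<close>, as functions of the
  parameters.\<close>

definition "K0 r a b = a + (r\<^sup>2 - 1) * b\<^sup>2" for r a b :: int
definition "K1 r a b m = a - (r - 1) * m + (r\<^sup>2 - 1) * (b + m)\<^sup>2" for r a b m :: int
definition "K2 r a b l = a - (r - 1) * (2 * l) + (r\<^sup>2 - 1) * (b + l)\<^sup>2" for r a b l :: int
definition "K3 r a b m l = a - (r - 1) * (m + 2 * l) + (r\<^sup>2 - 1) * (b + m + l)\<^sup>2" for r a b m l :: int

lemmas K_defs = K0_def K1_def K2_def K3_def

definition "nondeg r m l \<longleftrightarrow> \<not> int p dvd r - 1 \<and> \<not> int p dvd r + 1 \<and> \<not> int p dvd m \<and> \<not> int p dvd l"

lemma K_second_difference: "K3 r a b m l - K1 r a b m - K2 r a b l + K0 r a b = 2 * (r\<^sup>2 - 1) * m * l"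
  by (simp add: K_defs power2_eq_square algebra_simps)

lemma second_difference_nonzero:
  assumes "nondeg r m l"
  shows "\<not> int p dvd K3 r a b m l - K1 r a b m - K2 r a b l + K0 r a b"
proof -
  have "r\<^sup>2 - 1 = (r - 1) * (r + 1)" by (simp add: power2_eq_square algebra_simps)
  then show ?thesis using assms
    unfolding K_second_difference nondeg_def by (simp add: prime_dvd_mult_iff [OF prime_int])
qed

text \<open>The linear relation satisfied by \<open>(b, m, l)\<close> for every choice of the parameters; its coefficients
  depend on the values of the \<open>K\<close>'s only.\<close>

lemma K_relation:
  "b * (2 * (K3 r a b m l - K1 r a b m - K2 r a b l + K0 r a b))
    + m * (2 * (K3 r a b m l - K1 r a b m))
    + l * (- (4 * (K1 r a b m - K0 r a b) + (K3 r a b m l - K1 r a b m - K2 r a b l + K0 r a b))) = 0"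
  by (simp add: K_defs power2_eq_square algebra_simps)

text \<open>Write c = r^2 - 1. The second difference gives c m l, and the ratios turn it into c m^2
  and c b m; then K1 - K0 gives u = (r - 1) m. Since c m^2 = u (u + 2 m) and u is nonzero,
  \<open>m\<close> is determined, and then \<open>r\<close>, \<open>b\<close>, \<open>l\<close>,
  \<open>a\<close>.\<close>

lemma K_unique:
  assumes nd: "nondeg r m l" "nondeg r' m' l'"
    and e0: "int p dvd K0 r a b - K0 r' a' b'" and e1: "int p dvd K1 r a b m - K1 r' a' b' m'"
    and e2: "int p dvd K2 r a b l - K2 r' a' b' l'" and e3: "int p dvd K3 r a b m l - K3 r' a' b' m' l'"
    and pm: "int p dvd b * m' - b' * m" and pl: "int p dvd l * m' - l' * m"
  shows "int p dvd r - r'" "int p dvd a - a'" "int p dvd b - b'" "int p dvd m - m'" "int p dvd l - l'"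
proof -
  define c c' where "c = r\<^sup>2 - 1" and "c' = r'\<^sup>2 - 1"
  have m: "\<not> int p dvd m" "\<not> int p dvd l" "\<not> int p dvd m'" "\<not> int p dvd r - 1" using nd by (auto simp: nondeg_def)
  have s1: "int p dvd 2 * c * m * l - 2 * c' * m' * l'"
    by (rule dvd_comb4 [OF e0 e1 e2 e3, of _ 1 "- 1" "- 1" 1])
       (simp add: c_def c'_def K_defs power2_eq_square algebra_simps)
  have "int p dvd (2 * l) * (c * m\<^sup>2 - c' * m'\<^sup>2)"
    by (rule dvd_comb2 [OF s1 pl, of _ m "- 2 * c' * m'"]) (simp add: power2_eq_square algebra_simps)
  then have s3: "int p dvd c * m\<^sup>2 - c' * m'\<^sup>2"
    by (rule dvd_mult_cancel) (simp add: m prime_dvd_mult_iff [OF prime_int])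
  have "int p dvd m' * (2 * c * b * m - 2 * c' * b' * m')"
    by (rule dvd_comb2 [OF pm s3, of _ "2 * c * m" "2 * b'"]) (simp add: power2_eq_square algebra_simps)
  then have s5: "int p dvd 2 * c * b * m - 2 * c' * b' * m'"
    by (rule dvd_mult_cancel) (rule m)
  have s6: "int p dvd (r - 1) * m - (r' - 1) * m'"
    by (rule dvd_comb4 [OF s5 s3 e1 e0, of _ 1 1 "- 1" 1])
       (simp add: c_def c'_def K_defs power2_eq_square algebra_simps)
  have "int p dvd (2 * ((r - 1) * m)) * (m - m')"
    by (rule dvd_comb2 [OF s3 s6, of _ 1 "- ((r - 1) * m + (r' - 1) * m' + 2 * m')"])
       (simp add: c_def c'_def power2_eq_square algebra_simps)
  then show s8: "int p dvd m - m'"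
    by (rule dvd_mult_cancel) (simp add: m prime_dvd_mult_iff [OF prime_int])
  have "int p dvd m * (r - r')"
    by (rule dvd_comb2 [OF s6 s8, of _ 1 "- (r' - 1)"]) (simp add: algebra_simps)
  then show s9: "int p dvd r - r'" by (rule dvd_mult_cancel) (rule m)
  have "int p dvd m * (b - b')"
    by (rule dvd_comb2 [OF pm s8, of _ 1 b]) (simp add: algebra_simps)
  then show s10: "int p dvd b - b'" by (rule dvd_mult_cancel) (rule m)
  have "int p dvd m * (l - l')"
    by (rule dvd_comb2 [OF pl s8, of _ 1 l]) (simp add: algebra_simps)
  then show "int p dvd l - l'" by (rule dvd_mult_cancel) (rule m)
  show "int p dvd a - a'"
    by (rule dvd_comb3 [OF e0 s9 s10, of _ 1 "- ((r + r') * b\<^sup>2)" "- (c' * (b + b'))"])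
       (simp add: c'_def K_defs power2_eq_square algebra_simps)
qed

lemma dvd_diff_small: "x \<in> {0..<int p} \<Longrightarrow> y \<in> {0..<int p} \<Longrightarrow> int p dvd x - y \<Longrightarrow> x = y"
  by (metis atLeastLessThan_iff mod_eq_dvd_iff mod_pos_pos_trivial)

lemma av5_card:
  "(AV r. AV a. AV b. AV m. AV l. of_bool (P r a b m l) :: real) =
    card {(r, a, b, m, l) \<in> {0..<int p} \<times> {0..<int p} \<times> {0..<int p} \<times> {0..<int p} \<times> {0..<int p}. P r a b m l} / real p ^ 5"
proof -
  let ?C = "{0..<int p}"
  let ?D = "?C \<times> ?C \<times> ?C \<times> ?C \<times> ?C"
  have "{(r, a, b, m, l) \<in> ?D. P r a b m l} = ?D \<inter> {(r, a, b, m, l). P r a b m l}" by auto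
  then have "real (card {(r, a, b, m, l) \<in> ?D. P r a b m l})
    = (\<Sum>x\<in>?D. of_bool (x \<in> {(r, a, b, m, l). P r a b m l}))"
    using sum_of_bool_eq [of ?D "\<lambda>x. x \<in> {(r, a, b, m, l). P r a b m l}", where 'a = real] by simp
  also have "\<dots> = (\<Sum>(r, a, b, m, l)\<in>?D. of_bool (P r a b m l))"
    by (intro sum.cong refl) auto
  also have "\<dots> = (\<Sum>r\<in>?C. \<Sum>a\<in>?C. \<Sum>b\<in>?C. \<Sum>m\<in>?C. \<Sum>l\<in>?C. of_bool (P r a b m l))"
    by (simp only: sum.cartesian_product)
  finally show ?thesis by (simp add: av_def sum_divide_distrib [symmetric] eval_nat_numeral)
qed

text \<open>If the relation is not proportional to \<open>K_relation\<close>, then the four \<open>K\<close>'s determine the parameters.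
  If it is, then \<open>K3\<close> is determined by the other \<open>K\<close>'s, and these together with \<open>l / m\<close> determine the parameters.\<close>

lemma exceptional_card:
  assumes \<phi>: "per \<phi>"
  defines "S \<equiv> \<lambda>r a b m l. b * \<phi> (K0 r a b) - (b + m) * \<phi> (K1 r a b m) - (b + l) * \<phi> (K2 r a b l)
    + (b + m + l) * \<phi> (K3 r a b m l)"
  shows "card {(r, a, b, m, l) \<in> {0..<int p} \<times> {0..<int p} \<times> {0..<int p} \<times> {0..<int p} \<times> {0..<int p}.
    nondeg r m l \<and> int p dvd S r a b m l \<and> \<not> int p dvd \<phi> (K2 r a b l) - \<phi> (K0 r a b)} \<le> 2 * p ^ 4"
proof -
  let ?C = "{0..<int p}"
  let ?D = "?C \<times> ?C \<times> ?C \<times> ?C \<times> ?C"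
  define n1 where "n1 r a b m l = 2 * (K3 r a b m l - K1 r a b m - K2 r a b l + K0 r a b)" for r a b m l
  define n2 where "n2 r a b m l = 2 * (K3 r a b m l - K1 r a b m)" for r a b m l
  define n3 where "n3 r a b m l = - (4 * (K1 r a b m - K0 r a b) + (K3 r a b m l - K1 r a b m - K2 r a b l + K0 r a b))" for r a b m l
  define q1 where "q1 r a b m l = \<phi> (K0 r a b) - \<phi> (K1 r a b m) - \<phi> (K2 r a b l) + \<phi> (K3 r a b m l)" for r a b m l
  define q2 where "q2 r a b m l = \<phi> (K3 r a b m l) - \<phi> (K1 r a b m)" for r a b m l
  define q3 where "q3 r a b m l = \<phi> (K3 r a b m l) - \<phi> (K2 r a b l)" for r a b m l
  \<comment> \<open>The vanishing of the cross product: the relation from \<phi> is parallel to the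
    one that holds identically.\<close>
  define par where "par r a b m l \<longleftrightarrow> int p dvd n2 r a b m l * q3 r a b m l - n3 r a b m l * q2 r a b m l
    \<and> int p dvd n3 r a b m l * q1 r a b m l - n1 r a b m l * q3 r a b m l
    \<and> int p dvd n1 r a b m l * q2 r a b m l - n2 r a b m l * q1 r a b m l" for r a b m l
  have S: "S r a b m l = b * q1 r a b m l + m * q2 r a b m l + l * q3 r a b m l" for r a b m l
    by (simp add: S_def q1_def q2_def q3_def algebra_simps)
  have rel: "b * n1 r a b m l + m * n2 r a b m l + l * n3 r a b m l = 0" for r a b m l
    unfolding n1_def n2_def n3_def by (rule K_relation)
  have n1: "\<not> int p dvd n1 r a b m l" if "nondeg r m l" for r a b m l
    unfolding n1_def using second_difference_nonzero [OF that] dvd_mult_cancel [of 2] not_dvd_small by blast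
  define B1 where "B1 = {(r, a, b, m, l) \<in> ?D. nondeg r m l \<and> int p dvd S r a b m l \<and> \<not> par r a b m l}"
  define B2 where "B2 = {(r, a, b, m, l) \<in> ?D. nondeg r m l \<and> par r a b m l
    \<and> \<not> int p dvd \<phi> (K2 r a b l) - \<phi> (K0 r a b)}"
  \<comment> \<open>The coefficients depend on the values of the K's only, so two tuples with the
    same values satisfy the same relation.\<close>
  have rel': "int p dvd b' * n1 r a b m l + m' * n2 r a b m l + l' * n3 r a b m l"
    if "int p dvd K0 r a b - K0 r' a' b'" "int p dvd K1 r a b m - K1 r' a' b' m'"
      "int p dvd K2 r a b l - K2 r' a' b' l'" "int p dvd K3 r a b m l - K3 r' a' b' m' l'"
    for r a b m l r' a' b' m' l'
  proof (rule dvd_comb4 [OF that, of _ "2 * b' + 3 * l'" "- 2 * b' - 2 * m' - 3 * l'" "- 2 * b' + l'" "2 * b' + 2 * m' - l'"])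
    define k0 k1 k2 k3 j0 j1 j2 j3 where "k0 = K0 r a b" "k1 = K1 r a b m" "k2 = K2 r a b l" "k3 = K3 r a b m l"
      "j0 = K0 r' a' b'" "j1 = K1 r' a' b' m'" "j2 = K2 r' a' b' l'" "j3 = K3 r' a' b' m' l'"
    note d = this
    show "b' * n1 r a b m l + m' * n2 r a b m l + l' * n3 r a b m l =
      (2 * b' + 3 * l') * (K0 r a b - K0 r' a' b') + (- 2 * b' - 2 * m' - 3 * l') * (K1 r a b m - K1 r' a' b' m')
      + (- 2 * b' + l') * (K2 r a b l - K2 r' a' b' l') + (2 * b' + 2 * m' - l') * (K3 r a b m l - K3 r' a' b' m' l')"
      using rel [of b' r' a' m' l'] unfolding n1_def n2_def n3_def d [symmetric]
      by (simp add: algebra_simps)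
  qed
  have eqD: "int p dvd x - y" if "x mod int p = y mod int p" for x y
    using that by (simp add: mod_eq_dvd_iff)
  have phi_eq: "\<phi> x = \<phi> y" if "int p dvd x - y" for x y
    using that by (intro perD [OF \<phi>]) (simp add: cong_iff_dvd_diff)
  have "inj_on (\<lambda>(r, a, b, m, l). (K0 r a b mod int p, K1 r a b m mod int p, K2 r a b l mod int p, K3 r a b m l mod int p)) B1"
  proof (rule inj_onI, simp only: split_paired_all split_conv prod.inject)
    fix r a b m l r' a' b' m' l'
    assume B: "(r, a, b, m, l) \<in> B1" "(r', a', b', m', l') \<in> B1"
      and "K0 r a b mod int p = K0 r' a' b' mod int p \<and> K1 r a b m mod int p = K1 r' a' b' m' mod int p \<and>
      K2 r a b l mod int p = K2 r' a' b' l' mod int p \<and> K3 r a b m l mod int p = K3 r' a' b' m' l' mod int p"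
    then have e: "int p dvd K0 r a b - K0 r' a' b'" "int p dvd K1 r a b m - K1 r' a' b' m'"
      "int p dvd K2 r a b l - K2 r' a' b' l'" "int p dvd K3 r a b m l - K3 r' a' b' m' l'"
      by (blast intro: eqD)+
    have nd: "nondeg r m l" "nondeg r' m' l'" using B by (auto simp: B1_def)
    have q: "q1 r a b m l = q1 r' a' b' m' l'" "q2 r a b m l = q2 r' a' b' m' l'" "q3 r a b m l = q3 r' a' b' m' l'"
      using e [THEN phi_eq] by (simp_all add: q1_def q2_def q3_def)
    have "int p dvd b * n1 r a b m l + m * n2 r a b m l + l * n3 r a b m l" by (simp add: rel)
    moreover have "int p dvd b * q1 r a b m l + m * q2 r a b m l + l * q3 r a b m l" "\<not> int p dvd m"
      using B(1) by (auto simp: B1_def S nondeg_def)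
    moreover have "int p dvd b' * n1 r a b m l + m' * n2 r a b m l + l' * n3 r a b m l" by (rule rel' [OF e])
    moreover have "int p dvd b' * q1 r a b m l + m' * q2 r a b m l + l' * q3 r a b m l"
      using B(2) unfolding q by (auto simp: B1_def S)
    moreover have "\<not> (int p dvd n2 r a b m l * q3 r a b m l - n3 r a b m l * q2 r a b m l
      \<and> int p dvd n3 r a b m l * q1 r a b m l - n1 r a b m l * q3 r a b m l
      \<and> int p dvd n1 r a b m l * q2 r a b m l - n2 r a b m l * q1 r a b m l)"
      using B(1) by (auto simp: B1_def par_def)
    ultimately have "int p dvd b * m' - b' * m" "int p dvd l * m' - l' * m" by (rule proportional)+
    note K_unique [OF nd e this]
    then show "r = r' \<and> a = a' \<and> b = b' \<and> m = m' \<and> l = l'"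
      using B by (auto simp: B1_def intro!: dvd_diff_small)
  qed
  then have "card B1 \<le> card (?C \<times> ?C \<times> ?C \<times> ?C)"
    by (rule card_inj_on_le) auto
  then have c1: "card B1 \<le> p ^ 4" by (simp add: card_cartesian_product eval_nat_numeral)
  \<comment> \<open>A fixed choice of inverses codes the ratio l / m as a single residue.\<close>
  have "\<exists>j. \<not> int p dvd m \<longrightarrow> int p dvd m * j - 1" for m
    by (metis cong_iff_dvd_diff cong_solve_coprime_int coprime_commute prime_imp_coprime prime_int)
  then obtain iv where iv: "\<And>m. \<not> int p dvd m \<Longrightarrow> int p dvd m * iv m - 1" by metis
  have "inj_on (\<lambda>(r, a, b, m, l). (K0 r a b mod int p, K1 r a b m mod int p, K2 r a b l mod int p, (l * iv m) mod int p)) B2"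
  proof (rule inj_onI, simp only: split_paired_all split_conv prod.inject)
    fix r a b m l r' a' b' m' l'
    assume B: "(r, a, b, m, l) \<in> B2" "(r', a', b', m', l') \<in> B2"
      and "K0 r a b mod int p = K0 r' a' b' mod int p \<and> K1 r a b m mod int p = K1 r' a' b' m' mod int p \<and>
      K2 r a b l mod int p = K2 r' a' b' l' mod int p \<and> l * iv m mod int p = l' * iv m' mod int p"
    then have e: "int p dvd K0 r a b - K0 r' a' b'" "int p dvd K1 r a b m - K1 r' a' b' m'"
      "int p dvd K2 r a b l - K2 r' a' b' l'" and il: "int p dvd l * iv m - l' * iv m'"
      by (blast intro: eqD)+
    have nd: "nondeg r m l" "nondeg r' m' l'" using B by (auto simp: B2_def)
    then have m: "int p dvd m * iv m - 1" "int p dvd m' * iv m' - 1" using iv by (auto simp: nondeg_def)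
    have pl: "int p dvd l * m' - l' * m"
      by (rule dvd_comb3 [OF il m, of _ "m * m'" "- (l * m')" "l' * m"]) (simp add: algebra_simps)
    \<comment> \<open>Eliminating between the parallel relations removes \<phi>(K3) and leaves an
      equation in which \<open>K3\<close> occurs only linearly, as an argument value.\<close>
    have R: "int p dvd 2 * (K2 r a b l - K0 r a b) * (\<phi> (K1 r a b m) - \<phi> (K0 r a b))
        + (4 * (K1 r a b m - K0 r a b) + 3 * (K3 r a b m l - K1 r a b m - K2 r a b l + K0 r a b))
        * (\<phi> (K2 r a b l) - \<phi> (K0 r a b))" (is "int p dvd ?R r a b m l")
      if "par r a b m l" "nondeg r m l" for r a b m l
    proof -
      define k0 k1 k2 k3 where "k0 = K0 r a b" "k1 = K1 r a b m" "k2 = K2 r a b l" "k3 = K3 r a b m l"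
      note d = this
      have "int p dvd n3 r a b m l * q1 r a b m l - n1 r a b m l * q3 r a b m l"
        "int p dvd n1 r a b m l * q2 r a b m l - n2 r a b m l * q1 r a b m l" using that by (auto simp: par_def)
      then have "int p dvd n1 r a b m l * ?R r a b m l"
        by (rule dvd_comb2 [of _ _ _ _ "- 2 * (K2 r a b l - K0 r a b)"
              "4 * (K1 r a b m - K0 r a b) + 3 * (K3 r a b m l - K1 r a b m - K2 r a b l + K0 r a b)"])
           (unfold n1_def n2_def n3_def q1_def q2_def q3_def d [symmetric], simp add: algebra_simps)
      then show ?thesis using n1 [OF that(2)] by (rule dvd_mult_cancel)
    qed
    have R1: "int p dvd ?R r a b m l" and R2: "int p dvd ?R r' a' b' m' l'"
      by (rule R [OF _ nd(1)], use B in \<open>simp add: B2_def\<close>, rule R [OF _ nd(2)], use B in \<open>simp add: B2_def\<close>)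
    define d1 d2 where "d1 = \<phi> (K1 r a b m) - \<phi> (K0 r a b)" and "d2 = \<phi> (K2 r a b l) - \<phi> (K0 r a b)"
    have d': "\<phi> (K1 r' a' b' m') - \<phi> (K0 r' a' b') = d1" "\<phi> (K2 r' a' b' l') - \<phi> (K0 r' a' b') = d2"
      using e [THEN phi_eq] by (simp_all add: d1_def d2_def)
    have d2: "\<not> int p dvd d2" using B(1) by (auto simp: B2_def d2_def)
    define k0 k1 k2 k3 j0 j1 j2 j3 where "k0 = K0 r a b" "k1 = K1 r a b m" "k2 = K2 r a b l" "k3 = K3 r a b m l"
      "j0 = K0 r' a' b'" "j1 = K1 r' a' b' m'" "j2 = K2 r' a' b' l'" "j3 = K3 r' a' b' m' l'"
    note d = this
    note R1' = R1 [folded d1_def d2_def, folded d] and R2' = R2 [unfolded d', folded d]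
    have RR: "int p dvd (2 * (k2 - k0) * d1 + (4 * (k1 - k0) + 3 * (k3 - k1 - k2 + k0)) * d2)
      - (2 * (j2 - j0) * d1 + (4 * (j1 - j0) + 3 * (j3 - j1 - j2 + j0)) * d2)"
      by (rule dvd_diff [OF R1' R2'])
    \<comment> \<open>The coefficient of \<open>K3\<close> is \<open>3 * d2\<close>, nonzero because
      \<phi>(K2) and \<phi>(K0) differ on \<open>B2\<close>; hence \<open>K3\<close> is determined
      by the rest.\<close>
    have "int p dvd (3 * d2) * (k3 - j3)"
      by (rule dvd_comb4 [OF RR e [folded d], of _ 1 "2 * d1 + d2" "- d2" "- 2 * d1 + 3 * d2"])
         (simp add: algebra_simps)
    then have "int p dvd k3 - j3"
      by (rule dvd_mult_cancel) (simp add: d2 prime_dvd_mult_iff [OF prime_int])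
    then have e3: "int p dvd K3 r a b m l - K3 r' a' b' m' l'" by (simp add: d)
    have rel0: "int p dvd b * n1 r a b m l + m * n2 r a b m l + l * n3 r a b m l" by (simp add: rel)
    have "int p dvd n1 r a b m l * (b * m' - b' * m)"
      by (rule dvd_comb3 [OF rel' [OF e e3] pl rel0, of _ "- m" "- n3 r a b m l" m'])
         (simp add: algebra_simps)
    then have "int p dvd b * m' - b' * m" using n1 [OF nd(1)] by (rule dvd_mult_cancel)
    note K_unique [OF nd e e3 this pl]
    then show "r = r' \<and> a = a' \<and> b = b' \<and> m = m' \<and> l = l'"
      using B by (auto simp: B2_def intro!: dvd_diff_small)
  qed
  then have "card B2 \<le> card (?C \<times> ?C \<times> ?C \<times> ?C)"
    by (rule card_inj_on_le) auto
  then have c2: "card B2 \<le> p ^ 4" by (simp add: card_cartesian_product eval_nat_numeral)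
  have fin: "finite B1" "finite B2"
    unfolding B1_def B2_def by (rule finite_subset [where B = ?D]; auto)+
  have "card {(r, a, b, m, l) \<in> ?D. nondeg r m l \<and> int p dvd S r a b m l
      \<and> \<not> int p dvd \<phi> (K2 r a b l) - \<phi> (K0 r a b)} \<le> card (B1 \<union> B2)"
    using fin by (intro card_mono) (auto simp: B1_def B2_def)
  also have "\<dots> \<le> 2 * p ^ 4" using card_Un_le [of B1 B2] c1 c2 by linarith
  finally show ?thesis .
qed

text \<open>The loss 7 / p consists of 5 / p for the degenerate values of \<open>r\<close>,
  \<open>m\<close>, \<open>l\<close> and 2 / p for the exceptional tuples. Elsewhere \<phi>(K2) =
  \<phi>(K0), and for fixed \<open>r\<close> and \<open>l\<close> the pair (K0, K2) is uniformly
  distributed.\<close>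

lemma counting:
  assumes \<phi>: "per \<phi>" and w: "per w" "\<And>k. 0 \<le> w k" "\<And>k. w k \<le> (1::real)"
  shows "(AV r. AV a. AV b. AV m. AV l. w (K0 r a b) * of_bool (int p dvd r * (b * \<phi> (K0 r a b)
      - (b + m) * \<phi> (K1 r a b m) - (b + l) * \<phi> (K2 r a b l) + (b + m + l) * \<phi> (K3 r a b m l))))
    \<le> 7 / p + (AV k. AV k'. w k * of_bool (int p dvd \<phi> k - \<phi> k'))" (is "_ \<le> _ + ?W")
proof -
  define S where "S r a b m l = b * \<phi> (K0 r a b) - (b + m) * \<phi> (K1 r a b m) - (b + l) * \<phi> (K2 r a b l)
    + (b + m + l) * \<phi> (K3 r a b m l)" for r a b m l
  define B where "B r a b m l \<longleftrightarrow> nondeg r m l \<and> int p dvd S r a b m l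
    \<and> \<not> int p dvd \<phi> (K2 r a b l) - \<phi> (K0 r a b)" for r a b m l
  define Q where "Q r l k k' = w k * of_bool (\<not> int p dvd r - 1 \<and> \<not> int p dvd r + 1 \<and> \<not> int p dvd l \<and> int p dvd \<phi> k - \<phi> k')" for r l k k'
  have r0: "(AV r. of_bool (int p dvd r)) = 1 / real p"
    using av_of_bool_dvd1(1) [of 0] by simp
  have W0: "0 \<le> ?W" by (intro av_nonneg mult_nonneg_nonneg w) simp
  have "w (K0 r a b) * of_bool (int p dvd r * S r a b m l) \<le> of_bool (int p dvd r) + (of_bool (int p dvd r - 1)
    + (of_bool (int p dvd r + 1) + (of_bool (int p dvd m - 0) + (of_bool (int p dvd l - 0)
    + (of_bool (B r a b m l) + Q r l (K0 r a b) (K2 r a b l))))))" (is "?l \<le> ?r") for r a b m l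
  proof (cases "int p dvd r \<or> int p dvd r - 1 \<or> int p dvd r + 1 \<or> int p dvd m \<or> int p dvd l \<or> B r a b m l")
    case True
    have "?l \<le> 1" using w by (simp add: mult_le_one)
    also have "1 \<le> ?r" using True w by (auto simp: Q_def)
    finally show ?thesis .
  next
    case False
    then have "int p dvd r * S r a b m l \<Longrightarrow> int p dvd \<phi> (K0 r a b) - \<phi> (K2 r a b l)"
      by (auto simp: B_def nondeg_def prime_dvd_mult_iff [OF prime_int] dvd_diff_commute)
    then show ?thesis using False w by (auto simp: Q_def)
  qed
  then have "(AV r. AV a. AV b. AV m. AV l. w (K0 r a b) * of_bool (int p dvd r * S r a b m l))
    \<le> (AV r. AV a. AV b. AV m. AV l. of_bool (int p dvd r) + (of_bool (int p dvd r - 1)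
    + (of_bool (int p dvd r + 1) + (of_bool (int p dvd m - 0) + (of_bool (int p dvd l - 0)
    + (of_bool (B r a b m l) + Q r l (K0 r a b) (K2 r a b l)))))))"
    by (intro av_mono)
  also have "\<dots> = 5 / p + (AV r. AV a. AV b. AV m. AV l. of_bool (B r a b m l))
     + (AV r. AV a. AV b. AV m. AV l. Q r l (K0 r a b) (K2 r a b l))"
    by (simp only: av_add av_const av_of_bool_dvd1 r0)
  also have "(AV r. AV a. AV b. AV m. AV l. of_bool (B r a b m l)) \<le> 2 / real p"
  proof -
    have "(AV r. AV a. AV b. AV m. AV l. of_bool (B r a b m l)) \<le> real (2 * p ^ 4) / real p ^ 5"
      unfolding av5_card B_def S_def by (intro divide_right_mono of_nat_mono exceptional_card \<phi>) simp
    also have "\<dots> = 2 / real p" by (simp add: eval_nat_numeral)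
    finally show ?thesis .
  qed
  also have "(AV r. AV a. AV b. AV m. AV l. Q r l (K0 r a b) (K2 r a b l)) \<le> ?W"
  proof -
    have pQ: "per (\<lambda>x. Q r l (g x) (h x))" if "pc g" "pc h" for g h r l
      unfolding Q_def
      using perD [OF per_comp [OF \<phi> that(1)]] perD [OF per_comp [OF \<phi> that(2)]] perD [OF per_comp [OF w(1) that(1)]]
      by (simp add: per_def)
    have "(AV a. AV b. Q r l (K0 r a b) (K2 r a b l)) \<le> ?W" for r l
    proof (cases "\<not> int p dvd r - 1 \<and> \<not> int p dvd r + 1 \<and> \<not> int p dvd l")
      case True
      \<comment> \<open>K2 - K0 is the affine function \<open>s * b + c\<close> of \<open>b\<close>
        with invertible slope, while \<open>a\<close> translates both points.\<close>
      define c s where "c = - (r - 1) * (2 * l) + (r\<^sup>2 - 1) * l\<^sup>2" and "s = 2 * ((r - 1) * (r + 1)) * l"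
      have s: "\<not> int p dvd s" using True unfolding s_def by (simp add: prime_dvd_mult_iff [OF prime_int])
      have "(AV a. AV b. Q r l (K0 r a b) (K2 r a b l)) = (AV b. AV a. Q r l (K0 r a b) (K2 r a b l))" by (rule av_swap)
      also have "\<dots> = (AV b. AV a. Q r l (a + (r\<^sup>2 - 1) * b\<^sup>2) ((a + (r\<^sup>2 - 1) * b\<^sup>2) + (s * b + c)))"
      proof -
        have "K2 r a b l = (a + (r\<^sup>2 - 1) * b\<^sup>2) + (s * b + c)" for a b
          by (simp add: K_defs s_def c_def power2_eq_square algebra_simps)
        then show ?thesis by (simp only: K0_def)
      qed
      also have "\<dots> = (AV b. AV a. Q r l a (a + (s * b + c)))"
      proof -
        have "per (\<lambda>a. Q r l a (a + (s * b + c)))" for b by (intro pQ per_intros)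
        from av_shift [OF this] show ?thesis by (simp only:)
      qed
      also have "\<dots> = (AV a. AV b. Q r l a (a + (s * b + c)))" by (rule av_swap)
      also have "\<dots> = (AV a. AV b. Q r l a (a + b))"
      proof -
        have "per (\<lambda>b. Q r l a (a + b))" for a by (intro pQ per_intros)
        from av_affine [OF this s] show ?thesis by (simp only:)
      qed
      also have "\<dots> = (AV a. AV b. Q r l a (b + a))" by (simp only: add.commute)
      also have "\<dots> = (AV a. AV b. Q r l a b)"
      proof -
        have "per (\<lambda>b. Q r l a b)" for a by (intro pQ per_intros)
        from av_shift [OF this] show ?thesis by (simp only:)
      qed
      also have "\<dots> = ?W" using True by (simp add: Q_def)
      finally show ?thesis by simp
    next
      case False
      then show ?thesis using W0 by (auto simp: Q_def)
    qed
    note H = this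
    have "(AV r. AV l. AV a. AV b. Q r l (K0 r a b) (K2 r a b l)) \<le> ?W"
      by (rule av_le_const, rule av_le_const, rule H)
    moreover have "(AV r. AV a. AV b. AV l. Q r l (K0 r a b) (K2 r a b l)) = (AV r. AV l. AV a. AV b. Q r l (K0 r a b) (K2 r a b l))"
      by (rule arg_cong [where f = av], rule ext, rule av_up2)
    ultimately show ?thesis by simp
  qed
  finally show ?thesis by (simp add: S_def add_divide_distrib [symmetric])
qed

text \<open>The form used by degree lowering: correlation forces the values of \<phi> to repeat,
  with the weight kept at one of the two points. Here 52 = 45 + 7.\<close>

lemma core:
  assumes g: "fn g0" "fn g1" "fn g2" and h: "fn h0" "fn h1" "fn h2"
    and \<theta>: "per \<theta>" "\<And>k. cmod (\<theta> k) \<le> 1" and \<phi>: "per \<phi>"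
  shows "cmod (AV k. AV z. AV y. AV y'. \<theta> k * ep (\<phi> k * z) *
      (h0 (z - y\<^sup>2) * h1 (z - y\<^sup>2 + y) * h2 (z - y\<^sup>2 + 2 * y)) *
      (g0 (z + k - y'\<^sup>2) * g1 (z + k - y'\<^sup>2 + y') * g2 (z + k - y'\<^sup>2 + 2 * y'))) ^ 8
    \<le> 52 / p + (AV k. AV k'. cmod (\<theta> k) * of_bool (int p dvd \<phi> k - \<phi> k'))"
  using core_relation [OF g h \<theta> \<phi>] counting [OF \<phi>, of "\<lambda>k. cmod (\<theta> k)"] \<theta>
  unfolding K_defs by (simp add: per_intros)

section \<open>Degree lowering\<close>

lemma norm_sum_le_max:
  fixes c y :: "'a \<Rightarrow> complex"
  assumes "finite I" "I \<noteq> {}" "(\<Sum>i\<in>I. cmod (c i)) \<le> 1"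
  shows "\<exists>i\<in>I. cmod (\<Sum>i\<in>I. c i * y i) \<le> cmod (y i)"
proof -
  define M where "M = Max ((\<lambda>i. cmod (y i)) ` I)"
  have "M \<in> (\<lambda>i. cmod (y i)) ` I" unfolding M_def using assms by (intro Max_in) auto
  then obtain i where i: "i \<in> I" "M = cmod (y i)" by auto
  have "cmod (\<Sum>i\<in>I. c i * y i) \<le> (\<Sum>i\<in>I. cmod (c i) * M)"
    using assms unfolding M_def
    by (intro order_trans [OF norm_sum] sum_mono) (auto simp: norm_mult intro!: mult_left_mono)
  also have "\<dots> \<le> M"
    using assms(3) i(2) by (simp add: sum_distrib_right [symmetric] mult_left_le_one_le sum_nonneg)
  finally show ?thesis using i by auto
qed

lemma box_average:
  assumes w: "\<And>K z. LW m (w K z)"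
  shows "cmod (AV K. AV z. AV y. AV y'. EL m (\<lambda>k. f K z y y' k * w K z k)) ^ (2 ^ m)
    \<le> EL m (\<lambda>k. EL m (\<lambda>l. cmod (AV K. AV z. AV y. AV y'. bx k l (f K z y y'))))"
proof (cases m)
  case 0
  then show ?thesis using w by simp
next
  case (Suc n)
  have "cmod (AV K. AV z. AV y. AV y'. EL m (\<lambda>k. f K z y y' k * w K z k)) ^ (2 ^ m)
    \<le> (AV K. cmod (AV z. AV y. AV y'. EL m (\<lambda>k. f K z y y' k * w K z k)) ^ (2 ^ m))"
    by (rule cmod_av_power_le)
  also have "\<dots> \<le> (AV K. AV z. AV y. AV y'. cmod (EL m (\<lambda>k. f K z y y' k * w K z k)) ^ (2 ^ m))"
    by (intro av_mono cmod_av3_power_le)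
  also have "\<dots> \<le> (AV K. AV z. AV y. AV y'. Re (BA m (f K z y y')))"
    using w unfolding Suc by (intro av_mono box_cs)
  also have "\<dots> = Re (AV K. AV z. AV y. AV y'. EL m (\<lambda>k. EL m (\<lambda>l. bx k l (f K z y y'))))"
    by (simp only: av_Re BA_bx)
  also have "\<dots> = Re (EL m (\<lambda>k. EL m (\<lambda>l. AV K. AV z. AV y. AV y'. bx k l (f K z y y'))))"
    by (simp only: EL_av)
  also have "\<dots> \<le> EL m (\<lambda>k. EL m (\<lambda>l. cmod (AV K. AV z. AV y. AV y'. bx k l (f K z y y'))))"
    unfolding EL_Re by (intro EL_mono complex_Re_le_cmod)
  finally show ?thesis .
qed

lemma fn_sum_translates:
  assumes f: "fn f" and T: "finite T" "T \<noteq> {}"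
    and G: "\<And>z. G z = (\<Sum>t\<in>T. \<nu> t * f (z - t))" and \<nu>: "(\<Sum>t\<in>T. cmod (\<nu> t)) \<le> 1"
  shows "fn G"
proof -
  have fs: "fn (\<lambda>z. f (z - t))" for t
    by (rule fn_comp [OF f]) (intro per_intros)
  have "cmod (G z) \<le> 1" for z
  proof -
    obtain t where "cmod (G z) \<le> cmod (f (z - t))"
      unfolding G using norm_sum_le_max [OF T \<nu>, of "\<lambda>t. f (z - t)"] by auto
    then show ?thesis using fn_le1 [OF f, of "z - t"] by simp
  qed
  moreover have "per G"
    unfolding per_def G using perD [OF fn_per [OF fs]] by (auto intro!: sum.cong)
  ultimately show ?thesis by (simp add: fn_def)
qed

text \<open>Only the vertex of the cube that depends on all increments is expanded as a dual function;
  Cauchy--Schwarz removes the others. By \<open>core\<close>, the phase \<open>\<phi>\<close> is then, on a large set, independent of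
  the first increment up to terms each missing some other increment, and \<open>low_rank\<close> applies.\<close>

lemma degree_lowering:
  assumes f: "fn f0" "fn f1" "fn f2"
    and T: "finite T" "T \<noteq> {}"
    and G: "\<And>z. G z = (\<Sum>t\<in>T. \<nu> t * Du f0 f1 f2 (z - t))"
    and \<nu>: "(\<Sum>t\<in>T. cmod (\<nu> t)) \<le> 1"
  shows "\<exists>X \<ge> 0. NN (m + 2) G ^ (2 ^ m * 8) \<le> 52 / p + X \<and> X ^ (2 * 2 ^ Suc m) \<le> NN (Suc m) G"
proof -
  have fG: "fn G" by (rule fn_sum_translates [OF fn_Du [OF f] T G \<nu>])
  \<comment> \<open>The frequency is chosen as a function of the differentiated function itself, so
    \<phi>(K # k) inherits periodicity in \<open>K\<close>, as \<open>core\<close> requires.\<close>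
  obtain \<alpha> where \<alpha>: "\<And>g. fn g \<Longrightarrow> NN 1 g \<le> (cmod (AV x. g x * ep (\<alpha> g * x)))\<^sup>2"
    using NN1_le_fourier by metis
  define \<phi> where "\<phi> k = \<alpha> (dl k G)" for k
  \<comment> \<open>The conjugate of the Fourier coefficient, so that \<theta> times the coefficient
    is its squared modulus.\<close>
  define \<theta> where "\<theta> k = cnj (AV z. dl k G z * ep (\<phi> k * z))" for k
  have per_dl: "per (\<lambda>K. dl (K # k) G)" for k
    using per_map [OF per_dd [OF fn_per [OF fG]], of "dl k"] by simp
  have per\<phi>: "per (\<lambda>K. \<phi> (K # k))" for k
    unfolding \<phi>_def by (rule per_map [OF per_dl])
  have per\<theta>: "per (\<lambda>K. \<theta> (K # k))" for k
    unfolding \<theta>_def \<phi>_def by (rule per_map [OF per_dl, of "\<lambda>g. cnj (AV z. g z * ep (\<alpha> g * z))"])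
  have \<theta>1: "cmod (\<theta> k) \<le> 1" for k
    unfolding \<theta>_def complex_mod_cnj
    by (intro norm_av_le_const cmod_mult_le1 [OF fn_le1 [OF fn_dl [OF fG]]]) simp
  \<comment> \<open>The first increment \<open>K\<close> is kept apart as the variable of
    \<open>core\<close>; only the other m increments are split off by Cauchy--Schwarz.\<close>
  obtain w where w: "\<And>K z. LW m (w K z)"
    "\<And>K z k. length k = m \<Longrightarrow> dl k (dd K G) z = dd K G (z + sum_list k) * w K z k"
    using dl_split [OF fn_dd [OF fG]] by metis
  define Y where "Y t t' = (AV K. AV z. EL m (\<lambda>k. \<theta> (K # k) * ep (\<phi> (K # k) * z) *
    (Du f0 f1 f2 (z + sum_list k + K - t) * cnj (Du f0 f1 f2 (z + sum_list k - t'))) * w K z k))" for t t'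
  have "NN (m + 2) G = EL (Suc m) (\<lambda>k. NN 1 (dl k G))"
    using NN_add_EL [of "Suc m" 1 G] by simp
  also have "\<dots> \<le> EL (Suc m) (\<lambda>k. (cmod (\<theta> k))\<^sup>2)"
    unfolding \<theta>_def complex_mod_cnj \<phi>_def by (intro EL_mono \<alpha> fn_dl fG)
  also have "\<dots> = cmod (complex_of_real (EL (Suc m) (\<lambda>k. (cmod (\<theta> k))\<^sup>2)))"
    unfolding norm_of_real by (intro abs_of_nonneg [symmetric] EL_nonneg) simp
  also have "complex_of_real (EL (Suc m) (\<lambda>k. (cmod (\<theta> k))\<^sup>2)) = (\<Sum>t\<in>T. \<nu> t * (\<Sum>t'\<in>T. cnj (\<nu> t') * Y t t'))"
  proof -
    have "complex_of_real ((cmod (\<theta> k))\<^sup>2) = \<theta> k * (AV z. dl k G z * ep (\<phi> k * z))" for k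
      unfolding complex_norm_square by (simp add: \<theta>_def)
    then have "complex_of_real (EL (Suc m) (\<lambda>k. (cmod (\<theta> k))\<^sup>2))
      = EL (Suc m) (\<lambda>k. \<theta> k * (AV z. dl k G z * ep (\<phi> k * z)))" by (simp only: EL_of_real)
    also have "\<dots> = (AV K. AV z. EL m (\<lambda>k. \<theta> (K # k) * (dl k (dd K G) z * ep (\<phi> (K # k) * z))))"
      by (simp only: EL.simps dl.simps av_cmult [symmetric] EL_av)
    also have "\<dots> = (AV K. AV z. EL m (\<lambda>k. \<Sum>t\<in>T. \<nu> t * (\<Sum>t'\<in>T. cnj (\<nu> t') *
      (\<theta> (K # k) * ep (\<phi> (K # k) * z) *
       (Du f0 f1 f2 (z + sum_list k + K - t) * cnj (Du f0 f1 f2 (z + sum_list k - t'))) * w K z k))))"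
    proof -
      have "EL m (\<lambda>k. \<theta> (K # k) * (dl k (dd K G) z * ep (\<phi> (K # k) * z)))
        = EL m (\<lambda>k. \<Sum>t\<in>T. \<nu> t * (\<Sum>t'\<in>T. cnj (\<nu> t') * (\<theta> (K # k) * ep (\<phi> (K # k) * z) *
         (Du f0 f1 f2 (z + sum_list k + K - t) * cnj (Du f0 f1 f2 (z + sum_list k - t'))) * w K z k)))" for K z
      proof (rule EL_cong)
        fix k :: "int list" assume k: "length k = m"
        have "\<theta> (K # k) * (dl k (dd K G) z * ep (\<phi> (K # k) * z))
          = G (z + sum_list k + K) * (cnj (G (z + sum_list k)) * (\<theta> (K # k) * ep (\<phi> (K # k) * z) * w K z k))"
          unfolding w(2) [OF k] by (simp add: dd_def mult_ac)
        also have "\<dots> = (\<Sum>t\<in>T. \<nu> t * (\<Sum>t'\<in>T. cnj (\<nu> t') * (\<theta> (K # k) * ep (\<phi> (K # k) * z) *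
         (Du f0 f1 f2 (z + sum_list k + K - t) * cnj (Du f0 f1 f2 (z + sum_list k - t'))) * w K z k)))"
        proof -
          have 1: "G u * c = (\<Sum>t\<in>T. \<nu> t * (Du f0 f1 f2 (u - t) * c))" for u c
            by (simp add: G sum_distrib_right mult.assoc)
          have 2: "x * (cnj (G v) * c) = (\<Sum>t'\<in>T. cnj (\<nu> t') * (x * (cnj (Du f0 f1 f2 (v - t')) * c)))" for x v c
            by (simp add: G sum_distrib_right sum_distrib_left mult_ac)
          show ?thesis unfolding 1 unfolding 2 by (simp only: mult_ac)
        qed
        finally show "\<theta> (K # k) * (dl k (dd K G) z * ep (\<phi> (K # k) * z)) = \<dots>" .
      qed
      then show ?thesis by (simp only:)
    qed
    also have "\<dots> = (\<Sum>t\<in>T. \<nu> t * (\<Sum>t'\<in>T. cnj (\<nu> t') * Y t t'))"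
      unfolding Y_def by (simp only: EL_sum EL_cmult av_sum av_cmult)
    finally show ?thesis .
  qed
  finally have "NN (m + 2) G \<le> cmod (\<Sum>t\<in>T. \<nu> t * (\<Sum>t'\<in>T. cnj (\<nu> t') * Y t t'))" .
  moreover obtain t where "cmod (\<Sum>t\<in>T. \<nu> t * (\<Sum>t'\<in>T. cnj (\<nu> t') * Y t t')) \<le> cmod (\<Sum>t'\<in>T. cnj (\<nu> t') * Y t t')"
    using norm_sum_le_max [OF T \<nu>, of "\<lambda>t. \<Sum>t'\<in>T. cnj (\<nu> t') * Y t t'"] by auto
  moreover obtain t' where "cmod (\<Sum>t'\<in>T. cnj (\<nu> t') * Y t t') \<le> cmod (Y t t')"
    using norm_sum_le_max [OF T, of "\<lambda>t. cnj (\<nu> t)" "Y t"] \<nu> by auto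
  ultimately have Y: "NN (m + 2) G \<le> cmod (Y t t')" by linarith
  define A where "A y u = f0 (u - y\<^sup>2) * f1 (u - y\<^sup>2 + y) * f2 (u - y\<^sup>2 + 2 * y)" for y u
  define R where "R K z y y' k = \<theta> (K # k) * ep (\<phi> (K # k) * z) *
    (cnj (A y (z + sum_list k - t')) * A y' (z + sum_list k + K - t))" for K z y y' k
  have Y2: "Y t t' = (AV K. AV z. AV y. AV y'. EL m (\<lambda>k. R K z y y' k * w K z k))"
  proof -
    have "\<theta> (K # k) * ep (\<phi> (K # k) * z) * (Du f0 f1 f2 (z + sum_list k + K - t) *
        cnj (Du f0 f1 f2 (z + sum_list k - t'))) * w K z k = (AV y. AV y'. R K z y y' k * w K z k)" for K z k
    proof -
      have D: "Du f0 f1 f2 u = (AV y. A y u)" for u by (simp add: Du_def A_def)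
      show ?thesis
        unfolding D R_def av_cnj by (simp only: av_cmult av_multc mult_ac)
    qed
    then show ?thesis unfolding Y_def by (simp only: EL_av)
  qed
  \<comment> \<open>Box Cauchy--Schwarz in \<open>k\<close> turns the phase into this alternating
    sum, which, as a function of \<open>K\<close>, is the phase fed to \<open>core\<close>.\<close>
  define \<Phi> where "\<Phi> k l K = alt k l (\<lambda>x. \<phi> (K # x))" for k l K
  define H where "H k l = (AV K. AV z. AV y. AV y'. bx k l (R K z y y'))" for k l
  have H: "cmod (H k l) ^ 8 \<le> 52 / p + (AV K. AV K'. cmod (\<theta> (K # k)) * of_bool (int p dvd \<Phi> k l K - \<Phi> k l K'))"
    if len: "length k = m" "length l = m" for k l
  proof -
    define \<kappa> s where "\<kappa> = map2 (-) k l" and "s = sum_list l"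
    define \<Theta> where "\<Theta> K = bx k l (\<lambda>x. \<theta> (K # x))" for K
    define g0 g1 g2 where "g0 u = dl \<kappa> f0 (u + (s - t))" and "g1 u = dl \<kappa> f1 (u + (s - t))"
      and "g2 u = dl \<kappa> f2 (u + (s - t))" for u
    define h0 h1 h2 where "h0 u = cnj (dl \<kappa> f0 (u + (s - t')))" and "h1 u = cnj (dl \<kappa> f1 (u + (s - t')))"
      and "h2 u = cnj (dl \<kappa> f2 (u + (s - t')))" for u
    have sh: "fn (\<lambda>u. dl \<kappa> f (u + c))" if "fn f" for f c
      by (rule fn_comp [OF fn_dl [OF that]]) (intro per_intros)
    have gh: "fn g0" "fn g1" "fn g2" "fn h0" "fn h1" "fn h2"
      unfolding g0_def g1_def g2_def h0_def h1_def h2_def by (intro fn_cnj sh f)+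
    have dlA: "dl \<kappa> (A y) u = dl \<kappa> f0 (u + - y\<^sup>2) * dl \<kappa> f1 (u + (y - y\<^sup>2)) * dl \<kappa> f2 (u + (2 * y - y\<^sup>2))" for y u
    proof -
      have "A y = (\<lambda>u. f0 (u + - y\<^sup>2) * f1 (u + (y - y\<^sup>2)) * f2 (u + (2 * y - y\<^sup>2)))"
        by (rule ext) (simp add: A_def algebra_simps)
      then show ?thesis by (simp only: dl_mult dl_shift)
    qed
    have bxA: "bx k l (\<lambda>x. A y (z + sum_list x + c)) = dl \<kappa> (A y) (z + s + c)" for y z c
      using bx_sum_list [of k l "\<lambda>u. A y (u + c)" z] len
      unfolding \<kappa>_def s_def by (simp only: dl_shift)
    have bx: "bx k l (R K z y y') = \<Theta> K * ep (\<Phi> k l K * z) *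
      (h0 (z - y\<^sup>2) * h1 (z - y\<^sup>2 + y) * h2 (z - y\<^sup>2 + 2 * y)) *
      (g0 (z + K - y'\<^sup>2) * g1 (z + K - y'\<^sup>2 + y') * g2 (z + K - y'\<^sup>2 + 2 * y'))" for K z y y'
    proof -
      have "bx k l (R K z y y') = \<Theta> K * ep (\<Phi> k l K * z) * (cnj (dl \<kappa> (A y) (z + s + - t')) * dl \<kappa> (A y') (z + s + (K - t)))"
        unfolding \<Theta>_def \<Phi>_def bx_ep [symmetric] bxA [symmetric] bx_cnj [symmetric] bx_mult [symmetric]
        by (rule arg_cong [where f = "bx k l"], rule ext) (simp add: R_def algebra_simps)
      then show ?thesis
        unfolding dlA g0_def g1_def g2_def h0_def h1_def h2_def by (simp add: algebra_simps)
    qed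
    have \<Theta>: "cmod (\<Theta> K) \<le> cmod (\<theta> (K # k))" for K
      unfolding \<Theta>_def by (rule bx_norm_le) (rule \<theta>1)
    have p1: "per \<Theta>" unfolding \<Theta>_def by (rule per_map [where Q = "bx k l", OF per_all]) (rule per\<theta>)
    have p2: "per (\<Phi> k l)" unfolding \<Phi>_def by (rule per_map [where Q = "alt k l", OF per_all]) (rule per\<phi>)
    have "cmod (H k l) ^ 8 \<le> 52 / p + (AV K. AV K'. cmod (\<Theta> K) * of_bool (int p dvd \<Phi> k l K - \<Phi> k l K'))"
      unfolding H_def bx using order_trans [OF \<Theta> \<theta>1] by (intro core gh p1 p2)
    also have "\<dots> \<le> 52 / p + (AV K. AV K'. cmod (\<theta> (K # k)) * of_bool (int p dvd \<Phi> k l K - \<Phi> k l K'))"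
      by (intro add_left_mono av_mono mult_right_mono \<Theta>) simp
    finally show ?thesis .
  qed
  define V where "V l K' = EL m (\<lambda>k. AV K. cmod (\<theta> (K # k)) * of_bool (int p dvd \<Phi> k l K - \<Phi> k l K'))" for l K'
  have "NN (m + 2) G ^ (2 ^ m) \<le> cmod (Y t t') ^ (2 ^ m)" by (intro power_mono Y NN_nonneg)
  also have "\<dots> \<le> EL m (\<lambda>k. EL m (\<lambda>l. cmod (H k l)))"
    unfolding Y2 H_def by (rule box_average) (rule w)
  finally have "(NN (m + 2) G ^ (2 ^ m)) ^ (2 ^ 3) \<le> EL m (\<lambda>k. EL m (\<lambda>l. cmod (H k l))) ^ (2 ^ 3)"
    by (intro power_mono zero_le_power NN_nonneg)
  also have "\<dots> \<le> EL m (\<lambda>k. EL m (\<lambda>l. cmod (H k l)) ^ (2 ^ 3))"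
    by (intro EL_jensen EL_nonneg) simp
  also have "\<dots> \<le> EL m (\<lambda>k. EL m (\<lambda>l. cmod (H k l) ^ (2 ^ 3)))"
    by (intro EL_mono EL_jensen) simp
  also have "\<dots> \<le> EL m (\<lambda>k. EL m (\<lambda>l. 52 / p + (AV K. AV K'. cmod (\<theta> (K # k)) * of_bool (int p dvd \<Phi> k l K - \<Phi> k l K'))))"
    using H by (intro EL_mono) simp
  also have "\<dots> = 52 / p + EL m (\<lambda>k. EL m (\<lambda>l. (AV K. AV K'. cmod (\<theta> (K # k)) * of_bool (int p dvd \<Phi> k l K - \<Phi> k l K'))))"
    by (simp only: EL_add EL_const)
  also have "EL m (\<lambda>k. EL m (\<lambda>l. (AV K. AV K'. cmod (\<theta> (K # k)) * of_bool (int p dvd \<Phi> k l K - \<Phi> k l K'))))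
    = EL m (\<lambda>l. AV K'. V l K')"
    unfolding V_def EL_av
    by (subst EL_EL) (intro EL_cong av_swap)
  finally have 1: "NN (m + 2) G ^ (2 ^ m * 8) \<le> 52 / p + EL m (\<lambda>l. AV K'. V l K')"
    by (simp add: power_mult)
  \<comment> \<open>The doubled increments \<open>l\<close> and the comparison value
    \<open>K'\<close> are frozen where the average is attained or exceeded.\<close>
  obtain l where l: "length l = m" "EL m (\<lambda>l. AV K'. V l K') \<le> (AV K'. V l K')"
    using EL_exists_ge by blast
  obtain K' where K': "(AV K'. V l K') \<le> V l K'" using av_exists_ge by blast
  \<comment> \<open>\<psi> agrees with \<phi> modulo p where \<Phi> takes the same value at the
    first increment and at \<open>K'\<close>. In \<psi> the alternating sum at the first increment
    is traded for the one at \<open>K'\<close>, which does not involve the first increment; the rest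
    splits by \<open>LW_alt\<close>.\<close>
  define \<psi> where "\<psi> k = \<phi> k - alt (tl k) l (\<lambda>x. \<phi> (hd k # x)) + \<Phi> (tl k) l K'" for k
  have V: "V l K' \<le> EL (Suc m) (\<lambda>k. cmod (AV z. dl k G z * ep (\<psi> k * z)))"
  proof -
    have "V l K' = EL (Suc m) (\<lambda>k. cmod (\<theta> k) * of_bool (int p dvd \<Phi> (tl k) l (hd k) - \<Phi> (tl k) l K'))"
      by (simp add: V_def EL_av)
    also have "\<dots> \<le> EL (Suc m) (\<lambda>k. cmod (AV z. dl k G z * ep (\<psi> k * z)))"
    proof (rule EL_mono)
      fix k :: "int list"
      show "cmod (\<theta> k) * of_bool (int p dvd \<Phi> (tl k) l (hd k) - \<Phi> (tl k) l K') \<le> cmod (AV z. dl k G z * ep (\<psi> k * z))"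
      proof (cases "int p dvd \<Phi> (tl k) l (hd k) - \<Phi> (tl k) l K'")
        case True
        have "ep (\<psi> k * z) = ep (\<phi> k * z)" for z
        proof (rule perD [OF per_ep])
          have "\<phi> k * z - \<psi> k * z = (\<Phi> (tl k) l (hd k) - \<Phi> (tl k) l K') * z"
            by (simp add: \<psi>_def \<Phi>_def algebra_simps)
          then show "[\<psi> k * z = \<phi> k * z] (mod int p)"
            using True by (metis cong_iff_dvd_diff cong_sym dvd_mult2)
        qed
        then show ?thesis by (simp add: \<theta>_def)
      qed simp
    qed
    finally show ?thesis .
  qed
  have "V l K' ^ 2 \<le> EL (Suc m) (\<lambda>k. cmod (AV z. dl k G z * ep (\<psi> k * z))) ^ 2"
    by (intro power_mono V) (auto simp: V_def intro!: EL_nonneg av_nonneg)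
  also have "\<dots> \<le> EL (Suc m) (\<lambda>k. (cmod (AV z. dl k G z * ep (\<psi> k * z)))\<^sup>2)"
    using EL_jensen [of "\<lambda>k. cmod (AV z. dl k G z * ep (\<psi> k * z))" "Suc m" 1] by simp
  finally have "(V l K' ^ 2) ^ (2 ^ Suc m) \<le> EL (Suc m) (\<lambda>k. (cmod (AV z. dl k G z * ep (\<psi> k * z)))\<^sup>2) ^ (2 ^ Suc m)"
    by (rule power_mono) simp
  also have "\<dots> \<le> NN (Suc m) G"
  proof (rule low_rank [OF fG])
    fix h
    show "LW (Suc m) (\<lambda>k. ep (\<psi> k * h))"
      unfolding LW.simps
    proof (intro exI conjI allI)
      show "ep (\<psi> (K # k) * h) = ep (\<Phi> k l K' * h) * ep ((\<phi> (K # k) - alt k l (\<lambda>x. \<phi> (K # x))) * h)" for K k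
        by (simp add: \<psi>_def ep_add [symmetric] algebra_simps)
      show "LW m (\<lambda>k. ep ((\<phi> (K # k) - alt k l (\<lambda>x. \<phi> (K # x))) * h))" for K
        by (rule LW_alt [OF l(1)])
    qed simp
  qed
  finally have 2: "V l K' ^ (2 * 2 ^ Suc m) \<le> NN (Suc m) G" by (simp only: power_mult)
  have "0 \<le> V l K'" by (auto simp: V_def intro!: EL_nonneg av_nonneg)
  moreover have "NN (m + 2) G ^ (2 ^ m * 8) \<le> 52 / p + V l K'" using 1 l(2) K' by linarith
  ultimately show ?thesis using 2 by blast
qed

text \<open>The class on which degree lowering works. With one translate it contains the dual
  functions; with complex weights it also contains half the difference of a dual function and an
  average of its translates.\<close>

definition dual :: "(int \<Rightarrow> complex) \<Rightarrow> bool" where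
  "dual G \<longleftrightarrow> (\<exists>f0 f1 f2 T \<nu>. fn f0 \<and> fn f1 \<and> fn f2 \<and> finite T \<and> T \<noteq> {} \<and>
    (\<forall>z. G z = (\<Sum>t\<in>T. \<nu> t * Du f0 f1 f2 (z - t))) \<and> (\<Sum>t\<in>T. cmod (\<nu> t)) \<le> 1)"

lemma dual_fn: "dual G \<Longrightarrow> fn G"
proof -
  assume "dual G"
  then obtain f0 f1 f2 T \<nu> where f: "fn f0" "fn f1" "fn f2" and T: "finite T" "T \<noteq> {}"
    and G: "\<And>z. G z = (\<Sum>t\<in>T. \<nu> t * Du f0 f1 f2 (z - t))" and \<nu>: "(\<Sum>t\<in>T. cmod (\<nu> t)) \<le> 1"
    unfolding dual_def by blast
  show "fn G" by (rule fn_sum_translates [OF fn_Du [OF f] T G \<nu>])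
qed

lemma dual_Du: "fn f0 \<Longrightarrow> fn f1 \<Longrightarrow> fn f2 \<Longrightarrow> dual (Du f0 f1 f2)"
  unfolding dual_def
  by (intro exI [of _ f0] exI [of _ f1] exI [of _ f2] exI [of _ "{0}"] exI [of _ "\<lambda>_. 1"]) auto

text \<open>104 = 2 * 52: for such p the error 52 / p takes at most half of the main term.\<close>

lemma dual_lowering:
  assumes "dual G" "0 < e" "e \<le> NN (m + 2) G" "104 / e ^ (2 ^ m * 8) \<le> p"
  shows "(e ^ (2 ^ m * 8) / 2) ^ (2 * 2 ^ Suc m) \<le> NN (Suc m) G"
proof -
  from \<open>dual G\<close> obtain X where X: "X \<ge> 0" "NN (m + 2) G ^ (2 ^ m * 8) \<le> 52 / p + X"
      "X ^ (2 * 2 ^ Suc m) \<le> NN (Suc m) G"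
    using degree_lowering unfolding dual_def by blast
  have "e ^ (2 ^ m * 8) \<le> NN (m + 2) G ^ (2 ^ m * 8)" using assms by (intro power_mono) auto
  moreover have "52 / real p \<le> e ^ (2 ^ m * 8) / 2" using assms by (simp add: field_simps)
  ultimately have "e ^ (2 ^ m * 8) / 2 \<le> X" using X(2) by linarith
  then have "(e ^ (2 ^ m * 8) / 2) ^ (2 * 2 ^ Suc m) \<le> X ^ (2 * 2 ^ Suc m)"
    using assms by (intro power_mono) auto
  with X(3) show ?thesis by linarith
qed

section \<open>Averaging over Bohr sets\<close>

lemma norm_ep_diff_le:
  "cmod (ep x - ep y) \<le> 2 * pi * \<bar>real_of_int (x mod int p) / p - real_of_int (y mod int p) / p\<bar>"
proof -
  define s t where "s = 2 * pi * real_of_int (x mod int p) / p" and "t = 2 * pi * real_of_int (y mod int p) / p"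
  have "ep (x mod int p) = exp (\<i> * of_real s)" "ep (y mod int p) = exp (\<i> * of_real t)"
    by (simp_all add: ep_def e_p_def s_def t_def mult_ac)
  then have e: "ep x = exp (\<i> * of_real s)" "ep y = exp (\<i> * of_real t)"
    by (simp_all add: per_mod [OF per_ep])
  have "ep x - ep y = ep y * (exp (\<i> * of_real (s - t)) - 1)"
    unfolding e by (simp add: algebra_simps exp_add [symmetric])
  then have "cmod (ep x - ep y) = 2 * \<bar>sin ((s - t) / 2)\<bar>"
    by (simp only: norm_mult norm_ep dist_exp_i_1 mult_1)
  also have "\<dots> \<le> \<bar>s - t\<bar>" using abs_sin_x_le_abs_x [of "(s - t) / 2"] by simp
  also have "\<dots> = 2 * pi * \<bar>real_of_int (x mod int p) / p - real_of_int (y mod int p) / p\<bar>"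
  proof -
    have "s - t = 2 * pi * (real_of_int (x mod int p) / p - real_of_int (y mod int p) / p)"
      by (simp add: s_def t_def algebra_simps)
    then show ?thesis by (simp add: abs_mult)
  qed
  finally show ?thesis .
qed

text \<open>Pigeonhole over the positions of the points \<open>a x / p mod 1\<close> (\<open>a \<in> A\<close>) yields a
  large set on whose differences all characters from \<open>A\<close> are close to 1.\<close>

lemma bohr_cell:
  assumes A: "finite A" and L: "L > 0"
  shows "\<exists>T. finite T \<and> 0 \<in> T \<and> p \<le> card T * L ^ card A \<and>
    (\<forall>a\<in>A. \<forall>t\<in>T. cmod (1 - ep (a * t)) \<le> 2 * pi / L) \<and>
    (\<forall>s\<in>T. \<forall>t\<in>T. int p dvd s - t \<longrightarrow> s = t)"
proof -
  \<comment> \<open>\<open>c x\<close> records in which of L equal arcs each point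
    \<open>a x / p mod 1\<close> lies.\<close>
  define c where "c x = restrict (\<lambda>a. nat \<lfloor>real L * (real_of_int (a * x mod int p) / p)\<rfloor>) A" for x
  define V where "V = (\<Pi>\<^sub>E a\<in>A. {..<L})"
  define C where "C v = {x \<in> {0..<int p}. c x = v}" for v
  have fin: "finite (C v)" for v
    unfolding C_def by (rule finite_subset [of _ "{0..<int p}"]) auto
  have cV: "c x \<in> V" for x
  proof -
    have "nat \<lfloor>real L * (real_of_int (a * x mod int p) / p)\<rfloor> < L" for a
    proof -
      have "real_of_int (a * x mod int p) < p"
        by (metis of_int_less_iff of_int_of_nat_eq of_nat_0_less_iff p_pos pos_mod_bound)
      then have "real L * (real_of_int (a * x mod int p) / p) < L"
        using L by (simp add: field_simps)
      then have "\<lfloor>real L * (real_of_int (a * x mod int p) / p)\<rfloor> < int L"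
        by (simp only: floor_less_iff of_int_of_nat_eq)
      then show ?thesis using L by arith
    qed
    then show ?thesis by (auto simp: c_def V_def)
  qed
  have V: "finite V" "V \<noteq> {}" "card V = L ^ card A"
    using A L unfolding V_def by (auto simp: finite_PiE PiE_eq_empty_iff card_PiE)
  have "\<exists>v\<in>V. p \<le> card (C v) * card V"
  proof (rule ccontr)
    assume "\<not> ?thesis"
    then have lt: "card (C v) * card V < p" if "v \<in> V" for v using that by (auto simp: not_le)
    have "{0..<int p} \<subseteq> (\<Union>v\<in>V. C v)" using cV by (auto simp: C_def)
    then have "card {0..<int p} \<le> card (\<Union>v\<in>V. C v)"
      using V fin by (intro card_mono finite_UN_I) auto
    also have "\<dots> \<le> (\<Sum>v\<in>V. card (C v))" by (rule card_UN_le) (rule V)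
    finally have "p * card V \<le> (\<Sum>v\<in>V. card (C v)) * card V" by simp
    also have "\<dots> = (\<Sum>v\<in>V. card (C v) * card V)" by (simp add: sum_distrib_right)
    also have "\<dots> < (\<Sum>v\<in>V. p)" using V lt by (intro sum_strict_mono) auto
    finally show False by simp
  qed
  then obtain v where v: "v \<in> V" "p \<le> card (C v) * L ^ card A" using V(3) by auto
  have "C v \<noteq> {}" using v(2) by auto
  then obtain x0 where x0: "x0 \<in> C v" by blast
  \<comment> \<open>A cell translated by one of its points: it contains 0, and its elements stay
    distinct modulo p.\<close>
  define T where "T = (\<lambda>x. x - x0) ` C v"
  have "cmod (1 - ep (a * t)) \<le> 2 * pi / L" if a: "a \<in> A" and t: "t \<in> T" for a t
  proof -
    obtain x where x: "x \<in> C v" "t = x - x0" using t by (auto simp: T_def)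
    define r s where "r = real_of_int (a * x mod int p) / p" and "s = real_of_int (a * x0 mod int p) / p"
    have "c x = c x0" using x x0 by (simp add: C_def)
    then have "c x a = c x0 a" by simp
    then have "nat \<lfloor>real L * r\<rfloor> = nat \<lfloor>real L * s\<rfloor>" using a by (simp add: c_def r_def s_def)
    moreover have "0 \<le> real L * r" "0 \<le> real L * s" by (auto simp: r_def s_def)
    ultimately have "\<bar>real L * r - real L * s\<bar> \<le> 1" by linarith
    moreover have "real L * \<bar>r - s\<bar> = \<bar>real L * r - real L * s\<bar>"
      by (simp only: right_diff_distrib [symmetric] abs_mult abs_of_nat)
    ultimately have "real L * \<bar>r - s\<bar> \<le> 1" by linarith
    then have rs: "\<bar>r - s\<bar> \<le> 1 / L" using L by (simp add: pos_le_divide_eq mult.commute)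
    have "ep (a * x) = ep (a * x0) * ep (a * t)" by (simp add: x ep_add [symmetric] algebra_simps)
    then have "cmod (ep (a * x0) - ep (a * x)) = cmod (ep (a * x0) * (1 - ep (a * t)))"
      by (simp add: algebra_simps)
    then have "cmod (1 - ep (a * t)) = cmod (ep (a * x) - ep (a * x0))"
      by (simp add: norm_mult norm_minus_commute)
    also have "\<dots> \<le> 2 * pi * \<bar>r - s\<bar>" unfolding r_def s_def by (rule norm_ep_diff_le)
    also have "\<dots> \<le> 2 * pi * (1 / L)" using rs by (intro mult_left_mono) auto
    finally show ?thesis by simp
  qed
  moreover have "card T = card (C v)" unfolding T_def by (rule card_image) (auto simp: inj_on_def)
  moreover have "s = t" if "s \<in> T" "t \<in> T" "int p dvd s - t" for s t
  proof -
    obtain x y where "x \<in> C v" "y \<in> C v" "s = x - x0" "t = y - x0" using \<open>s \<in> T\<close> \<open>t \<in> T\<close> by (auto simp: T_def)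
    with that(3) show ?thesis using dvd_diff_small [of x y] by (auto simp: C_def)
  qed
  ultimately show ?thesis using v(2) fin x0 by (intro exI [of _ T]) (auto simp: T_def)
qed

text \<open>The square expands into correlations at differences \<open>s - t\<close>. For fixed
  \<open>t\<close> these differences are distinct residues, so the sum of squared correlations over
  \<open>s\<close> is at most \<open>p * NN 1 f\<close>; Cauchy--Schwarz over the pairs
  finishes.\<close>

lemma average_over_set:
  assumes f: "fn f" and T: "finite T" "T \<noteq> {}" "\<And>s t. s \<in> T \<Longrightarrow> t \<in> T \<Longrightarrow> int p dvd s - t \<Longrightarrow> s = t"
  shows "(AV z. (cmod (\<Sum>t\<in>T. f (z + t)))\<^sup>2)\<^sup>2 \<le> real (card T) ^ 3 * (p * NN 1 f)"
proof -
  define r where "r h = av (dd h f)" for h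
  have pr: "per r"
    unfolding r_def by (rule per_map [OF per_dd [OF fn_per [OF f]]])
  have "complex_of_real (AV z. (cmod (\<Sum>t\<in>T. f (z + t)))\<^sup>2) = (AV z. \<Sum>s\<in>T. \<Sum>t\<in>T. f (z + s) * cnj (f (z + t)))"
    by (simp only: av_of_real complex_norm_square cnj_sum sum_product)
  also have "\<dots> = (\<Sum>s\<in>T. \<Sum>t\<in>T. r (s - t))"
  proof -
    have "(AV z. f (z + s) * cnj (f (z + t))) = r (s - t)" for s t
    proof -
      have "per (dd (s - t) f)" by (rule fn_per [OF fn_dd [OF f]])
      from av_shift [OF this, of t] show ?thesis by (simp add: r_def dd_def)
    qed
    then show ?thesis by (simp only: av_sum)
  qed
  finally have eq: "complex_of_real (AV z. (cmod (\<Sum>t\<in>T. f (z + t)))\<^sup>2) = (\<Sum>s\<in>T. \<Sum>t\<in>T. r (s - t))" .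
  have "(AV z. (cmod (\<Sum>t\<in>T. f (z + t)))\<^sup>2) = cmod (\<Sum>s\<in>T. \<Sum>t\<in>T. r (s - t))"
    unfolding eq [symmetric] norm_of_real by (intro abs_of_nonneg [symmetric] av_nonneg) simp
  also have "\<dots> = cmod (\<Sum>(s, t)\<in>T \<times> T. r (s - t))" by (simp add: sum.cartesian_product)
  also have "\<dots> \<le> (\<Sum>(s, t)\<in>T \<times> T. cmod (r (s - t)))"
    by (rule order_trans [OF norm_sum]) (simp add: case_prod_unfold)
  finally have "(AV z. (cmod (\<Sum>t\<in>T. f (z + t)))\<^sup>2)\<^sup>2 \<le> (\<Sum>(s, t)\<in>T \<times> T. cmod (r (s - t)))\<^sup>2"
    by (intro power_mono av_nonneg) auto
  also have "\<dots> \<le> (\<Sum>x\<in>T \<times> T. 1\<^sup>2) * (\<Sum>(s, t)\<in>T \<times> T. (cmod (r (s - t)))\<^sup>2)"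
    using Cauchy_Schwarz_ineq_sum [of "\<lambda>_. 1" "\<lambda>(s, t). cmod (r (s - t))" "T \<times> T"]
    by (simp add: case_prod_unfold)
  also have "\<dots> = real (card T) ^ 2 * (\<Sum>t\<in>T. \<Sum>s\<in>T. (cmod (r (s - t)))\<^sup>2)"
    by (simp add: sum.cartesian_product [symmetric] card_cartesian_product power2_eq_square)
       (subst sum.swap, simp)
  also have "\<dots> \<le> real (card T) ^ 2 * (\<Sum>t\<in>T. p * NN 1 f)"
  proof (intro mult_left_mono sum_mono)
    fix t assume "t \<in> T"
    have inj: "inj_on (\<lambda>s. (s - t) mod int p) T"
    proof (rule inj_onI)
      fix x y assume xy: "x \<in> T" "y \<in> T" "(x - t) mod int p = (y - t) mod int p"
      then have "int p dvd (x - t) - (y - t)" by (simp add: mod_eq_dvd_iff)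
      then show "x = y" using xy by (intro T(3)) auto
    qed
    have "(\<Sum>s\<in>T. (cmod (r (s - t)))\<^sup>2) = (\<Sum>s\<in>T. (cmod (r ((s - t) mod int p)))\<^sup>2)"
      by (simp add: per_mod [OF pr])
    also have "\<dots> = (\<Sum>h\<in>(\<lambda>s. (s - t) mod int p) ` T. (cmod (r h))\<^sup>2)" by (simp add: sum.reindex [OF inj])
    also have "\<dots> \<le> (\<Sum>h\<in>{0..<int p}. (cmod (r h))\<^sup>2)" by (intro sum_mono2) auto
    also have "\<dots> = p * NN 1 f" by (simp add: av_sum_left r_def)
    finally show "(\<Sum>s\<in>T. (cmod (r (s - t)))\<^sup>2) \<le> p * NN 1 f" .
  qed simp
  also have "\<dots> = real (card T) ^ 3 * (p * NN 1 f)" by (simp add: power2_eq_square power3_eq_cube)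
  finally show ?thesis .
qed

section \<open>Large averages\<close>

text \<open>\<open>pet\<close> applied to a conjugate translate of \<open>G\<close> as last function
  makes \<open>NN 6 G\<close> large. The premise \<open>low\<close> stands for five lowering steps,
  abstracted so that \<open>d\<close> can be fixed before p. Here 14 = 2 * 7 keeps 7 / p below half
  of \<open>e ^ 8\<close>.\<close>

lemma large_Lam_fourier:
  fixes e :: real
  assumes f: "fn f0" "fn f1" "fn f2" and G: "dual G" and e: "0 < e" "14 / e ^ 8 \<le> p"
    and le: "e \<le> cmod (Lam f0 f1 f2 (\<lambda>z. cnj (G (z + t))))"
    and low: "(e ^ 8 / 2) ^ 128 \<le> NN 6 G \<Longrightarrow> d \<le> NN 1 G"
  shows "\<exists>a. d \<le> cmod (AV z. G z * ep (a * z))"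
proof -
  have fG: "fn G" by (rule dual_fn [OF G])
  have sh: "pc (\<lambda>z. z + t)" by (intro per_intros)
  have eq: "NN 6 (\<lambda>z. cnj (G (z + t))) = NN 6 G"
    using NN_cnj [of 6 "\<lambda>z. G (z + t)"] NN_shift [OF fn_per [OF fG], of 6 t] by simp
  have "cmod (Lam f0 f1 f2 (\<lambda>z. cnj (G (z + t)))) ^ 8 \<le> root 128 (NN 6 G) + 7 / p"
    unfolding eq [symmetric] by (intro pet f fn_cnj fn_comp [OF fG sh])
  moreover have "e ^ 8 \<le> cmod (Lam f0 f1 f2 (\<lambda>z. cnj (G (z + t)))) ^ 8"
    using le e by (intro power_mono) auto
  moreover have "7 / real p \<le> e ^ 8 / 2" using e by (simp add: field_simps)
  ultimately have "e ^ 8 / 2 \<le> root 128 (NN 6 G)" by linarith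
  then have "(e ^ 8 / 2) ^ 128 \<le> root 128 (NN 6 G) ^ 128" using e by (intro power_mono) auto
  also have "\<dots> = NN 6 G" by (rule real_root_pow_pos2) (simp_all add: NN_nonneg del: NN.simps)
  finally have "d \<le> NN 1 G" by (rule low)
  moreover obtain a where "NN 1 G \<le> (cmod (AV z. G z * ep (a * z)))\<^sup>2" using NN1_le_fourier [OF fG] by blast
  moreover have "(cmod (AV z. G z * ep (a * z)))\<^sup>2 \<le> cmod (AV z. G z * ep (a * z))"
  proof -
    have "cmod (AV z. G z * ep (a * z)) \<le> 1"
      by (intro norm_av_le_const cmod_mult_le1 [OF fn_le1 [OF fG]]) simp
    then show ?thesis by (simp add: power2_eq_square mult_left_le_one_le)
  qed
  ultimately show ?thesis by (meson order_trans)
qed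

text \<open>The mean square of the dual function is at least \<open>e\<^sup>2\<close>, and it is
  itself an average of the same kind, with the conjugate dual function last. The premise
  \<open>four\<close> stands for \<open>large_Lam_fourier\<close>, used here with shift 0.\<close>

lemma large_Lam_bias:
  fixes e :: real
  assumes f: "fn f0" "fn f1" "fn f2" "fn f3" and "0 < e" "0 < d" and e: "e \<le> cmod (Lam f0 f1 f2 f3)"
    and four: "\<And>G t. dual G \<Longrightarrow> e\<^sup>2 \<le> cmod (Lam f0 f1 f2 (\<lambda>z. cnj (G (z + t))))
      \<Longrightarrow> \<exists>a. d \<le> cmod (AV z. G z * ep (a * z))"
    and g: "g = f0 \<or> g = f1 \<or> g = f2"
  shows "\<exists>\<alpha> \<beta>. d\<^sup>2 \<le> cmod (AV x. g x * ep (\<alpha> * x\<^sup>2 + \<beta> * x))"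
proof -
  let ?D = "Du f0 f1 f2"
  have fD: "fn ?D" by (intro fn_Du f)
  have "e\<^sup>2 \<le> (cmod (AV z. ?D z * f3 z))\<^sup>2"
    using e \<open>0 < e\<close> unfolding Lam_Du [OF f [THEN fn_per]] by (intro power_mono) auto
  also have "\<dots> \<le> (AV z. (cmod (?D z * f3 z))\<^sup>2)"
    using cmod_av_power_le [of _ 1] by simp
  also have "\<dots> \<le> (AV z. (cmod (?D z))\<^sup>2)"
    by (intro av_mono power_mono) (simp_all add: norm_mult fn_le1 [OF f(4)] mult_right_le_one_le)
  also have "\<dots> = cmod (complex_of_real (AV z. (cmod (?D z))\<^sup>2))"
    unfolding norm_of_real by (intro abs_of_nonneg [symmetric] av_nonneg) simp
  also have "complex_of_real (AV z. (cmod (?D z))\<^sup>2) = Lam f0 f1 f2 (\<lambda>z. cnj (?D (z + 0)))"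
    by (subst Lam_Du [OF f(1-3) [THEN fn_per]])
       (simp_all only: av_of_real complex_norm_square add_0_right fn_per [OF fn_cnj [OF fD]])
  finally obtain a where a: "d \<le> cmod (AV z. ?D z * ep (a * z))"
    using four [OF dual_Du [OF f(1-3)]] by blast
  obtain \<alpha> \<beta> where "(cmod (AV z. ?D z * ep (a * z)))\<^sup>2 \<le> cmod (AV x. g x * ep (\<alpha> * x\<^sup>2 + \<beta> * x))"
    using Du_fourier [OF f(1-3) g, of a] by blast
  moreover have "d\<^sup>2 \<le> (cmod (AV z. ?D z * ep (a * z)))\<^sup>2" using a \<open>0 < d\<close> by (intro power_mono) auto
  ultimately show ?thesis by (meson order_trans)
qed

lemma large_Lam_U2:
  fixes e :: real
  assumes f: "fn f0" "fn f1" "fn f2" "fn f3" and "0 < e" "0 < d" and e: "e \<le> cmod (Lam f0 f1 f2 f3)"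
    and L: "pi / d < real L" and N: "4 / d\<^sup>2 \<le> real N"
    and four: "\<And>G t. dual G \<Longrightarrow> e\<^sup>2 / 16 \<le> cmod (Lam f0 f1 f2 (\<lambda>z. cnj (G (z + t))))
      \<Longrightarrow> \<exists>a. d \<le> cmod (AV z. G z * ep (a * z))"
  shows "e ^ 4 / 16 \<le> real L ^ N * NN 1 f3"
proof -
  define D where "D = Du f0 f1 f2"
  have fD: "fn D" unfolding D_def by (intro fn_Du f)
  define h where "h a = cmod (AV z. D z * ep (a * z))" for a
  \<comment> \<open>The large spectrum at half the threshold; by Parseval it has at most 4 / d^2
    elements, which bounds the dimension of the Bohr set.\<close>
  define A where "A = {a \<in> {0..<int p}. d / 2 \<le> h a}"
  have "0 < pi / d" using \<open>0 < d\<close> by simp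
  then have L0: "0 < L" using L by (metis less_trans of_nat_0_less_iff)
  have finA: "finite A" unfolding A_def by (rule finite_subset [of _ "{0..<int p}"]) auto
  have cardA: "card A \<le> N"
  proof -
    have "real (card A) * (d / 2)\<^sup>2 = (\<Sum>a\<in>A. (d / 2)\<^sup>2)" by simp
    also have "\<dots> \<le> (\<Sum>a\<in>A. (h a)\<^sup>2)" using \<open>0 < d\<close> by (intro sum_mono power_mono) (auto simp: A_def)
    also have "\<dots> \<le> (\<Sum>a\<in>{0..<int p}. (h a)\<^sup>2)" by (intro sum_mono2) (auto simp: A_def)
    also have "\<dots> \<le> 1"
      unfolding h_def parseval [OF fn_per [OF fD]] by (intro av_le_const power_le_one) (auto simp: fn_le1 [OF fD])
    finally have "real (card A) \<le> 4 / d\<^sup>2" using \<open>0 < d\<close> by (simp add: field_simps power2_eq_square)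
    with N show ?thesis by linarith
  qed
  from bohr_cell [OF finA L0] obtain T where
    T': "finite T \<and> 0 \<in> T \<and> p \<le> card T * L ^ card A \<and>
      (\<forall>a\<in>A. \<forall>t\<in>T. cmod (1 - ep (a * t)) \<le> 2 * pi / L) \<and>
      (\<forall>s\<in>T. \<forall>t\<in>T. int p dvd s - t \<longrightarrow> s = t)" ..
  note T = T' [THEN conjunct1] T' [THEN conjunct2, THEN conjunct1]
    T' [THEN conjunct2, THEN conjunct2, THEN conjunct1]
    T' [THEN conjunct2, THEN conjunct2, THEN conjunct2, THEN conjunct1, rule_format]
    T' [THEN conjunct2, THEN conjunct2, THEN conjunct2, THEN conjunct2, rule_format]
  have T0: "T \<noteq> {}" "0 < card T" using T(1,2) by (auto simp: card_gt_0_iff)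
  \<comment> \<open>Weights of (D minus its average over T) / 2; the factor 1/2 keeps the total
    weight at most 1.\<close>
  define \<nu> where "\<nu> t = complex_of_real ((of_bool (t = 0) - 1 / card T) / 2)" for t :: int
  define G where "G z = (\<Sum>t\<in>T. \<nu> t * D (z - t))" for z
  have \<nu>1: "(\<Sum>t\<in>T. cmod (\<nu> t)) \<le> 1"
  proof -
    have "(\<Sum>t\<in>T. cmod (\<nu> t)) \<le> (\<Sum>t\<in>T. (of_bool (t = 0) + 1 / card T) / 2)"
    proof (intro sum_mono)
      show "cmod (\<nu> t) \<le> (of_bool (t = 0) + 1 / card T) / 2" for t
        unfolding \<nu>_def norm_of_real
        using abs_triangle_ineq4 [of "of_bool (t = 0)" "1 / real (card T)"] by simp
    qed
    also have "\<dots> = ((\<Sum>t\<in>T. of_bool (t = 0)) + (\<Sum>t\<in>T. 1 / card T)) / 2"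
      by (simp add: sum.distrib sum_divide_distrib add_divide_distrib)
    also have "(\<Sum>t\<in>T. of_bool (t = 0)) = (1::real)" using T by (simp add: of_bool_def)
    finally show ?thesis using T0 by simp
  qed
  have dG: "dual G"
    unfolding dual_def G_def D_def
    by (rule exI [of _ f0], rule exI [of _ f1], rule exI [of _ f2], rule exI [of _ T], rule exI [of _ \<nu>])
       (simp add: f \<nu>1 T(1) T0(1))
  have fG: "fn G" by (rule dual_fn [OF dG])
  have shiftD: "(AV z. D (z - t) * H z) = (AV z. D z * H (z + t))" if "per H" for t H
  proof -
    have "per (\<lambda>z. D (z - t) * H z)"
      by (intro per_intros per_comp [OF fn_per [OF fD]] that)
    from av_shift [OF this, of t] show ?thesis by simp
  qed
  have expandG: "(AV z. G z * H z) = (\<Sum>t\<in>T. \<nu> t * (AV z. D z * H (z + t)))" if "per H" for H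
  proof -
    have "(AV z. G z * H z) = (\<Sum>t\<in>T. \<nu> t * (AV z. D (z - t) * H z))"
      unfolding G_def sum_distrib_right mult.assoc by (simp only: av_sum av_cmult)
    then show ?thesis by (simp only: shiftD [OF that])
  qed
  \<comment> \<open>On the spectrum the multiplier averages (1 - ep) / 2 over T and is at most pi /
    L < d. Off the spectrum the coefficient of \<open>D\<close> is already below d / 2.\<close>
  have hatG: "cmod (AV z. G z * ep (a * z)) < d" for a
  proof -
    define a' where "a' = a mod int p"
    have ea: "ep (a * z) = ep (a' * z)" for z
      unfolding a'_def by (rule perD [OF per_ep]) (simp add: cong_def mod_mult_left_eq)
    have "(AV z. G z * ep (a' * z)) = (\<Sum>t\<in>T. \<nu> t * (AV z. D z * ep (a' * (z + t))))"
      by (rule expandG) (intro per_intros)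
    also have "\<dots> = (\<Sum>t\<in>T. \<nu> t * ep (a' * t)) * (AV z. D z * ep (a' * z))"
      by (simp add: distrib_left ep_add mult.assoc [symmetric] av_multc sum_distrib_right) (simp add: mult_ac)
    finally have eq: "cmod (AV z. G z * ep (a * z)) = cmod (\<Sum>t\<in>T. \<nu> t * ep (a' * t)) * h a'"
      by (simp add: ea h_def norm_mult)
    have h1: "h a' \<le> 1" "0 \<le> h a'"
      unfolding h_def by (intro norm_av_le_const cmod_mult_le1 [OF fn_le1 [OF fD]], simp_all)
    show ?thesis
    proof (cases "a' \<in> A")
      case True
      have "(\<Sum>t\<in>T. \<nu> t * ep (a' * t)) = (\<Sum>t\<in>T. 1 - ep (a' * t)) / of_nat (2 * card T)"
      proof -
        have "(\<Sum>t\<in>T. \<nu> t * ep (a' * t)) = (\<Sum>t\<in>T. of_bool (t = 0) * ep (a' * t) / 2 - ep (a' * t) / of_nat (2 * card T))"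
          by (intro sum.cong refl) (simp add: \<nu>_def diff_divide_distrib algebra_simps)
        also have "\<dots> = (\<Sum>t\<in>T. of_bool (t = 0) * ep (a' * t) / 2) - (\<Sum>t\<in>T. ep (a' * t)) / of_nat (2 * card T)"
          by (simp only: sum_subtractf sum_divide_distrib)
        also have "(\<Sum>t\<in>T. of_bool (t = 0) * ep (a' * t) / 2) = (\<Sum>t\<in>T. if t = 0 then 1 / 2 else 0)"
          by (intro sum.cong refl) auto
        also have "\<dots> = of_nat (card T) / of_nat (2 * card T)" using T T0 by simp
        finally show ?thesis by (simp add: sum_subtractf diff_divide_distrib)
      qed
      then have "cmod (\<Sum>t\<in>T. \<nu> t * ep (a' * t)) = cmod (\<Sum>t\<in>T. 1 - ep (a' * t)) / (2 * card T)"
        by (simp add: norm_divide norm_mult)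
      also have "\<dots> \<le> (\<Sum>t\<in>T. 2 * pi / L) / (2 * card T)"
        using T(4) [OF True] by (intro divide_right_mono order_trans [OF norm_sum] sum_mono) auto
      also have "\<dots> = pi / L" using T0 by simp
      also have "\<dots> < d" using L L0 \<open>0 < d\<close> by (simp add: field_simps)
      finally show ?thesis unfolding eq using h1
        by (meson le_less_trans mult_right_le_one_le norm_ge_zero)
    next
      case False
      then have "h a' < d / 2" by (auto simp: A_def a'_def not_le)
      moreover have "cmod (\<Sum>t\<in>T. \<nu> t * ep (a' * t)) \<le> 1"
        by (rule order_trans [OF norm_sum]) (simp add: norm_mult \<nu>1)
      ultimately show ?thesis unfolding eq using h1 \<open>0 < d\<close>
        mult_left_le_one_le [of "h a'" "cmod (\<Sum>t\<in>T. \<nu> t * ep (a' * t))"] by simp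
    qed
  qed
  \<comment> \<open>The mean square of \<open>G\<close> is a weighted sum of correlations of
    \<open>D\<close> with translates of the conjugate of \<open>G\<close>. A large one would, by
    \<open>four\<close>, give \<open>G\<close> a Fourier coefficient of size
    \<open>d\<close>.\<close>
  have G2: "(AV z. (cmod (G z))\<^sup>2) < e\<^sup>2 / 16"
  proof -
    have "(AV z. (cmod (G z))\<^sup>2) = cmod (complex_of_real (AV z. (cmod (G z))\<^sup>2))"
      unfolding norm_of_real by (intro abs_of_nonneg [symmetric] av_nonneg) simp
    also have "complex_of_real (AV z. (cmod (G z))\<^sup>2) = (AV z. G z * cnj (G z))"
      by (simp only: av_of_real complex_norm_square)
    also have "\<dots> = (\<Sum>t\<in>T. \<nu> t * (AV z. D z * cnj (G (z + t))))"
      by (rule expandG) (intro per_intros fn_per fG)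
    finally obtain t where "(AV z. (cmod (G z))\<^sup>2) \<le> cmod (AV z. D z * cnj (G (z + t)))"
      using norm_sum_le_max [OF T(1) T0(1) \<nu>1, of "\<lambda>t. AV z. D z * cnj (G (z + t))"] by auto
    also have "(AV z. D z * cnj (G (z + t))) = Lam f0 f1 f2 (\<lambda>z. cnj (G (z + t)))"
      unfolding D_def
      by (rule Lam_Du [OF f(1-3) [THEN fn_per], symmetric]) (intro per_intros per_comp [OF fn_per [OF fG]])
    also have "cmod \<dots> < e\<^sup>2 / 16"
    proof (rule ccontr)
      assume "\<not> ?thesis"
      then obtain a where "d \<le> cmod (AV z. G z * ep (a * z))" using four [OF dG, of t] by auto
      with hatG [of a] show False by simp
    qed
    finally show ?thesis .
  qed
  have bound: "(cmod (AV z. F' z * H z))\<^sup>2 \<le> (AV z. (cmod (F' z))\<^sup>2)" if "\<And>z. cmod (H z) \<le> 1" for F' H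
  proof -
    have "(cmod (AV z. F' z * H z))\<^sup>2 \<le> (AV z. (cmod (F' z * H z))\<^sup>2)"
      using cmod_av_power_le [of _ 1] by simp
    also have "\<dots> \<le> (AV z. (cmod (F' z))\<^sup>2)"
      by (intro av_mono power_mono) (simp_all add: norm_mult that mult_right_le_one_le)
    finally show ?thesis .
  qed
  have "(cmod (AV z. G z * f3 z))\<^sup>2 \<le> (AV z. (cmod (G z))\<^sup>2)" by (rule bound) (rule fn_le1 [OF f(4)])
  also note G2
  also have "e\<^sup>2 / 16 = (e / 4)\<^sup>2" by (simp add: power_divide)
  finally have Gf: "cmod (AV z. G z * f3 z) < e / 4"
    by (rule power_less_imp_less_base) (use \<open>0 < e\<close> in simp)
  define S where "S z = (\<Sum>t\<in>T. f3 (z + t))" for z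
  have "(AV z. G z * f3 z) = (\<Sum>t\<in>T. \<nu> t * (AV z. D z * f3 (z + t)))"
    by (rule expandG) (rule fn_per [OF f(4)])
  also have "\<dots> = (\<Sum>t\<in>T. (if t = 0 then (AV z. D z * f3 (z + t)) / 2 else 0) - (AV z. D z * f3 (z + t)) / of_nat (2 * card T))"
    by (intro sum.cong refl) (simp add: \<nu>_def diff_divide_distrib algebra_simps)
  also have "\<dots> = (AV z. D z * f3 z) / 2 - (AV z. D z * S z) / of_nat (2 * card T)"
    unfolding sum_subtractf sum_divide_distrib [symmetric] S_def sum_distrib_left av_sum using T by simp
  \<comment> \<open>Solving the definition of \<open>G\<close> for the averaged part, with the
    average over T moved from \<open>D\<close> to \<open>f3\<close>. The error is below e / 2 since
    the correlation of \<open>G\<close> with \<open>f3\<close> is below e / 4.\<close>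
  finally have "(AV z. S z * D z) / of_nat (card T) = Lam f0 f1 f2 f3 - 2 * (AV z. G z * f3 z)"
    unfolding Lam_Du [OF f [THEN fn_per]] D_def by (simp add: mult.commute)
  then have "cmod (AV z. S z * D z) / card T = cmod (Lam f0 f1 f2 f3 - 2 * (AV z. G z * f3 z))"
    by (metis norm_divide norm_of_nat)
  then have "cmod (Lam f0 f1 f2 f3) \<le> cmod (AV z. S z * D z) / card T + 2 * cmod (AV z. G z * f3 z)"
    using norm_triangle_ineq2 [of "Lam f0 f1 f2 f3" "2 * (AV z. G z * f3 z)"] by (simp add: norm_mult)
  with e Gf have "e / 2 \<le> cmod (AV z. S z * D z) / card T" by linarith
  then have "e / 2 * card T \<le> cmod (AV z. S z * D z)" using T0 by (simp add: field_simps)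
  then have "(e / 2 * card T)\<^sup>2 \<le> (cmod (AV z. S z * D z))\<^sup>2" using \<open>0 < e\<close> by (intro power_mono) auto
  also have "\<dots> \<le> (AV z. (cmod (S z))\<^sup>2)" by (rule bound) (rule fn_le1 [OF fD])
  finally have "((e / 2 * card T)\<^sup>2)\<^sup>2 \<le> (AV z. (cmod (S z))\<^sup>2)\<^sup>2" by (intro power_mono) auto
  also have "\<dots> \<le> real (card T) ^ 3 * (p * NN 1 f3)"
    unfolding S_def by (rule average_over_set [OF f(4) T(1) T0(1) T(5)])
  finally have "real (card T) ^ 3 * (e ^ 4 / 16 * card T) \<le> real (card T) ^ 3 * (p * NN 1 f3)"
    by (simp add: power_mult_distrib power_divide eval_nat_numeral mult_ac)
  then have "e ^ 4 / 16 * card T \<le> p * NN 1 f3" using T0 by (simp del: NN.simps)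
  \<comment> \<open>The lower bound on the size of T trades the factor p for \<open>card T\<close>,
    which then cancels.\<close>
  also have "\<dots> \<le> (card T * real L ^ N) * NN 1 f3"
  proof (intro mult_right_mono NN_nonneg)
    have "real p \<le> real (card T * L ^ card A)" using T(3) by (simp only: of_nat_le_iff)
    also have "\<dots> \<le> card T * real L ^ N" using L0 cardA by (auto intro!: mult_left_mono power_increasing)
    finally show "real p \<le> card T * real L ^ N" .
  qed
  finally have "card T * (e ^ 4 / 16) \<le> card T * (real L ^ N * NN 1 f3)" by (simp only: mult_ac)
  then show ?thesis using T0 by (simp del: NN.simps)
qed

section \<open>Translation to the residue ring\<close>

lemma one_bounded_fn: "one_bounded p f \<Longrightarrow> fn (\<lambda>x. f (x mod int p))"
  by (auto simp: one_bounded_def fn_def residue_ring_def intro: per_intros)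

lemma carrier_p: "carrier (F p) = {0..<int p}"
  by (auto simp: residue_ring_def)

lemma add_p: "x \<oplus>\<^bsub>F p\<^esub> y = (x + y) mod int p"
  by (simp add: residue_ring_def)

lemma mult_p: "x \<otimes>\<^bsub>F p\<^esub> y = (x * y) mod int p"
  by (simp add: residue_ring_def)

lemma square_p: "x [^]\<^bsub>F p\<^esub> (2::nat) = x\<^sup>2 mod int p"
  unfolding numeral_2_eq_2 nat_pow_def by (simp add: residue_ring_def mod_mult_left_eq)

lemma double_p: "[(2::nat)] \<cdot>\<^bsub>F p\<^esub> y = (2 * y) mod int p"
  unfolding numeral_2_eq_2 add_pow_def nat_pow_def
  by (simp add: residue_ring_def mod_add_left_eq)

lemma avg_av: "avg (carrier (F p)) g = av g"
  by (simp add: avg_def av_def carrier_p)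

lemma avg_av2: "avg (carrier (F p) \<times> carrier (F p)) (\<lambda>(x, y). g x y) = (AV x. AV y. g x y)"
  by (simp add: avg_def av_def carrier_p card_cartesian_product sum.cartesian_product [symmetric]
      sum_divide_distrib [symmetric])

lemma avg_av3: "avg (carrier (F p) \<times> carrier (F p) \<times> carrier (F p)) (\<lambda>(x, y, z). g x y z)
    = (AV x. AV y. AV z. g x y z)"
  by (simp add: avg_def av_def carrier_p card_cartesian_product sum.cartesian_product [symmetric]
      sum_divide_distrib [symmetric] mult.assoc)

lemma Lam_eq_avg:
  "avg (carrier (F p) \<times> carrier (F p)) (\<lambda>(x, y). f0 x * f1 (x \<oplus>\<^bsub>F p\<^esub> y) *
      f2 (x \<oplus>\<^bsub>F p\<^esub> [(2::nat)] \<cdot>\<^bsub>F p\<^esub> y) * f3 (x \<oplus>\<^bsub>F p\<^esub> y [^]\<^bsub>F p\<^esub> (2::nat)))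
    = Lam (\<lambda>x. f0 (x mod int p)) (\<lambda>x. f1 (x mod int p)) (\<lambda>x. f2 (x mod int p)) (\<lambda>x. f3 (x mod int p))"
  unfolding avg_av2 Lam_def add_p double_p square_p
  by (intro av_cong) (simp add: mod_add_right_eq)

lemma u3_norm_ge:
  "cmod (AV x. f (x mod int p) * ep (\<alpha> * x\<^sup>2 + \<beta> * x)) \<le> u3_norm p f"
proof -
  let ?a = "\<alpha> mod int p" and ?b = "\<beta> mod int p"
  define S where "S = (\<lambda>(\<alpha>, \<beta>). cmod (avg (carrier (F p))
       (\<lambda>x. f x * e_p p (\<alpha> \<otimes>\<^bsub>F p\<^esub> (x [^]\<^bsub>F p\<^esub> (2::nat)) \<oplus>\<^bsub>F p\<^esub> \<beta> \<otimes>\<^bsub>F p\<^esub> x)))) ` (carrier (F p) \<times> carrier (F p))"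
  have "(?a, ?b) \<in> carrier (F p) \<times> carrier (F p)" by (simp add: carrier_p)
  then have "cmod (avg (carrier (F p)) (\<lambda>x. f x * e_p p (?a \<otimes>\<^bsub>F p\<^esub> (x [^]\<^bsub>F p\<^esub> (2::nat)) \<oplus>\<^bsub>F p\<^esub> ?b \<otimes>\<^bsub>F p\<^esub> x))) \<in> S"
    unfolding S_def by (rule image_eqI [rotated]) simp
  moreover have "finite S" unfolding S_def carrier_p by simp
  moreover have "avg (carrier (F p)) (\<lambda>x. f x * e_p p (?a \<otimes>\<^bsub>F p\<^esub> (x [^]\<^bsub>F p\<^esub> (2::nat)) \<oplus>\<^bsub>F p\<^esub> ?b \<otimes>\<^bsub>F p\<^esub> x))
      = (AV x. f (x mod int p) * ep (\<alpha> * x\<^sup>2 + \<beta> * x))"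
    unfolding avg_av
  proof (rule av_cong)
    fix x assume "x \<in> {0..<int p}"
    then have "f x = f (x mod int p)" by simp
    moreover have "e_p p (?a \<otimes>\<^bsub>F p\<^esub> (x [^]\<^bsub>F p\<^esub> (2::nat)) \<oplus>\<^bsub>F p\<^esub> ?b \<otimes>\<^bsub>F p\<^esub> x) = ep (\<alpha> * x\<^sup>2 + \<beta> * x)"
      unfolding ep_def [symmetric] add_p mult_p square_p
      by (rule perD [OF per_ep]) (simp add: cong_def mod_simps)
    ultimately show "f x * e_p p (?a \<otimes>\<^bsub>F p\<^esub> (x [^]\<^bsub>F p\<^esub> (2::nat)) \<oplus>\<^bsub>F p\<^esub> ?b \<otimes>\<^bsub>F p\<^esub> x) = f (x mod int p) * ep (\<alpha> * x\<^sup>2 + \<beta> * x)"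
      by simp
  qed
  ultimately have "cmod (AV x. f (x mod int p) * ep (\<alpha> * x\<^sup>2 + \<beta> * x)) \<le> Max S" by simp
  then show ?thesis unfolding u3_norm_def S_def .
qed

lemma U2_norm_eq: "U2_norm p f = root 4 (NN 1 (\<lambda>x. f (x mod int p)))"
proof -
  define g where "g x = f (x mod int p)" for x
  have pg: "per (dd h g)" for h unfolding dd_def g_def
    by (intro per_intros per_comp [OF per_of_mod])
  have "U2_avg p f = (AV x. AV h1. AV h2. g x * cnj (g (x + h1)) * cnj (g (x + h2)) * g (x + h1 + h2))"
    unfolding U2_avg_def avg_av3 add_p g_def by (intro av_cong) (simp add: mod_simps)
  also have "\<dots> = (AV x. AV h1. AV h2. dd h1 g (x + h2) * cnj (dd h1 g x))"
    by (simp add: dd_def add_ac mult_ac)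
  also have "\<dots> = (AV h1. AV h2. AV x. dd h1 g (x + h2) * cnj (dd h1 g x))" by (rule av_rotate)
  also have "\<dots> = complex_of_real (NN 1 g)"
    by (simp add: av_of_real av_square_shift [OF pg] del: of_real_power)
  finally show ?thesis unfolding U2_norm_def g_def [abs_def] by simp
qed

end

section \<open>Uniformity in the prime\<close>

text \<open>Stated outside the locale because \<open>d\<close> and \<open>p0\<close> have to be
  chosen before p. Each induction step feeds the bound from \<open>dual_lowering\<close> into the
  next lower degree and enlarges \<open>p0\<close>.\<close>

lemma ex_lower:
  fixes e :: real
  assumes "0 < e"
  shows "\<exists>d>0. \<exists>p0. \<forall>p>p0. prime_field p \<longrightarrow>
    (\<forall>G. prime_field.dual p G \<longrightarrow> e \<le> prime_field.NN p (Suc n) G \<longrightarrow> d \<le> prime_field.NN p 1 G)"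
  using assms
proof (induction n arbitrary: e)
  case 0
  then show ?case by (intro exI [of _ e]) auto
next
  case (Suc n)
  define e' where "e' = (e ^ (2 ^ n * 8) / 2) ^ (2 * 2 ^ Suc n)"
  have "0 < e'" using Suc.prems by (simp add: e'_def)
  from Suc.IH [OF this] obtain d p0 where d: "d > 0" "\<And>p G. p > p0 \<Longrightarrow> prime_field p \<Longrightarrow> prime_field.dual p G \<Longrightarrow>
    e' \<le> prime_field.NN p (Suc n) G \<Longrightarrow> d \<le> prime_field.NN p 1 G" by blast
  show ?case
  proof (intro exI conjI allI impI)
    fix p G assume p: "p > max p0 (nat \<lceil>104 / e ^ (2 ^ n * 8)\<rceil>)" "prime_field p"
      and G: "prime_field.dual p G" "e \<le> prime_field.NN p (Suc (Suc n)) G"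
    have pp: "104 / e ^ (2 ^ n * 8) \<le> p" "p > p0" using p(1) by linarith+
    have "e' \<le> prime_field.NN p (Suc n) G"
      unfolding e'_def using G Suc.prems pp by (intro prime_field.dual_lowering [OF p(2)]) auto
    then show "d \<le> prime_field.NN p 1 G" by (rule d(2) [OF pp(2) p(2) G(1)])
  qed (rule d)
qed

lemma ex_fourier:
  fixes e :: real
  assumes "0 < e"
  shows "\<exists>d>0. \<exists>p0. \<forall>p>p0. prime_field p \<longrightarrow>
    (\<forall>f0 f1 f2 G t. prime_field.fn p f0 \<longrightarrow> prime_field.fn p f1 \<longrightarrow> prime_field.fn p f2 \<longrightarrow> prime_field.dual p G
      \<longrightarrow> e \<le> cmod (prime_field.Lam p f0 f1 f2 (\<lambda>z. cnj (G (z + t))))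
      \<longrightarrow> (\<exists>a. d \<le> cmod (prime_field.av p (\<lambda>z. G z * prime_field.ep p (a * z)))))"
proof -
  have "0 < (e ^ 8 / 2) ^ 128" using assms by simp
  \<comment> \<open>Five steps lead from \<open>NN 6\<close>, the U^7 norm supplied by
    \<open>pet\<close>, to \<open>NN 1\<close>.\<close>
  from ex_lower [OF this, of 5] obtain d p0 where d: "d > 0" "\<And>p G. p > p0 \<Longrightarrow> prime_field p \<Longrightarrow> prime_field.dual p G \<Longrightarrow>
    (e ^ 8 / 2) ^ 128 \<le> prime_field.NN p 6 G \<Longrightarrow> d \<le> prime_field.NN p 1 G" by auto
  show ?thesis
  proof (rule exI [of _ d], rule conjI, rule d, rule exI [of _ "max p0 (nat \<lceil>14 / e ^ 8\<rceil>)"], intro allI impI)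
    fix p f0 f1 f2 G t
    assume p: "p > max p0 (nat \<lceil>14 / e ^ 8\<rceil>)" "prime_field p"
      and f: "prime_field.fn p f0" "prime_field.fn p f1" "prime_field.fn p f2" and G: "prime_field.dual p G"
      and e: "e \<le> cmod (prime_field.Lam p f0 f1 f2 (\<lambda>z. cnj (G (z + t))))"
    have "14 / e ^ 8 \<le> p" "p > p0" using p(1) by linarith+
    then show "\<exists>a. d \<le> cmod (prime_field.av p (\<lambda>z. G z * prime_field.ep p (a * z)))"
      using prime_field.large_Lam_fourier [OF p(2) f G assms _ e] d(2) [OF _ p(2) G] by blast
  qed
qed

theorem theorem1p6:
  shows "\<forall>\<epsilon>::real. \<epsilon> > 0 \<longrightarrow> (\<exists>(\<delta>::real) (p0::nat). \<delta> > 0 \<and>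
    (\<forall>p::nat. prime p \<and> p > p0 \<longrightarrow>
      (\<forall>f0 f1 f2 f3 :: int \<Rightarrow> complex.
        one_bounded p f0 \<and> one_bounded p f1 \<and> one_bounded p f2 \<and> one_bounded p f3 \<and>
        (u3_norm p f0 \<le> \<delta> \<or> u3_norm p f1 \<le> \<delta> \<or> u3_norm p f2 \<le> \<delta> \<or> U2_norm p f3 \<le> \<delta>) \<longrightarrow>
        cmod (avg (carrier (F p) \<times> carrier (F p))
          (\<lambda>(x, y). f0 x * f1 (x \<oplus>\<^bsub>F p\<^esub> y) * f2 (x \<oplus>\<^bsub>F p\<^esub> [(2::nat)] \<cdot>\<^bsub>F p\<^esub> y)
                      * f3 (x \<oplus>\<^bsub>F p\<^esub> y [^]\<^bsub>F p\<^esub> (2::nat)))) \<le> \<epsilon>)))"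
proof (intro allI impI)
  fix \<epsilon> :: real
  assume \<epsilon>: "\<epsilon> > 0"
  then have "0 < \<epsilon>\<^sup>2" "0 < \<epsilon>\<^sup>2 / 16" by simp_all
  from ex_fourier [OF this(1)] ex_fourier [OF this(2)] obtain d1 p1 d2 p2 where
    d1: "d1 > 0" "\<forall>p>p1. prime_field p \<longrightarrow>
    (\<forall>f0 f1 f2 G t. prime_field.fn p f0 \<longrightarrow> prime_field.fn p f1 \<longrightarrow> prime_field.fn p f2 \<longrightarrow> prime_field.dual p G
      \<longrightarrow> \<epsilon>\<^sup>2 \<le> cmod (prime_field.Lam p f0 f1 f2 (\<lambda>z. cnj (G (z + t))))
      \<longrightarrow> (\<exists>a. d1 \<le> cmod (prime_field.av p (\<lambda>z. G z * prime_field.ep p (a * z)))))" and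
    d2: "d2 > 0" "\<forall>p>p2. prime_field p \<longrightarrow>
    (\<forall>f0 f1 f2 G t. prime_field.fn p f0 \<longrightarrow> prime_field.fn p f1 \<longrightarrow> prime_field.fn p f2 \<longrightarrow> prime_field.dual p G
      \<longrightarrow> \<epsilon>\<^sup>2 / 16 \<le> cmod (prime_field.Lam p f0 f1 f2 (\<lambda>z. cnj (G (z + t))))
      \<longrightarrow> (\<exists>a. d2 \<le> cmod (prime_field.av p (\<lambda>z. G z * prime_field.ep p (a * z)))))"
    by (elim exE conjE) (rule that)
  obtain L :: nat where L: "pi / d2 < real L" using reals_Archimedean2 by blast
  obtain N :: nat where N: "4 / d2\<^sup>2 \<le> real N" using real_arch_simple by blast
  have L0: "0 < real L" using L d2(1) by (meson divide_pos_pos less_trans pi_gt_zero)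
  define c where "c = \<epsilon> ^ 4 / 16 / real L ^ N"
  have c: "0 < c" using \<epsilon> L0 by (simp add: c_def)
  \<comment> \<open>The halves make the comparisons with d1^2 and \<open>c\<close> strict, and the
    bound 1 allows \<delta>^4 to be replaced by \<delta>.\<close>
  define \<delta> where "\<delta> = min (d1\<^sup>2 / 2) (min 1 (c / 2))"
  have \<delta>: "0 < \<delta>" "\<delta> \<le> 1" "\<delta> < d1\<^sup>2" "\<delta> < c" using c d1(1) by (auto simp: \<delta>_def min_def)
  show "\<exists>(\<delta>::real) (p0::nat). \<delta> > 0 \<and>
    (\<forall>p::nat. prime p \<and> p > p0 \<longrightarrow>
      (\<forall>f0 f1 f2 f3 :: int \<Rightarrow> complex.
        one_bounded p f0 \<and> one_bounded p f1 \<and> one_bounded p f2 \<and> one_bounded p f3 \<and>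
        (u3_norm p f0 \<le> \<delta> \<or> u3_norm p f1 \<le> \<delta> \<or> u3_norm p f2 \<le> \<delta> \<or> U2_norm p f3 \<le> \<delta>) \<longrightarrow>
        cmod (avg (carrier (F p) \<times> carrier (F p))
          (\<lambda>(x, y). f0 x * f1 (x \<oplus>\<^bsub>F p\<^esub> y) * f2 (x \<oplus>\<^bsub>F p\<^esub> [(2::nat)] \<cdot>\<^bsub>F p\<^esub> y)
                      * f3 (x \<oplus>\<^bsub>F p\<^esub> y [^]\<^bsub>F p\<^esub> (2::nat)))) \<le> \<epsilon>))"
  proof (rule exI [of _ \<delta>], rule exI [of _ "max 3 (max p1 p2)"], intro conjI allI impI)
    fix p :: nat and f0 f1 f2 f3 :: "int \<Rightarrow> complex"
    assume p: "prime p \<and> p > max 3 (max p1 p2)"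
      and f: "one_bounded p f0 \<and> one_bounded p f1 \<and> one_bounded p f2 \<and> one_bounded p f3 \<and>
        (u3_norm p f0 \<le> \<delta> \<or> u3_norm p f1 \<le> \<delta> \<or> u3_norm p f2 \<le> \<delta> \<or> U2_norm p f3 \<le> \<delta>)"
    then interpret prime_field p by unfold_locales auto
    have pf: "prime_field p" by unfold_locales
    define g0 g1 g2 g3 where "g0 x = f0 (x mod int p)" and "g1 x = f1 (x mod int p)"
      and "g2 x = f2 (x mod int p)" and "g3 x = f3 (x mod int p)" for x
    have g: "fn g0" "fn g1" "fn g2" "fn g3"
      unfolding g0_def g1_def g2_def g3_def using f by (auto intro: one_bounded_fn)
    have "cmod (Lam g0 g1 g2 g3) \<le> \<epsilon>"
    proof (rule ccontr)
      assume "\<not> ?thesis"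
      then have le: "\<epsilon> \<le> cmod (Lam g0 g1 g2 g3)" by simp
      have four1: "\<exists>a. d1 \<le> cmod (av (\<lambda>z. G z * ep (a * z)))"
        if "dual G" "\<epsilon>\<^sup>2 \<le> cmod (Lam g0 g1 g2 (\<lambda>z. cnj (G (z + t))))" for G t
        by (rule d1(2) [rule_format, OF _ pf g(1-3) that]) (use p in simp)
      have four2: "\<exists>a. d2 \<le> cmod (av (\<lambda>z. G z * ep (a * z)))"
        if "dual G" "\<epsilon>\<^sup>2 / 16 \<le> cmod (Lam g0 g1 g2 (\<lambda>z. cnj (G (z + t))))" for G t
        by (rule d2(2) [rule_format, OF _ pf g(1-3) that]) (use p in simp)
      have bias: "d1\<^sup>2 \<le> u3_norm p k" if "(\<lambda>x. k (x mod int p)) \<in> {g0, g1, g2}" for k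
      proof -
        have k: "(\<lambda>x. k (x mod int p)) = g0 \<or> (\<lambda>x. k (x mod int p)) = g1 \<or> (\<lambda>x. k (x mod int p)) = g2"
          using that by simp
        have "\<exists>\<alpha> \<beta>. d1\<^sup>2 \<le> cmod (av (\<lambda>x. k (x mod int p) * ep (\<alpha> * x\<^sup>2 + \<beta> * x)))"
          by (rule large_Lam_bias [OF g \<epsilon> d1(1) le four1 k])
        then obtain \<alpha> \<beta> where "d1\<^sup>2 \<le> cmod (av (\<lambda>x. k (x mod int p) * ep (\<alpha> * x\<^sup>2 + \<beta> * x)))"
          by blast
        then show ?thesis using u3_norm_ge by (rule order_trans)
      qed
      have "d1\<^sup>2 \<le> u3_norm p f0" "d1\<^sup>2 \<le> u3_norm p f1" "d1\<^sup>2 \<le> u3_norm p f2"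
        by (rule bias; simp add: g0_def [abs_def] g1_def [abs_def] g2_def [abs_def])+
      \<comment> \<open>The bias bounds rule out the first three alternatives of the hypothesis, so
        only smallness of the U^2 norm of \<open>f3\<close> is left to refute.\<close>
      with f \<delta> have U2: "U2_norm p f3 \<le> \<delta>" by auto
      have "\<epsilon> ^ 4 / 16 \<le> real L ^ N * NN 1 g3"
        by (rule large_Lam_U2 [OF g \<epsilon> d2(1) le L N four2])
      then have "c \<le> NN 1 g3" using L0 by (simp add: c_def divide_le_eq mult_ac del: NN.simps)
      also have "\<dots> = U2_norm p f3 ^ 4"
        unfolding U2_norm_eq g3_def [abs_def, symmetric]
        by (rule real_root_pow_pos2 [symmetric]) (simp_all add: NN_nonneg del: NN.simps)
      also have "\<dots> \<le> \<delta> ^ 4"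
        using U2 unfolding U2_norm_def by (intro power_mono real_root_ge_zero U2_avg_nonneg prime_p)
      also have "\<dots> \<le> \<delta>" using \<delta> power_decreasing [of 1 4 \<delta>] by simp
      finally show False using \<delta>(4) by simp
    qed
    then show "cmod (avg (carrier (F p) \<times> carrier (F p))
          (\<lambda>(x, y). f0 x * f1 (x \<oplus>\<^bsub>F p\<^esub> y) * f2 (x \<oplus>\<^bsub>F p\<^esub> [(2::nat)] \<cdot>\<^bsub>F p\<^esub> y)
                      * f3 (x \<oplus>\<^bsub>F p\<^esub> y [^]\<^bsub>F p\<^esub> (2::nat)))) \<le> \<epsilon>"
      unfolding Lam_eq_avg g0_def g1_def g2_def g3_def .
  qed (rule \<delta>)
qed

end
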